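(* Let $m\ge0$ be an integer. For $u>0$ and $0\le x<\infty$, $$W\left(-\tfrac12u,\sqrt{2u}x\right)=\left\{\frac{2\bar k^2(u)}{u(1+x^2)}\right\}^{1/4}\exp\left\{\sum_{s=1}^m(-1)^s\frac{\bar{\mathrm E}_{2s}(\bar\beta)}{u^{2s}}\right\}\cos\left\{u\bar\xi+\frac14\pi-\sum_{s=0}^m(-1)^s\frac{\bar{\mathrm E}_{2s+1}(\bar\beta)}{u^{2s+1}}+\tilde\epsilon_{2m+2,0}(u,x)\right\}\left|1+\bar\eta_{2m+2,0}(u,x)\right|,$$ $$W\left(-\tfrac12u,-\sqrt{2u}x\right)=\left\{\frac{2}{u\bar k^2(u)(1+x^2)}\right\}^{1/4}\exp\left\{\sum_{s=1}^m(-1)^s\frac{\bar{\mathrm E}_{2s}(\bar\beta)}{u^{2s}}\right\}\sin\left\{u\bar\xi+\frac14\pi-\sum_{s=0}^m(-1)^s\frac{\bar{\mathrm E}_{2s+1}(\bar\beta)}{u^{2s+1}}+\tilde\epsilon_{2m+2,0}(u,x)\right\}\left|1+\bar\eta_{2m+2,0}(u,x)\right|,$$ where $\bar k(u)=\sqrt{1+e^{-\pi u}}-e^{-\pi u/2}$, $\bar\xi,\bar\beta$ are evaluated at $z=x$, $$\tilde\epsilon_{2m+2,0}(u,x)=\arg\{1+\bar\eta_{2m+2,0}(u,x)\}-\varepsilon_m(u),\qquad\varepsilon_m(u)=\tfrac12\phi_2(u)+\frac u4\ln\left(\frac{2e}u\right)-\sum_{s=0}^m(-1)^s\frac{\bar{\mathrm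 E}_{2s+1}(1)}{u^{2s+1}}$$ (principal argument). As $u\to\infty$, $\varepsilon_m(u)=\mathcal O(u^{-2m-2})$, and $\bar\eta_{2m+2,0}(u,x)$ and $\tilde\epsilon_{2m+2,0}(u,x)$ are $\mathcal O(u^{-2m-2})$ uniformly for $0\le x<\infty$; also $\bar\eta_{2m+2,0}(u,x)\to0$ as $x\to\infty$.
   Context: $U(a,z)$ is the parabolic cylinder function: the solution of $y''-(\tfrac14z^2+a)y=0$ with $U(a,z)\sim z^{-a-1/2}e^{-z^2/4}$ as $z\to\infty$, $|\arg z|\le\frac34\pi-\delta$. For real $a,x$ the Weber function is $W(a,x)=\sqrt{2k(2a)}\,e^{\pi a/4}\,\Re\{e^{i\rho(2a)}U(ia,xe^{-\pi i/4})\}$, with $k(u)=\sqrt{1+e^{\pi u}}-e^{\pi u/2}$, $\rho(u)=\frac12\phi_2(u)+\frac18\pi$, $\phi_2(u)=\arg\Gamma(\frac12+\frac12iu)$ (continuous in $u$, $\phi_2(0)=0$). $\bar\xi=\tfrac12z\sqrt{z^2+1}+\tfrac12\ln(z+\sqrt{z^2+1})$, $\bar\beta=z/\sqrt{z^2+1}$ (positive roots for real $z$). (Bars are not complex conjugates.) $\bar{\mathrm E}_1(\bar\beta)=\frac1{24}\bar\beta(6-5\bar\beta^2)$, $\bar{\mathrm E}_2(\bar\beta)=\frac1{16}(1-\bar\beta^2)^2(5\bar\beta^2-2)$, and for $s\ge2$ $$\bar{\mathrm E}_{s+1}(\bar\beta)=-\tfrac12(1-\bar\beta^2)^2\bar{\mathrm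 E}_s'(\bar\beta)-\tfrac12\int_{\sigma(s)}^{\bar\beta}(1-p^2)^2\sum_{j=1}^{s-1}\bar{\mathrm E}_j'(p)\bar{\mathrm E}_{s-j}'(p)\,dp,$$ with $\sigma(s)=1$ for $s$ odd and $\sigma(s)=0$ for $s$ even. $\bar\eta_{2m+2,0}(u,z)$ is the function defined by $$U\left(-\tfrac12iu,\sqrt{2u}ze^{-\pi i/4}\right)=\frac{e^{-i(\hat\chi_m(u)-\frac18\pi)}e^{\pi u/8}}{(2u)^{1/4}(1+z^2)^{1/4}}\exp\left\{\sum_{s=1}^m(-1)^s\frac{\bar{\mathrm E}_{2s}(\bar\beta)}{u^{2s}}+iu\bar\xi-i\sum_{s=0}^m(-1)^s\frac{\bar{\mathrm E}_{2s+1}(\bar\beta)}{u^{2s+1}}\right\}\{1+\bar\eta_{2m+2,0}(u,z)\},$$ with $\hat\chi_m(u)=\frac u4\ln(\frac{2e}u)-\sum_{s=0}^m(-1)^s\bar{\mathrm E}_{2s+1}(1)u^{-2s-1}$. *)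

theory Defs
  imports "HOL-Complex_Analysis.Complex_Analysis" "HOL-Library.Landau_Symbols"
begin

text \<open>The \<open>\<forall>\<delta>\<close> makes the asymptotic relation hold, for each fixed \<open>\<delta>\<close>, uniformly as
  \<open>z \<rightarrow> \<infinity>\<close> in the sector. The power is the principal one.\<close>

definition is_pcf_U :: "complex \<Rightarrow> (complex \<Rightarrow> complex) \<Rightarrow> bool" where
  "is_pcf_U a y \<longleftrightarrow>
     y holomorphic_on UNIV \<and>
     (\<forall>z. deriv (deriv y) z - (1/4 * z^2 + a) * y z = 0) \<and>
     (\<forall>\<delta>>0. y \<sim>[inf at_infinity (principal {z. \<bar>Arg z\<bar> \<le> 3/4 * pi - \<delta>})]
        (\<lambda>z. z powr (- a - 1/2) * exp (- (z^2) / 4)))"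

definition pcf_U :: "complex \<Rightarrow> complex \<Rightarrow> complex" where
  "pcf_U a = (THE y. is_pcf_U a y)"

definition phi2 :: "real \<Rightarrow> real" where
  "phi2 = (THE \<phi>. continuous_on UNIV \<phi> \<and> \<phi> 0 = 0 \<and>
     (\<forall>u. is_Arg (Gamma (1/2 + \<i> * of_real u / 2)) (\<phi> u)))"

definition rho :: "real \<Rightarrow> real" where
  "rho u = 1/2 * phi2 u + 1/8 * pi"

definition weber_k :: "real \<Rightarrow> real" where
  "weber_k u = sqrt (1 + exp (pi * u)) - exp (pi * u / 2)"

definition weber_W :: "real \<Rightarrow> real \<Rightarrow> real" where
  "weber_W a x = sqrt (2 * weber_k (2 * a)) * exp (pi * a / 4) *
     Re (exp (\<i> * of_real (rho (2 * a))) *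
         pcf_U (\<i> * of_real a) (of_real x * exp (- (of_real pi * \<i> / 4))))"

definition xi_bar :: "real \<Rightarrow> real" where
  "xi_bar z = 1/2 * z * sqrt (z^2 + 1) + 1/2 * ln (z + sqrt (z^2 + 1))"

definition beta_bar :: "real \<Rightarrow> real" where
  "beta_bar z = z / sqrt (z^2 + 1)"

definition sigma :: "nat \<Rightarrow> real" where
  "sigma s = (if odd s then 1 else 0)"

text \<open>The last equation is the recursion for index \<open>s + 1\<close> with \<open>s = n + 2\<close>; the
  value at index \<open>0\<close> is a dummy. The interval integral is oriented, so it is minus the integral
  over \<open>{\<beta>..\<sigma> s}\<close> when \<open>\<beta> < \<sigma> s\<close>.\<close>

fun E_bar :: "nat \<Rightarrow> real \<Rightarrow> real" where
  "E_bar 0 \<beta> = 0"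
| "E_bar (Suc 0) \<beta> = 1/24 * \<beta> * (6 - 5 * \<beta>^2)"
| "E_bar (Suc (Suc 0)) \<beta> = 1/16 * (1 - \<beta>^2)^2 * (5 * \<beta>^2 - 2)"
| "E_bar (Suc (Suc (Suc n))) \<beta> =
     - (1/2) * (1 - \<beta>^2)^2 * deriv (\<lambda>p. E_bar (n + 2) p) \<beta>
     - 1/2 * (LBINT p=sigma (n + 2)..\<beta>. (1 - p^2)^2 *
         (\<Sum>j = 1..n + 1. deriv (\<lambda>q. E_bar j q) p * deriv (\<lambda>q. E_bar (n + 2 - j) q) p))"

lemma E_bar_rec:
  assumes "s \<ge> 2"
  shows "E_bar (s + 1) \<beta> = - (1/2) * (1 - \<beta>^2)^2 * deriv (E_bar s) \<beta>
     - 1/2 * (LBINT p=sigma s..\<beta>. (1 - p^2)^2 *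
         (\<Sum>j = 1..s - 1. deriv (E_bar j) p * deriv (E_bar (s - j)) p))"
proof -
  obtain n where "s = n + 2" using assms by (metis add.commute le_Suc_ex)
  then show ?thesis by simp
qed

definition chi_hat :: "nat \<Rightarrow> real \<Rightarrow> real" where
  "chi_hat m u = u / 4 * ln (2 * exp 1 / u) - (\<Sum>s=0..m. (-1)^s * E_bar (2 * s + 1) 1 / u^(2 * s + 1))"

definition LG_approx :: "nat \<Rightarrow> real \<Rightarrow> real \<Rightarrow> complex" where
  "LG_approx m u z =
     exp (- (\<i> * of_real (chi_hat m u - 1/8 * pi))) * of_real (exp (pi * u / 8)) /
       of_real ((2 * u) powr (1/4) * (1 + z^2) powr (1/4)) *
     exp (of_real (\<Sum>s=1..m. (-1)^s * E_bar (2 * s) (beta_bar z) / u^(2 * s))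
          + \<i> * of_real (u * xi_bar z)
          - \<i> * of_real (\<Sum>s=0..m. (-1)^s * E_bar (2 * s + 1) (beta_bar z) / u^(2 * s + 1)))"

text \<open>\<open>eta_bar m\<close> stands for \<open>\<eta>\<^bsub>2m+2,0\<^esub>\<close>; solving its defining equation for it is legitimate
  since \<open>LG_approx m u z \<noteq> 0\<close> for \<open>u > 0\<close>, see \<open>eta_bar_eq\<close>. Only real arguments are covered,
  where all roots are positive.\<close>

definition eta_bar :: "nat \<Rightarrow> real \<Rightarrow> real \<Rightarrow> complex" where
  "eta_bar m u z =
     pcf_U (- (1/2) * \<i> * of_real u) (of_real (sqrt (2 * u) * z) * exp (- (of_real pi * \<i> / 4)))
       / LG_approx m u z - 1"

lemma eta_bar_eq:
  assumes "u > 0"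
  shows "pcf_U (- (1/2) * \<i> * of_real u)
           (of_real (sqrt (2 * u) * z) * exp (- (of_real pi * \<i> / 4)))
         = LG_approx m u z * (1 + eta_bar m u z)"
proof -
  have "1 + z^2 > 0" by (simp add: add_pos_nonneg)
  then have "LG_approx m u z \<noteq> 0" using assms by (simp add: LG_approx_def)
  then show ?thesis by (simp add: eta_bar_def)
qed

definition k_bar :: "real \<Rightarrow> real" where
  "k_bar u = sqrt (1 + exp (- pi * u)) - exp (- pi * u / 2)"

definition eps :: "nat \<Rightarrow> real \<Rightarrow> real" where
  "eps m u = 1/2 * phi2 u + u / 4 * ln (2 * exp 1 / u)
     - (\<Sum>s=0..m. (-1)^s * E_bar (2 * s + 1) 1 / u^(2 * s + 1))"

definition eps_tilde :: "nat \<Rightarrow> real \<Rightarrow> real \<Rightarrow> real" where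
  "eps_tilde m u x = Arg (1 + eta_bar m u x) - eps m u"

end

theory Submission
  imports Defs "HOL-Real_Asymp.Real_Asymp"
begin

text \<open>For \<open>Re a > -1/2\<close>, \<open>U(a,z)\<close> is \<open>exp (- z\<^sup>2/4) / \<Gamma>(a + 1/2)\<close> times the integral of
  \<open>t powr (a - 1/2) * exp (- t\<^sup>2/2 - z * t)\<close> over \<open>t > 0\<close>; rotating the ray of integration gives the asymptotics in the
  whole sector.

  On the ray \<open>z = sqrt (2u) x exp (- \<pi>\<i>/4)\<close> the function solves \<open>y'' = - u\<^sup>2 (1 + x\<^sup>2) y\<close>. The quotient
  \<open>h = 1 + \<eta>\<close> of \<open>y\<close> by the truncated Liouville-Green expansion satisfies a linear equation in the variable \<open>\<xi>\<close>
  whose residual is \<open>(1 - \<beta>\<^sup>2)\<^sup>2 O(u\<^bsup>-2m-1\<^esup>)\<close>. As \<open>d\<beta> = (1 - \<beta>\<^sup>2)\<^sup>2 d\<xi>\<close> and \<open>\<beta>\<close> ranges over \<open>[0,1)\<close>, a Gronwall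
  argument started at \<open>x = \<infinity>\<close>, where \<open>h \<rightarrow> 1\<close>, bounds \<open>\<eta>\<close> uniformly in \<open>x\<close>.

  The formula for negative arguments is a connection formula between two solutions of a real equation, so it only has
  to be checked at the origin, where it follows from the duplication and reflection formulas for \<open>\<Gamma>\<close>. The same identity
  at \<open>x = 0\<close>, compared with the Liouville-Green expansion there, yields the size of \<open>\<epsilon>\<^sub>m(u)\<close> modulo \<open>\<pi>\<close>.\<close>

section \<open>The integral and its derivatives\<close>

text \<open>As \<open>pcf_U\<close> is a definite description, existence and uniqueness come before
  any statement about it. All parameters met later are purely imaginary, so
  \<open>Re a > - 1/2\<close> suffices.

  Truncation at n = 2m+1 leaves a residual O(u^(-n)), but \<open>eta_bar\<close> must be
  O(u^(-2m-2)); the missing factor 1/u has to come from the rapid oscillation. The normalisation of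
  U is known only as x tends to infinity, so the limit of U' is needed there as well; an asymptotic
  relation cannot be differentiated freely, hence that limit is taken from the integral.

  No Stirling series for \<open>phi2\<close> is used. At x = 0 the odd coefficients vanish, so the
  phase is pi/4 + \<open>eps_tilde m u 0\<close>, while the connection formula says that its tangent
  is \<open>k_bar u\<close>, which is exponentially close to 1. Hence \<open>eps_tilde m u 0\<close>
  is exponentially small modulo pi, and \<open>eps m u\<close> inherits the size of Arg (1 +
  \<open>eta_bar m u 0\<close>): the expansion of \<open>phi2\<close> is an outcome of the
  Liouville-Green bound. All that \<open>phi2\<close> itself must supply is a bounded estimate
  selecting the multiple of pi.\<close>

definition gauss_kernel :: "complex \<Rightarrow> complex \<Rightarrow> complex \<Rightarrow> real \<Rightarrow> complex" where
  "gauss_kernel \<alpha> p q t =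
     of_real t powr (\<alpha> - 1) * exp (- (p * of_real (t^2) / 2) - q * of_real t)"

text \<open>\<open>p = 0\<close> is Euler's integral, \<open>p = 1\<close> the integral behind
  U(a,z) with \<alpha> = a + 1/2; other complex \<open>p\<close> arise when the ray is
  turned.\<close>

definition gauss_int :: "complex \<Rightarrow> complex \<Rightarrow> complex \<Rightarrow> complex" where
  "gauss_int \<alpha> p q = (LBINT t:{0<..}. gauss_kernel \<alpha> p q t)"

lemma set_integrable_powr_exp:
  fixes r b :: real
  assumes "r > 0" "b > 0"
  shows "set_integrable lborel {0<..} (\<lambda>t. t powr (r - 1) * exp (- b * t))"
proof -
  have "(\<lambda>t. complex_of_real t powr (of_real r - 1) / of_real (exp (b * t))) absolutely_integrable_on {0<..}"
    using assms by (intro absolutely_integrable_Gamma_integral) auto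
  then have "set_integrable lebesgue {0<..} (\<lambda>t. norm (complex_of_real t powr (of_real r - 1) / of_real (exp (b * t))))"
    by (rule set_integrable_norm)
  also have "?this \<longleftrightarrow> set_integrable lebesgue {0<..} (\<lambda>t. t powr (r - 1) * exp (- b * t))"
    by (intro set_integrable_cong refl)
       (auto simp: norm_divide norm_powr_real_powr exp_minus field_simps)
  finally show ?thesis
    unfolding set_integrable_def by (subst (asm) integrable_completion) auto
qed

lemma set_integrable_powr_exp_gauss:
  fixes r b c :: real
  assumes "r > 0" "c > 0 \<or> c = 0 \<and> b > 0"
  shows "set_integrable lborel {0<..} (\<lambda>t. t powr (r - 1) * exp (- (c * t^2 / 2) - b * t))"
proof (cases "c = 0")
  case True
  then show ?thesis using assms set_integrable_powr_exp[of r b] by simp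
next
  case False
  then have c: "c > 0" using assms by auto
  \<comment> \<open>Completing the square: this K makes exp (K - t) a majorant of the exponential,
    whatever the sign of b.\<close>
  define K where "K = (1 - b)^2 / (2 * c)"
  have le: "- (c * t^2 / 2) - b * t \<le> K - t" for t
  proof -
    have "0 \<le> (c * t + (b - 1))^2 / (2 * c)" using c by simp
    also have "\<dots> = K - t - (- (c * t^2 / 2) - b * t)"
      using c unfolding K_def by (simp add: field_simps power2_eq_square)
    finally show ?thesis by simp
  qed
  have "set_integrable lborel {0<..} (\<lambda>t. exp K * (t powr (r - 1) * exp (- 1 * t)))"
    using set_integrable_powr_exp[of r 1] assms by (intro set_integrable_mult_right) auto
  then show ?thesis
  proof (rule set_integrable_bound)
    show "set_borel_measurable lborel {0<..} (\<lambda>t. t powr (r - 1) * exp (- (c * t^2 / 2) - b * t))"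
      unfolding set_borel_measurable_def by measurable
    have "norm (t powr (r - 1) * exp (- (c * t\<^sup>2 / 2) - b * t)) \<le> norm (exp K * (t powr (r - 1) * exp (- 1 * t)))" for t
    proof -
      have "t powr (r - 1) * exp (- (c * t\<^sup>2 / 2) - b * t) \<le> t powr (r - 1) * exp (K - t)"
        using le[of t] by (intro mult_left_mono) auto
      then show ?thesis by (simp add: exp_diff exp_minus field_simps)
    qed
    then show "AE t in lborel. t \<in> {0<..} \<longrightarrow> norm (t powr (r - 1) * exp (- (c * t\<^sup>2 / 2) - b * t))
         \<le> norm (exp K * (t powr (r - 1) * exp (- 1 * t)))" by auto
  qed
qed

lemma norm_gauss_kernel:
  "t > 0 \<Longrightarrow> norm (gauss_kernel \<alpha> p q t) = t powr (Re \<alpha> - 1) * exp (- (Re p * t^2 / 2) - Re q * t)"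
  unfolding gauss_kernel_def by (simp add: norm_mult norm_powr_real_powr)

lemma isCont_gauss_kernel: "t > 0 \<Longrightarrow> isCont (gauss_kernel \<alpha> p q) t"
  unfolding gauss_kernel_def by (intro continuous_intros) (auto simp: complex_nonpos_Reals_iff)

lemma measurable_gauss_kernel: "set_borel_measurable lborel {0<..} (gauss_kernel \<alpha> p q)"
  unfolding set_borel_measurable_def
  by (auto intro!: borel_measurable_continuous_on_indicator continuous_at_imp_continuous_on
      isCont_gauss_kernel simp del: real_scaleR_def)

lemma gauss_kernel_integrable:
  assumes "Re \<alpha> > 0" "Re p > 0 \<or> Re p = 0 \<and> Re q > 0"
  shows "set_integrable lborel {0<..} (gauss_kernel \<alpha> p q)"
  by (rule set_integrable_bound[OF set_integrable_powr_exp_gauss[OF assms] measurable_gauss_kernel])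
     (auto simp: norm_gauss_kernel)

text \<open>Differentiation in q brings down a factor t, in p a factor t^2; as shifts of \<alpha>
  these keep all derivatives inside the family \<open>gauss_int\<close>.\<close>

lemma gauss_kernel_plus_1: "t > 0 \<Longrightarrow> gauss_kernel (\<alpha> + 1) p q t = of_real t * gauss_kernel \<alpha> p q t"
  unfolding gauss_kernel_def
  by (simp add: powr_diff powr_add field_simps)

lemma gauss_kernel_plus_2:
  assumes "t > 0"
  shows "gauss_kernel (\<alpha> + 2) p q t = of_real (t^2) * gauss_kernel \<alpha> p q t"
  using gauss_kernel_plus_1[OF assms, of "\<alpha> + 1" p q] gauss_kernel_plus_1[OF assms, of \<alpha> p q]
  by (simp add: power2_eq_square add.assoc)

lemma norm_exp_minus_affine: "norm (exp w - 1 - w) \<le> norm w ^ 2 * exp (norm w)" for w :: complex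
  using Taylor_exp_field[of w 1] by (simp add: power2_eq_square algebra_simps)

text \<open>An explicit quadratic remainder takes the place of differentiation under the integral
  sign. The value p = 0 lies on the boundary of the domain of convergence, so there only q may move;
  hence the side condition on h.\<close>

lemma gauss_int_expansion:
  assumes \<alpha>: "Re \<alpha> > 0" and pq: "Re p > 0 \<or> p = 0 \<and> Re q > 0"
  obtains K \<epsilon> where "\<epsilon> > 0" "K \<ge> 0"
    "\<And>h k. norm h + norm k \<le> \<epsilon> \<Longrightarrow> (p = 0 \<Longrightarrow> h = 0) \<Longrightarrow>
      norm (gauss_int \<alpha> (p + h) (q + k) - gauss_int \<alpha> p q
            - (- h / 2 * gauss_int (\<alpha> + 2) p q - k * gauss_int (\<alpha> + 1) p q)) \<le> K * (norm h + norm k)^2"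
proof -
  \<comment> \<open>\<open>\<sigma>\<close> switches the quadratic part off when p = 0;
    \<open>\<epsilon>\<close> is half of the decay margin, so that the weakened rates c and b below
    still give an integrable majorant.\<close>
  define \<sigma> :: real where "\<sigma> = (if p = 0 then 0 else 1)"
  define \<epsilon> where "\<epsilon> = (if p = 0 then Re q / 2 else Re p / 2)"
  have \<epsilon>: "\<epsilon> > 0" using pq unfolding \<epsilon>_def by (auto split: if_splits)
  define r where "r = Re \<alpha>"
  define c where "c = Re p - \<epsilon> * \<sigma>"
  define b where "b = Re q - \<epsilon>"
  have cb: "c > 0 \<or> c = 0 \<and> b > 0" using pq unfolding c_def b_def \<epsilon>_def \<sigma>_def by auto
  \<comment> \<open>The two powers come from T^2 \<le> t^4 + 2 * t^2, with T defined below.\<close>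
  define G where "G = (\<lambda>t. t powr (r + 4 - 1) * exp (- (c * t^2 / 2) - b * t)
                  + 2 * (t powr (r + 2 - 1) * exp (- (c * t^2 / 2) - b * t)))"
  have G: "set_integrable lborel {0<..} G" unfolding G_def
    using \<alpha> cb unfolding r_def
    by (intro set_integral_add(1) set_integrable_mult_right set_integrable_powr_exp_gauss) auto
  define K where "K = (LBINT t:{0<..}. G t)"
  have main: "norm (gauss_int \<alpha> (p + h) (q + k) - gauss_int \<alpha> p q
            - (- h / 2 * gauss_int (\<alpha> + 2) p q - k * gauss_int (\<alpha> + 1) p q)) \<le> K * (norm h + norm k)^2"
    if hk: "norm h + norm k \<le> \<epsilon>" "p = 0 \<Longrightarrow> h = 0" for h k
  proof -
    define N where "N = norm h + norm k"
    have N: "N \<ge> 0" "N \<le> \<epsilon>" using hk unfolding N_def by auto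
    have dom2: "Re (p + h) > 0 \<or> Re (p + h) = 0 \<and> Re (q + k) > 0"
    proof (cases "p = 0")
      case True
      with hk have "norm k \<le> Re q / 2" "h = 0" by (auto simp: \<epsilon>_def)
      then show ?thesis using True pq abs_Re_le_cmod[of k] by (auto simp: abs_le_iff)
    next
      case False
      have "norm h \<le> \<epsilon>" using hk(1) norm_ge_zero[of k] by linarith
      then have "norm h \<le> Re p / 2" using False by (simp add: \<epsilon>_def)
      then show ?thesis using False pq abs_Re_le_cmod[of h] by (auto simp: abs_le_iff)
    qed
    have dom1: "Re p > 0 \<or> Re p = 0 \<and> Re q > 0" using pq by auto
    note I = gauss_kernel_integrable
    have i1: "set_integrable lborel {0<..} (gauss_kernel \<alpha> (p + h) (q + k))"
      "set_integrable lborel {0<..} (gauss_kernel \<alpha> p q)"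
      "set_integrable lborel {0<..} (gauss_kernel (\<alpha> + 1) p q)"
      "set_integrable lborel {0<..} (gauss_kernel (\<alpha> + 2) p q)"
      using \<alpha> dom1 dom2 by (auto intro!: I)
    define D where "D = (\<lambda>t. gauss_kernel \<alpha> (p + h) (q + k) t - gauss_kernel \<alpha> p q t
        - ((- h / 2) * gauss_kernel (\<alpha> + 2) p q t - k * gauss_kernel (\<alpha> + 1) p q t))"
    note i2 = set_integrable_mult_right[OF i1(4), of "- h / 2"] set_integrable_mult_right[OF i1(3), of k]
    have D: "set_integrable lborel {0<..} D" unfolding D_def using i1 i2
      by (intro set_integral_diff(1)) auto
    have "(LBINT t:{0<..}. D t) = gauss_int \<alpha> (p + h) (q + k) - gauss_int \<alpha> p q
            - (- h / 2 * gauss_int (\<alpha> + 2) p q - k * gauss_int (\<alpha> + 1) p q)"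
      unfolding D_def gauss_int_def
      by (simp only: set_integral_diff(2)[OF set_integral_diff(1)[OF i1(1,2)] set_integral_diff(1)[OF i2]]
            set_integral_diff(2)[OF i1(1,2)] set_integral_diff(2)[OF i2] set_integral_mult_right)
    moreover have "norm (LBINT t:{0<..}. D t) \<le> (LBINT t:{0<..}. norm (D t))"
      by (rule set_integral_norm_bound[OF D])
    moreover have "(LBINT t:{0<..}. norm (D t)) \<le> (LBINT t:{0<..}. N^2 * G t)"
    proof (rule set_integral_mono)
      show "set_integrable lborel {0<..} (\<lambda>t. norm (D t))" using D by (rule set_integrable_norm)
      show "set_integrable lborel {0<..} (\<lambda>t. N^2 * G t)" using G by auto
      fix t :: real assume "t \<in> {0<..}"
      then have t: "t > 0" by simp
      define w where "w = - (h * of_real (t^2) / 2) - k * of_real t"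
      \<comment> \<open>norm w is at most N * T, and the factor exp (\<epsilon> * T) is exactly what
        lowers Re p and Re q to c and b.\<close>
      define T where "T = \<sigma> * t^2 / 2 + t"
      have T: "T > 0" using t unfolding T_def \<sigma>_def by (auto simp: add_pos_nonneg)
      have wN: "norm w \<le> N * T"
      proof -
        have "norm w \<le> norm h * (t^2 / 2) + norm k * t"
          unfolding w_def using t norm_triangle_ineq4[of "- (h * of_real (t^2) / 2)" "k * of_real t"]
          by (simp add: norm_mult norm_divide norm_power)
        also have "norm h * (t^2/2) \<le> N * (\<sigma> * t^2 / 2)"
          using hk unfolding \<sigma>_def N_def by (auto simp: mult_right_mono)
        also have "norm k * t \<le> N * t" using t unfolding N_def by (simp add: mult_right_mono)
        finally show ?thesis unfolding T_def by (simp add: algebra_simps)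
      qed
      have "gauss_kernel \<alpha> (p + h) (q + k) t = gauss_kernel \<alpha> p q t * exp w"
      proof -
        have "- ((p + h) * of_real (t^2) / 2) - (q + k) * of_real t
            = (- (p * of_real (t^2) / 2) - q * of_real t) + w"
          unfolding w_def by (simp add: algebra_simps add_divide_distrib)
        then show ?thesis unfolding gauss_kernel_def by (simp only: exp_add mult.assoc)
      qed
      then have "D t = gauss_kernel \<alpha> p q t * (exp w - 1 - w)"
        unfolding D_def gauss_kernel_plus_1[OF t] gauss_kernel_plus_2[OF t]
        unfolding w_def by (simp add: algebra_simps)
      then have "norm (D t) \<le> norm (gauss_kernel \<alpha> p q t) * (norm w ^ 2 * exp (norm w))"
        using norm_exp_minus_affine[of w] by (simp add: norm_mult mult_left_mono)
      also have "\<dots> \<le> norm (gauss_kernel \<alpha> p q t) * ((N * T) ^ 2 * exp (\<epsilon> * T))"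
      proof -
        have "N * T \<le> \<epsilon> * T" using N T by (intro mult_right_mono) auto
        then show ?thesis using wN by (intro mult_left_mono mult_mono power_mono) auto
      qed
      also have "\<dots> = N^2 * (T^2 * (t powr (r - 1) * exp (- (c * t^2 / 2) - b * t)))"
      proof -
        have "- (c * t^2 / 2) - b * t = (- (Re p * t^2 / 2) - Re q * t) + \<epsilon> * T"
          unfolding c_def b_def T_def by (simp add: algebra_simps add_divide_distrib diff_divide_distrib)
        then have "exp (- (c * t^2 / 2) - b * t) = exp (- (Re p * t^2 / 2) - Re q * t) * exp (\<epsilon> * T)"
          by (simp only: exp_add)
        then show ?thesis
          unfolding norm_gauss_kernel[OF t] r_def by (simp add: power_mult_distrib)
      qed
      also have "\<dots> \<le> N^2 * ((t^4 + 2 * t^2) * (t powr (r - 1) * exp (- (c * t^2 / 2) - b * t)))"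
      proof -
        have "T \<le> t^2 / 2 + t" unfolding T_def \<sigma>_def using t by auto
        then have "T^2 \<le> (t^2 / 2 + t)^2" using T by (intro power_mono) auto
        also have "\<dots> \<le> t^4 + 2 * t^2"
        proof -
          have "t^4 + 2 * t^2 - (t^2/2 + t)^2 = t^2 * ((t/2 - 1)^2 + t^2/2)"
            by (simp add: power2_eq_square power4_eq_xxxx field_simps)
          moreover have "t^2 * ((t/2 - 1)^2 + t^2/2) \<ge> 0" by simp
          ultimately show ?thesis by linarith
        qed
        finally show ?thesis by (intro mult_left_mono mult_right_mono) auto
      qed
      also have "\<dots> = N^2 * G t"
      proof -
        have "t powr (r + 4 - 1) = t^4 * t powr (r - 1)" "t powr (r + 2 - 1) = t^2 * t powr (r - 1)"
          using t powr_add[of t 4 "r - 1"] powr_add[of t 2 "r - 1"] by (simp_all add: algebra_simps)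
        then show ?thesis unfolding G_def by (simp add: algebra_simps)
      qed
      finally show "norm (D t) \<le> N^2 * G t" .
    qed
    moreover have "(LBINT t:{0<..}. N^2 * G t) = N^2 * K" unfolding K_def by simp
    ultimately show ?thesis unfolding N_def[symmetric] by (metis mult.commute order_trans)
  qed
  have "K \<ge> 0" unfolding K_def set_lebesgue_integral_def G_def
    by (intro Bochner_Integration.integral_nonneg) (auto simp: indicator_def)
  with that[OF \<epsilon> _ main] show ?thesis by blast
qed


lemma DERIV_of_quadratic_bound:
  fixes f :: "complex \<Rightarrow> complex"
  assumes "\<epsilon> > 0" "\<And>k. norm k \<le> \<epsilon> \<Longrightarrow> norm (f (x + k) - f x - k * D) \<le> K * norm k ^ 2"
  shows "(f has_field_derivative D) (at x)"
proof -
  have "((\<lambda>k. (f (x + k) - f x) / k - D) \<longlongrightarrow> 0) (at 0)"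
  proof (rule Lim_null_comparison)
    have "eventually (\<lambda>k::complex. norm k \<le> \<epsilon> \<and> k \<noteq> 0) (at 0)"
      using assms(1) by (auto simp: eventually_at intro!: exI[of _ \<epsilon>])
    then show "eventually (\<lambda>k. norm ((f (x + k) - f x) / k - D) \<le> K * norm k) (at 0)"
    proof eventually_elim
      case (elim k)
      have "norm ((f (x + k) - f x) / k - D) = norm (f (x + k) - f x - k * D) / norm k"
        using elim by (simp add: norm_divide[symmetric] field_simps)
      also have "\<dots> \<le> K * norm k ^ 2 / norm k" using elim assms(2)[of k] by (intro divide_right_mono) auto
      finally show ?case using elim by (simp add: power2_eq_square)
    qed
    show "((\<lambda>k. K * norm k) \<longlongrightarrow> 0) (at (0::complex))" by (auto intro!: tendsto_eq_intros)
  qed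
  then show ?thesis unfolding DERIV_def using Lim_null by blast
qed

lemma gauss_int_deriv_q:
  assumes \<alpha>: "Re \<alpha> > 0" and pq: "Re p > 0 \<or> p = 0 \<and> Re q > 0"
  shows "((\<lambda>q. gauss_int \<alpha> p q) has_field_derivative - gauss_int (\<alpha> + 1) p q) (at q)"
proof -
  obtain K \<epsilon> where K: "\<epsilon> > 0" "K \<ge> 0"
    "\<And>h k. norm h + norm k \<le> \<epsilon> \<Longrightarrow> (p = 0 \<Longrightarrow> h = 0) \<Longrightarrow>
      norm (gauss_int \<alpha> (p + h) (q + k) - gauss_int \<alpha> p q
            - (- h / 2 * gauss_int (\<alpha> + 2) p q - k * gauss_int (\<alpha> + 1) p q)) \<le> K * (norm h + norm k)^2"
    using gauss_int_expansion[OF assms] by metis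
  show ?thesis by (rule DERIV_of_quadratic_bound[OF K(1)]) (use K(3)[of 0] in simp)
qed

text \<open>The joint derivative is needed because turning the ray moves p and q = p powr (1/2) * z
  together.\<close>

lemma gauss_int_has_derivative:
  assumes \<alpha>: "Re \<alpha> > 0" and p: "Re p > 0"
  shows "((\<lambda>(p, q). gauss_int \<alpha> p q) has_derivative
          (\<lambda>(h, k). - h / 2 * gauss_int (\<alpha> + 2) p q - k * gauss_int (\<alpha> + 1) p q)) (at (p, q))"
    (is "(?f has_derivative ?D) _")
proof -
  obtain K \<epsilon> where K: "\<epsilon> > 0" "K \<ge> 0"
    "\<And>h k. norm h + norm k \<le> \<epsilon> \<Longrightarrow> (p = 0 \<Longrightarrow> h = 0) \<Longrightarrow>
      norm (gauss_int \<alpha> (p + h) (q + k) - gauss_int \<alpha> p q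
            - (- h / 2 * gauss_int (\<alpha> + 2) p q - k * gauss_int (\<alpha> + 1) p q)) \<le> K * (norm h + norm k)^2"
    using gauss_int_expansion[of \<alpha> p q] assms by metis
  have bl: "bounded_linear ?D"
  proof -
    have "?D = (\<lambda>x. fst x * (- gauss_int (\<alpha> + 2) p q / 2) - snd x * gauss_int (\<alpha> + 1) p q)"
      by (auto simp: fun_eq_iff)
    then show ?thesis
      by (simp only:) (intro bounded_linear_sub bounded_linear_mult_const bounded_linear_fst bounded_linear_snd)
  qed
  have "((\<lambda>v. norm (?f ((p, q) + v) - ?f (p, q) - ?D v) / norm v) \<longlongrightarrow> 0) (at 0)"
  proof (rule Lim_null_comparison)
    have "eventually (\<lambda>v::complex \<times> complex. norm v \<le> \<epsilon> / 2 \<and> v \<noteq> 0) (at 0)"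
      using K(1) by (auto simp: eventually_at intro!: exI[of _ "\<epsilon> / 2"])
    then show "eventually (\<lambda>v. norm (norm (?f ((p, q) + v) - ?f (p, q) - ?D v) / norm v) \<le> (4 * K) * norm v) (at 0)"
    proof eventually_elim
      case (elim v)
      obtain h k where v: "v = (h, k)" by (cases v)
      have hk: "norm h + norm k \<le> 2 * norm v"
        unfolding v using norm_fst_le[of h k] norm_snd_le[of k h] by linarith
      have "norm (?f ((p, q) + v) - ?f (p, q) - ?D v) \<le> K * (norm h + norm k)^2"
      proof -
        have "norm h + norm k \<le> \<epsilon>" "p \<noteq> 0" using elim hk p by auto
        then show ?thesis unfolding v using K(3)[of h k] by simp
      qed
      also have "\<dots> \<le> K * (2 * norm v)^2" using hk K by (intro mult_left_mono power_mono) auto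
      finally have "norm (?f ((p, q) + v) - ?f (p, q) - ?D v) / norm v \<le> K * (2 * norm v)^2 / norm v"
        by (intro divide_right_mono) auto
      then show ?case using elim by (simp add: power2_eq_square)
    qed
    show "((\<lambda>v. 4 * K * norm v) \<longlongrightarrow> 0) (at (0::complex \<times> complex))" by (auto intro!: tendsto_eq_intros)
  qed
  then show ?thesis unfolding has_derivative_at using bl by blast
qed

lemma powr_exp_gauss_tendsto_0:
  fixes r b c :: real assumes "c > 0 \<or> c = 0 \<and> b > 0"
  shows "((\<lambda>t. t powr r * exp (- (c * t^2 / 2) - b * t)) \<longlongrightarrow> 0) at_top"
proof (cases "c = 0")
  case True
  then show ?thesis using assms by simp real_asymp
next
  case False
  then have "c > 0" using assms by auto
  then show ?thesis by real_asymp
qed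

text \<open>Integrate the derivative of \<open>gauss_kernel (\<alpha> + 1) p q\<close>: the boundary
  term at 0 vanishes because Re \<alpha> > 0, the one at infinity by decay. The identity serves
  three times: for turning the ray, for scaling at p = 0 and for the differential equation.\<close>

lemma gauss_int_recurrence:
  assumes \<alpha>: "Re \<alpha> > 0" and pq: "Re p > 0 \<or> p = 0 \<and> Re q > 0"
  shows "\<alpha> * gauss_int \<alpha> p q = p * gauss_int (\<alpha> + 2) p q + q * gauss_int (\<alpha> + 1) p q"
proof -
  have dom: "Re p > 0 \<or> Re p = 0 \<and> Re q > 0" using pq by auto
  define f where "f = (\<lambda>t. \<alpha> * gauss_kernel \<alpha> p q t -
      (p * gauss_kernel (\<alpha> + 2) p q t + q * gauss_kernel (\<alpha> + 1) p q t))"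
  have ints: "set_integrable lborel {0<..} (\<lambda>t. \<alpha> * gauss_kernel \<alpha> p q t)"
     "set_integrable lborel {0<..} (\<lambda>t. p * gauss_kernel (\<alpha> + 2) p q t)"
     "set_integrable lborel {0<..} (\<lambda>t. q * gauss_kernel (\<alpha> + 1) p q t)"
    using \<alpha> dom by (auto intro!: set_integrable_mult_right gauss_kernel_integrable)
  have "(LBINT t=ereal 0..\<infinity>. f t) = 0 - 0"
  proof (rule interval_integral_FTC_integrable[where F = "gauss_kernel (\<alpha> + 1) p q"])
    show "set_integrable lborel (einterval (ereal 0) \<infinity>) f"
      unfolding f_def using ints by simp
    fix t assume "ereal 0 < ereal t" "ereal t < \<infinity>"
    then have t: "t > 0" by simp
    show "isCont f t" unfolding f_def using t by (intro continuous_intros isCont_gauss_kernel) auto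
    have "((\<lambda>z. z powr \<alpha> * exp (- (p * z^2 / 2) - q * z)) has_field_derivative
        (\<alpha> * of_real t powr (\<alpha> - 1) * exp (- (p * of_real t^2 / 2) - q * of_real t) +
         of_real t powr \<alpha> * (exp (- (p * of_real t^2 / 2) - q * of_real t) * (- p * of_real t - q)))) (at (of_real t))"
      using t by (auto intro!: derivative_eq_intros simp: complex_nonpos_Reals_iff field_simps)
    from has_vector_derivative_real_field[OF this]
    have "((\<lambda>t. of_real t powr \<alpha> * exp (- (p * of_real t^2 / 2) - q * of_real t)) has_vector_derivative
        (\<alpha> * of_real t powr (\<alpha> - 1) * exp (- (p * of_real t^2 / 2) - q * of_real t) +
         of_real t powr \<alpha> * (exp (- (p * of_real t^2 / 2) - q * of_real t) * (- p * of_real t - q)))) (at t)" .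
    moreover have "\<alpha> * of_real t powr (\<alpha> - 1) * exp (- (p * of_real t^2 / 2) - q * of_real t) +
         of_real t powr \<alpha> * (exp (- (p * of_real t^2 / 2) - q * of_real t) * (- p * of_real t - q)) = f t"
      unfolding f_def gauss_kernel_plus_1[OF t] gauss_kernel_plus_2[OF t]
      unfolding gauss_kernel_def using t by (simp add: powr_diff field_simps power2_eq_square)
    moreover have "gauss_kernel (\<alpha> + 1) p q = (\<lambda>t. of_real t powr \<alpha> * exp (- (p * of_real t^2 / 2) - q * of_real t))"
      unfolding gauss_kernel_def by (simp add: fun_eq_iff)
    ultimately show "(gauss_kernel (\<alpha> + 1) p q has_vector_derivative f t) (at t)" by simp
  next
    have "((\<lambda>t. t powr Re \<alpha> * exp (- (Re p * t^2 / 2) - Re q * t)) \<longlongrightarrow> 0) (at_right 0)"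
      using \<alpha> by real_asymp
    moreover have "eventually (\<lambda>t. norm (gauss_kernel (\<alpha> + 1) p q t) \<le> t powr Re \<alpha> * exp (- (Re p * t^2 / 2) - Re q * t)) (at_right 0)"
      using eventually_at_right_less[of "0::real"] by eventually_elim (simp add: norm_gauss_kernel)
    ultimately have "(gauss_kernel (\<alpha> + 1) p q \<longlongrightarrow> 0) (at_right 0)"
      by (rule Lim_null_comparison[rotated])
    then show "((gauss_kernel (\<alpha> + 1) p q \<circ> real_of_ereal) \<longlongrightarrow> 0) (at_right (ereal 0))"
      by (simp add: ereal_tendsto_simps)
    have "eventually (\<lambda>t. norm (gauss_kernel (\<alpha> + 1) p q t) \<le> t powr Re \<alpha> * exp (- (Re p * t^2 / 2) - Re q * t)) at_top"
      using eventually_gt_at_top[of "0::real"] by eventually_elim (simp add: norm_gauss_kernel)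
    then have "(gauss_kernel (\<alpha> + 1) p q \<longlongrightarrow> 0) at_top"
      using powr_exp_gauss_tendsto_0[OF dom] by (rule Lim_null_comparison)
    then show "((gauss_kernel (\<alpha> + 1) p q \<circ> real_of_ereal) \<longlongrightarrow> 0) (at_left \<infinity>)"
      by (simp add: ereal_tendsto_simps)
  qed simp
  then have "(LBINT t:{0<..}. f t) = 0" by (simp add: interval_integral_to_infinity_eq zero_ereal_def[symmetric] flip: interval_integral_to_infinity_eq)
  then show ?thesis unfolding f_def gauss_int_def
    by (simp only: set_integral_diff(2)[OF ints(1) set_integral_add(1)[OF ints(2,3)]]
      set_integral_add(2)[OF ints(2,3)] set_integral_mult_right) simp
qed

section \<open>Asymptotics of the integral\<close>

text \<open>Turning the ray of integration is expressed through the parameter \<open>p\<close> (which is \<open>exp (2 * \<i> * \<psi>)\<close>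
  for the ray of angle \<open>\<psi>\<close>): the derivative in \<open>p\<close> vanishes by the recurrence, so no contour deformation
  is needed.\<close>

lemma gauss_int_rotate:
  assumes \<alpha>: "Re \<alpha> > 0" and p: "Re p > 0"
  shows "p powr (\<alpha> / 2) * gauss_int \<alpha> p (p powr (1/2) * z) = gauss_int \<alpha> 1 z"
proof -
  define H where "H = (\<lambda>p. p powr (\<alpha> / 2) * gauss_int \<alpha> p (p powr (1/2) * z))"
  have "\<exists>c. \<forall>p\<in>{p. Re p > 0}. H p = c"
  proof (rule has_field_derivative_zero_constant)
    show "convex {p. Re p > 0}" by (rule convex_halfspace_Re_gt)
    fix p assume "p \<in> {p. Re p > 0}"
    then have p: "Re p > 0" by simp
    then have p0: "p \<noteq> 0" "p \<notin> \<real>\<^sub>\<le>\<^sub>0" by (auto simp: complex_nonpos_Reals_iff)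
    define q where "q = p powr (1/2) * z"
    have dq: "((\<lambda>p. p powr (1/2) * z) has_field_derivative q / (2 * p)) (at p)"
    proof -
      have e: "p powr (1/2 - 1) = p powr (1/2) / p" using p0 by (subst powr_diff) simp
      have "((\<lambda>p. p powr (1/2) * z) has_field_derivative (1/2 * p powr (1/2 - 1)) * z) (at p)"
        using p0(2) by (intro DERIV_cmult_right has_field_derivative_powr)
      then show ?thesis unfolding q_def e by simp
    qed
    have "((\<lambda>p. (p, p powr (1/2) * z)) has_derivative (\<lambda>h. (h, q / (2 * p) * h))) (at p)"
      by (rule has_derivative_Pair[OF has_derivative_ident dq[unfolded has_field_derivative_def]])
    from has_derivative_compose[OF this gauss_int_has_derivative[OF \<alpha> p]]
    have "((\<lambda>p. gauss_int \<alpha> p (p powr (1/2) * z)) has_derivative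
       (\<lambda>h. - h / 2 * gauss_int (\<alpha> + 2) p q - q / (2 * p) * h * gauss_int (\<alpha> + 1) p q)) (at p)"
      by (simp add: q_def)
    then have "((\<lambda>p. gauss_int \<alpha> p (p powr (1/2) * z)) has_field_derivative
       (- 1 / 2 * gauss_int (\<alpha> + 2) p q - q / (2 * p) * gauss_int (\<alpha> + 1) p q)) (at p)"
      unfolding has_field_derivative_def
      by (rule has_derivative_eq_rhs) (auto simp: fun_eq_iff algebra_simps)
    moreover have "((\<lambda>p. p powr (\<alpha> / 2)) has_field_derivative \<alpha> / (2 * p) * p powr (\<alpha> / 2)) (at p)"
    proof -
      have e: "p powr (\<alpha> / 2 - 1) = p powr (\<alpha> / 2) / p" using p0 by (subst powr_diff) simp
      show ?thesis using has_field_derivative_powr[OF p0(2), of "\<alpha> / 2"] unfolding e by simp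
    qed
    ultimately have "(H has_field_derivative
        (\<alpha> / (2 * p) * p powr (\<alpha> / 2)) * gauss_int \<alpha> p q +
        (- 1 / 2 * gauss_int (\<alpha> + 2) p q - q / (2 * p) * gauss_int (\<alpha> + 1) p q) * p powr (\<alpha> / 2)) (at p)"
      unfolding H_def q_def by (rule DERIV_mult[rotated])
    moreover have "(\<alpha> / (2 * p) * p powr (\<alpha> / 2)) * gauss_int \<alpha> p q +
        (- 1 / 2 * gauss_int (\<alpha> + 2) p q - q / (2 * p) * gauss_int (\<alpha> + 1) p q) * p powr (\<alpha> / 2)
        = p powr (\<alpha> / 2) / (2 * p) *
          (\<alpha> * gauss_int \<alpha> p q - (p * gauss_int (\<alpha> + 2) p q + q * gauss_int (\<alpha> + 1) p q))"
      using p0 by (simp add: field_simps)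
    ultimately have "(H has_field_derivative 0) (at p)"
      using gauss_int_recurrence[OF \<alpha>, of p q] p by simp
    then show "(H has_field_derivative 0) (at p within {p. Re p > 0})"
      by (rule has_field_derivative_at_within)
  qed
  then obtain c where c: "\<And>p. Re p > 0 \<Longrightarrow> H p = c" by auto
  then have "H p = H 1" using p by simp
  then show ?thesis unfolding H_def by simp
qed

lemma gauss_int_0_1:
  assumes \<alpha>: "Re \<alpha> > 0"
  shows "gauss_int \<alpha> 0 1 = Gamma \<alpha>"
proof -
  have "set_integrable lborel {0<..} (gauss_kernel \<alpha> 0 1)"
    using \<alpha> by (intro gauss_kernel_integrable) auto
  then have "gauss_int \<alpha> 0 1 = integral {0<..} (gauss_kernel \<alpha> 0 1)"
    unfolding gauss_int_def by (rule set_borel_integral_eq_integral)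
  also have "gauss_kernel \<alpha> 0 1 = (\<lambda>t. of_real t powr (\<alpha> - 1) / of_real (exp t))"
    unfolding gauss_kernel_def by (auto simp: fun_eq_iff exp_minus exp_of_real field_simps)
  also have "integral {0<..} \<dots> = Gamma \<alpha>"
    by (rule integral_unique[OF Gamma_integral_complex'[OF \<alpha>]])
  finally show ?thesis .
qed

text \<open>For complex q the substitution t -> t / q would leave the real axis. Instead, q powr
  \<alpha> times the integral has derivative 0 by the recurrence at p = 0, so it equals its value at
  q = 1.\<close>

lemma gauss_int_0:
  assumes \<alpha>: "Re \<alpha> > 0" and q: "Re q > 0"
  shows "gauss_int \<alpha> 0 q = Gamma \<alpha> * q powr (- \<alpha>)"
proof -
  define H where "H = (\<lambda>q. q powr \<alpha> * gauss_int \<alpha> 0 q)"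
  have "\<exists>c. \<forall>q\<in>{q. Re q > 0}. H q = c"
  proof (rule has_field_derivative_zero_constant)
    show "convex {q. Re q > 0}" by (rule convex_halfspace_Re_gt)
    fix q assume "q \<in> {q. Re q > 0}"
    then have q: "Re q > 0" by simp
    then have q0: "q \<noteq> 0" "q \<notin> \<real>\<^sub>\<le>\<^sub>0" by (auto simp: complex_nonpos_Reals_iff)
    have "((\<lambda>q. q powr \<alpha>) has_field_derivative \<alpha> / q * q powr \<alpha>) (at q)"
      using q0 by (auto intro!: derivative_eq_intros simp: powr_diff field_simps)
    from DERIV_mult[OF this gauss_int_deriv_q[OF \<alpha>, of 0 q]] q
    have "(H has_field_derivative
        (\<alpha> / q * q powr \<alpha>) * gauss_int \<alpha> 0 q + (- gauss_int (\<alpha> + 1) 0 q) * q powr \<alpha>) (at q)"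
      unfolding H_def by simp
    moreover have "(\<alpha> / q * q powr \<alpha>) * gauss_int \<alpha> 0 q + (- gauss_int (\<alpha> + 1) 0 q) * q powr \<alpha> =
       q powr \<alpha> / q * (\<alpha> * gauss_int \<alpha> 0 q - q * gauss_int (\<alpha> + 1) 0 q)"
      using q0 by (simp add: field_simps)
    ultimately have "(H has_field_derivative 0) (at q)"
      using gauss_int_recurrence[OF \<alpha>, of 0 q] q by simp
    then show "(H has_field_derivative 0) (at q within {q. Re q > 0})"
      by (rule has_field_derivative_at_within)
  qed
  then obtain c where c: "\<And>q. Re q > 0 \<Longrightarrow> H q = c" by auto
  then have "H q = H 1" using q by simp
  then have "q powr \<alpha> * gauss_int \<alpha> 0 q = Gamma \<alpha>" unfolding H_def using gauss_int_0_1[OF \<alpha>] by simp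
  moreover have "q \<noteq> 0" using q by auto
  ultimately show ?thesis by (simp add: powr_minus field_simps)
qed

text \<open>Mean value inequality on the half plane where exp has modulus at most 1.\<close>

lemma norm_exp_minus_1_le:
  fixes w :: complex assumes "Re w \<le> 0"
  shows "norm (exp w - 1) \<le> norm w"
proof -
  have "norm (exp w - exp 0) \<le> 1 * norm (w - 0)"
  proof (rule field_differentiable_bound[where S = "{z. Re z \<le> 0}" and f' = exp])
    show "convex {z. Re z \<le> 0}" by (rule convex_halfspace_Re_le)
  qed (use assms in \<open>auto intro!: derivative_eq_intros\<close>)
  then show ?thesis by simp
qed

lemma set_integral_powr_exp:
  fixes r b :: real
  assumes "r > 0" "b > 0"
  shows "(LBINT t:{0<..}. t powr (r - 1) * exp (- b * t)) = Gamma r * b powr (- r)"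
proof -
  have "complex_of_real (LBINT t:{0<..}. t powr (r - 1) * exp (- b * t)) =
     (LBINT t:{0<..}. complex_of_real (t powr (r - 1) * exp (- b * t)))"
    by (rule set_integral_complex_of_real[symmetric])
  also have "\<dots> = gauss_int (of_real r) 0 (of_real b)"
    unfolding gauss_int_def gauss_kernel_def
  proof (intro set_lebesgue_integral_cong allI impI)
    fix t :: real assume "t \<in> {0<..}"
    then have "complex_of_real (t powr (r - 1)) = of_real t powr (of_real r - 1)"
      by (simp add: powr_of_real[symmetric])
    moreover have "complex_of_real (exp (- b * t)) = exp (of_real (- b * t))"
      by (rule exp_of_real[symmetric])
    ultimately show "complex_of_real (t powr (r - 1) * exp (- b * t)) =
        of_real t powr (of_real r - 1) * exp (- (0 * of_real (t^2) / 2) - of_real b * of_real t)"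
      by simp
  qed auto
  also have "\<dots> = of_real (Gamma r * b powr (- r))"
    using assms by (subst gauss_int_0) (auto simp: Gamma_complex_of_real powr_of_real[symmetric])
  finally show ?thesis by (simp only: of_real_eq_iff)
qed

text \<open>The quadratic exponential is compared with 1, for which the integral is exact. As Re p
  \<ge> 0 the error is at most norm p / 2 times the integral of t^(r+1) exp (- Re \<zeta> t) with r
  = Re \<alpha>, which is O(norm \<zeta>^(-r-2)) when Re \<zeta> is comparable to norm
  \<zeta>.\<close>

lemma gauss_int_asymptotic_halfplane:
  assumes \<alpha>: "Re \<alpha> > 0" and p: "Re p \<ge> 0" and c: "c > 0"
  obtains K where "\<And>\<zeta>. \<zeta> \<noteq> 0 \<Longrightarrow> Re \<zeta> \<ge> c * norm \<zeta> \<Longrightarrow>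
    norm (\<zeta> powr \<alpha> * gauss_int \<alpha> p \<zeta> - Gamma \<alpha>) \<le> K / norm \<zeta> ^ 2"
proof -
  define r where "r = Re \<alpha>"
  define K where "K = exp (pi * \<bar>Im \<alpha>\<bar>) * (norm p / 2 * (Gamma (r + 2) * c powr (- (r + 2))))"
  have r: "r > 0" using \<alpha> unfolding r_def .
  have "norm (\<zeta> powr \<alpha> * gauss_int \<alpha> p \<zeta> - Gamma \<alpha>) \<le> K / norm \<zeta> ^ 2"
    if z: "\<zeta> \<noteq> 0" and Re: "Re \<zeta> \<ge> c * norm \<zeta>" for \<zeta>
  proof -
    have pos: "Re \<zeta> > 0" using Re c z by (smt (verit) mult_pos_pos zero_less_norm_iff)
    have dom: "Re p > 0 \<or> Re p = 0 \<and> Re \<zeta> > 0" "Re (0::complex) > 0 \<or> Re (0::complex) = 0 \<and> Re \<zeta> > 0"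
      using p pos by auto
    note i = gauss_kernel_integrable[OF \<alpha> dom(1)] gauss_kernel_integrable[OF \<alpha> dom(2)]
    note d = set_integral_diff[OF i]
    have iG: "set_integrable lborel {0<..} (\<lambda>t. t powr (r + 2 - 1) * exp (- Re \<zeta> * t))"
      using r pos by (intro set_integrable_powr_exp) auto
    have "norm (gauss_int \<alpha> p \<zeta> - gauss_int \<alpha> 0 \<zeta>) \<le>
       (LBINT t:{0<..}. norm (gauss_kernel \<alpha> p \<zeta> t - gauss_kernel \<alpha> 0 \<zeta> t))"
      using set_integral_norm_bound[OF d(1)] unfolding gauss_int_def d(2) .
    also have "\<dots> \<le> (LBINT t:{0<..}. norm p / 2 * (t powr (r + 2 - 1) * exp (- Re \<zeta> * t)))"
    proof (rule set_integral_mono)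
      show "set_integrable lborel {0<..} (\<lambda>t. norm (gauss_kernel \<alpha> p \<zeta> t - gauss_kernel \<alpha> 0 \<zeta> t))"
        using d(1) by (rule set_integrable_norm)
      show "set_integrable lborel {0<..} (\<lambda>t. norm p / 2 * (t powr (r + 2 - 1) * exp (- Re \<zeta> * t)))"
        using iG by (intro set_integrable_mult_right) auto
      fix t :: real assume "t \<in> {0<..}"
      then have t: "t > 0" by simp
      define w where "w = - (p * of_real (t^2) / 2)"
      have "gauss_kernel \<alpha> p \<zeta> t = gauss_kernel \<alpha> 0 \<zeta> t * exp w"
      proof -
        have "- (p * of_real (t^2) / 2) - \<zeta> * of_real t = (- (0 * of_real (t^2) / 2) - \<zeta> * of_real t) + w"
          unfolding w_def by simp
        then show ?thesis unfolding gauss_kernel_def by (simp only: exp_add mult.assoc)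
      qed
      then have "norm (gauss_kernel \<alpha> p \<zeta> t - gauss_kernel \<alpha> 0 \<zeta> t) = norm (gauss_kernel \<alpha> 0 \<zeta> t) * norm (exp w - 1)"
        by (simp add: norm_mult[symmetric] algebra_simps)
      also have "\<dots> \<le> norm (gauss_kernel \<alpha> 0 \<zeta> t) * norm w"
        using p by (intro mult_left_mono norm_exp_minus_1_le) (auto simp: w_def)
      also have "\<dots> = norm p / 2 * (t powr (r + 2 - 1) * exp (- Re \<zeta> * t))"
        using t powr_add[of t 2 "r - 1"] unfolding norm_gauss_kernel[OF t] w_def r_def
        by (simp add: norm_mult norm_divide norm_power algebra_simps)
      finally show "norm (gauss_kernel \<alpha> p \<zeta> t - gauss_kernel \<alpha> 0 \<zeta> t) \<le> norm p / 2 * (t powr (r + 2 - 1) * exp (- Re \<zeta> * t))" .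
    qed
    also have "\<dots> = norm p / 2 * (Gamma (r + 2) * Re \<zeta> powr (- (r + 2)))"
      using r pos by (subst set_integral_mult_right, subst set_integral_powr_exp) auto
    also have "\<dots> \<le> norm p / 2 * (Gamma (r + 2) * (c * norm \<zeta>) powr (- (r + 2)))"
      using r Re c z by (intro mult_left_mono powr_mono2') (auto intro!: less_imp_le[OF Gamma_real_pos])
    finally have 1: "norm (gauss_int \<alpha> p \<zeta> - gauss_int \<alpha> 0 \<zeta>) \<le> norm p / 2 * (Gamma (r + 2) * (c * norm \<zeta>) powr (- (r + 2)))" .
    have "norm (\<zeta> powr \<alpha>) = norm \<zeta> powr r * exp (- Im \<alpha> * Arg \<zeta>)"
      unfolding r_def by (rule norm_powr_complex)
    also have "\<dots> \<le> norm \<zeta> powr r * exp (pi * \<bar>Im \<alpha>\<bar>)"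
    proof -
      have "- Im \<alpha> * Arg \<zeta> \<le> \<bar>Im \<alpha>\<bar> * \<bar>Arg \<zeta>\<bar>" by (metis abs_ge_self abs_minus_cancel abs_mult)
      also have "\<dots> \<le> \<bar>Im \<alpha>\<bar> * pi" using Arg_bounded[of \<zeta>] by (intro mult_left_mono) auto
      finally show ?thesis by (intro mult_left_mono) (auto simp: mult.commute)
    qed
    finally have 2: "norm (\<zeta> powr \<alpha>) \<le> norm \<zeta> powr r * exp (pi * \<bar>Im \<alpha>\<bar>)" .
    have "\<zeta> powr \<alpha> * gauss_int \<alpha> 0 \<zeta> = Gamma \<alpha>"
      using gauss_int_0[OF \<alpha> pos] z by (simp add: powr_minus)
    then have "norm (\<zeta> powr \<alpha> * gauss_int \<alpha> p \<zeta> - Gamma \<alpha>) = norm (\<zeta> powr \<alpha>) * norm (gauss_int \<alpha> p \<zeta> - gauss_int \<alpha> 0 \<zeta>)"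
      by (simp add: norm_mult[symmetric] algebra_simps)
    also have "\<dots> \<le> (norm \<zeta> powr r * exp (pi * \<bar>Im \<alpha>\<bar>)) * (norm p / 2 * (Gamma (r + 2) * (c * norm \<zeta>) powr (- (r + 2))))"
      using 1 2 by (intro mult_mono) auto
    also have "\<dots> = K / norm \<zeta> ^ 2"
    proof -
      have "(c * norm \<zeta>) powr (- (r + 2)) = c powr (- (r + 2)) * (1 / (norm \<zeta> powr r * norm \<zeta> ^ 2))"
      proof -
        have "norm \<zeta> powr (r + 2) = norm \<zeta> powr r * norm \<zeta> ^ 2" using z by (simp add: powr_add)
        then have "norm \<zeta> powr (- (r + 2)) = 1 / (norm \<zeta> powr r * norm \<zeta> ^ 2)"
          by (simp only: powr_minus) (simp add: divide_inverse)
        then show ?thesis using c by (simp only: powr_mult)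
      qed
      then show ?thesis unfolding K_def using z by (simp add: field_simps)
    qed
    finally show ?thesis .
  qed
  then show ?thesis using that by blast
qed

text \<open>The bound on \<psi> is what gives p = exp (2 i \<psi>) a positive real part. The
  integral at z then equals, up to a power, the one at exp (i \<psi>) z, whose argument is within
  \<theta> of the positive axis.\<close>

lemma gauss_int_asymptotic_rotated:
  assumes \<alpha>: "Re \<alpha> > 0" and \<psi>: "\<bar>\<psi>\<bar> < pi / 4" and \<theta>: "\<theta> < pi / 2"
  obtains K where "\<And>z. z \<noteq> 0 \<Longrightarrow> \<bar>Arg z + \<psi>\<bar> \<le> \<theta> \<Longrightarrow>
    norm (z powr \<alpha> * gauss_int \<alpha> 1 z - Gamma \<alpha>) \<le> K / norm z ^ 2"
proof -
  define w where "w = exp (\<i> * of_real \<psi>)"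
  define p where "p = exp (2 * \<i> * of_real \<psi>)"
  have Re_p: "Re p > 0" unfolding p_def using \<psi> by (simp add: Re_exp, intro cos_gt_zero_pi) (auto simp: abs_less_iff)
  have Lnp: "Ln p = 2 * \<i> * of_real \<psi>"
    unfolding p_def using \<psi> pi_gt_zero by (intro Ln_exp) (auto simp: abs_less_iff)
  have Lnw: "Ln w = \<i> * of_real \<psi>"
    unfolding w_def using \<psi> pi_gt_zero by (intro Ln_exp) (auto simp: abs_less_iff)
  have p0: "p \<noteq> 0" "w \<noteq> 0" unfolding p_def w_def by auto
  have p1: "p powr (1/2) = w" "p powr (\<alpha>/2) = w powr \<alpha>"
    using p0 unfolding powr_def Lnp Lnw by (simp_all add: w_def mult_ac)
  define \<theta>' where "\<theta>' = max \<theta> 0"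
  have \<theta>': "0 \<le> \<theta>'" "\<theta>' < pi / 2" "\<theta> \<le> \<theta>'" using \<theta> pi_gt_zero unfolding \<theta>'_def by (simp_all add: max_def)
  have c: "cos \<theta>' > 0" using \<theta>' by (intro cos_gt_zero_pi) auto
  obtain K where K: "\<And>\<zeta>. \<zeta> \<noteq> 0 \<Longrightarrow> Re \<zeta> \<ge> cos \<theta>' * norm \<zeta> \<Longrightarrow>
    norm (\<zeta> powr \<alpha> * gauss_int \<alpha> p \<zeta> - Gamma \<alpha>) \<le> K / norm \<zeta> ^ 2"
    using gauss_int_asymptotic_halfplane[OF \<alpha> less_imp_le[OF Re_p] c] by metis
  have "norm (z powr \<alpha> * gauss_int \<alpha> 1 z - Gamma \<alpha>) \<le> K / norm z ^ 2"
    if z: "z \<noteq> 0" and Arg: "\<bar>Arg z + \<psi>\<bar> \<le> \<theta>" for z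
  proof -
    define \<zeta> where "\<zeta> = w * z"
    have nw: "norm w = 1" unfolding w_def by simp
    have \<zeta>: "\<zeta> \<noteq> 0" "norm \<zeta> = norm z" using z p0 nw unfolding \<zeta>_def by (auto simp: norm_mult)
    have "\<zeta> = of_real (norm z) * exp (\<i> * of_real (Arg z + \<psi>))"
      unfolding \<zeta>_def w_def using Arg_eq[OF z] by (simp add: exp_add algebra_simps)
    then have "Re \<zeta> = norm z * cos (Arg z + \<psi>)" by (simp add: Re_exp)
    also have "cos (Arg z + \<psi>) = cos \<bar>Arg z + \<psi>\<bar>" by simp
    also have "norm z * \<dots> \<ge> norm z * cos \<theta>'"
      using Arg \<theta>' by (intro mult_left_mono cos_monotone_0_pi_le) auto
    finally have Re: "Re \<zeta> \<ge> cos \<theta>' * norm \<zeta>" unfolding \<zeta> by (simp add: mult.commute)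
    \<comment> \<open>The sum of the arguments stays strictly between -pi and pi, so the principal
      logarithms add without a correction.\<close>
    have "Ln \<zeta> = Ln w + Ln z"
      unfolding \<zeta>_def using p0 z Arg \<theta>' pi_gt_zero Arg_eq_Im_Ln[OF z] unfolding Lnw[symmetric]
      by (intro Ln_times_simple) (auto simp: Lnw abs_le_iff)
    then have "\<zeta> powr \<alpha> = w powr \<alpha> * z powr \<alpha>"
      using p0 z \<zeta> unfolding powr_def by (simp add: exp_add[symmetric] algebra_simps)
    then have "z powr \<alpha> * gauss_int \<alpha> 1 z = \<zeta> powr \<alpha> * gauss_int \<alpha> p \<zeta>"
      using gauss_int_rotate[OF \<alpha> Re_p, of z] unfolding p1 \<zeta>_def by simp
    then show ?thesis using K[OF \<zeta>(1) Re] \<zeta>(2) by simp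
  qed
  then show ?thesis using that by blast
qed

text \<open>The two rotations by almost \<open>\<plusminus>\<pi>/4\<close> bring every point of the sector into a closed subsector of the right
  half plane.\<close>

lemma gauss_int_asymptotic_sector:
  assumes \<alpha>: "Re \<alpha> > 0" and \<delta>: "\<delta> > 0"
  obtains K where "\<And>z. z \<noteq> 0 \<Longrightarrow> \<bar>Arg z\<bar> \<le> 3/4 * pi - \<delta> \<Longrightarrow>
    norm (z powr \<alpha> * gauss_int \<alpha> 1 z - Gamma \<alpha>) \<le> K / norm z ^ 2"
proof -
  \<comment> \<open>Turning by pi/4 - d/2 towards the positive axis takes the extreme argument 3/4
    pi - d to pi/2 - d/2, with margin d/2. The cap on d keeps the angle of rotation below pi/4 in
    absolute value.\<close>
  define d where "d = min \<delta> (pi / 4)"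
  have d: "d > 0" "d \<le> pi / 4" "d \<le> \<delta>" using \<delta> pi_gt_zero unfolding d_def by auto
  obtain K1 where K1: "\<And>z. z \<noteq> 0 \<Longrightarrow> \<bar>Arg z + (pi/4 - d/2)\<bar> \<le> pi/2 - d/2 \<Longrightarrow>
    norm (z powr \<alpha> * gauss_int \<alpha> 1 z - Gamma \<alpha>) \<le> K1 / norm z ^ 2"
    using gauss_int_asymptotic_rotated[OF \<alpha>, of "pi/4 - d/2" "pi/2 - d/2"] d by auto
  obtain K2 where K2: "\<And>z. z \<noteq> 0 \<Longrightarrow> \<bar>Arg z + (d/2 - pi/4)\<bar> \<le> pi/2 - d/2 \<Longrightarrow>
    norm (z powr \<alpha> * gauss_int \<alpha> 1 z - Gamma \<alpha>) \<le> K2 / norm z ^ 2"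
    using gauss_int_asymptotic_rotated[OF \<alpha>, of "d/2 - pi/4" "pi/2 - d/2"] d by auto
  have "norm (z powr \<alpha> * gauss_int \<alpha> 1 z - Gamma \<alpha>) \<le> max K1 K2 / norm z ^ 2"
    if z: "z \<noteq> 0" "\<bar>Arg z\<bar> \<le> 3/4 * pi - \<delta>" for z
  proof (cases "Arg z \<ge> 0")
    case True
    then have "\<bar>Arg z + (d/2 - pi/4)\<bar> \<le> pi/2 - d/2" using z d by (auto simp: abs_le_iff)
    from K2[OF z(1) this] show ?thesis by (rule order_trans) (intro divide_right_mono, auto)
  next
    case False
    then have "\<bar>Arg z + (pi/4 - d/2)\<bar> \<le> pi/2 - d/2" using z d by (auto simp: abs_le_iff)
    from K1[OF z(1) this] show ?thesis by (rule order_trans) (intro divide_right_mono, auto)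
  qed
  then show ?thesis using that by blast
qed

section \<open>The parabolic cylinder function\<close>

lemma wronskian_constant:
  fixes y1 y2 f :: "complex \<Rightarrow> complex"
  assumes "y1 holomorphic_on UNIV" "y2 holomorphic_on UNIV"
    "\<And>z. deriv (deriv y1) z = f z * y1 z" "\<And>z. deriv (deriv y2) z = f z * y2 z"
  obtains c where "\<And>z. y1 z * deriv y2 z - deriv y1 z * y2 z = c"
proof -
  have d: "(y has_field_derivative deriv y z) (at z)" "(deriv y has_field_derivative deriv (deriv y) z) (at z)"
    if "y holomorphic_on UNIV" for y :: "complex \<Rightarrow> complex" and z
    using that holomorphic_deriv[OF that open_UNIV] holomorphic_derivI[OF _ open_UNIV UNIV_I] by blast+
  have "((\<lambda>z. y1 z * deriv y2 z - deriv y1 z * y2 z) has_field_derivative 0) (at z)" for z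
    using assms(3,4)[of z] by (auto intro!: derivative_eq_intros d assms(1,2))
  then have "\<exists>c. \<forall>z\<in>UNIV. y1 z * deriv y2 z - deriv y1 z * y2 z = c"
    by (intro has_field_derivative_zero_constant) auto
  then show ?thesis using that by auto
qed

text \<open>Asymptotic equivalence counts 0/0 as 1; away from z = 0 the comparison function does not
  vanish, so the plain quotient converges too.\<close>

lemma is_pcf_U_ratio_tendsto:
  assumes "is_pcf_U a y" "\<delta> > 0"
  shows "((\<lambda>z. y z / (z powr (- a - 1/2) * exp (- (z^2) / 4))) \<longlongrightarrow> 1)
           (inf at_infinity (principal {z. \<bar>Arg z\<bar> \<le> 3/4 * pi - \<delta>}))"
proof -
  let ?F = "inf at_infinity (principal {z. \<bar>Arg z\<bar> \<le> 3/4 * pi - \<delta>})"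
  let ?E = "\<lambda>z. z powr (- a - 1/2) * exp (- (z^2) / 4)"
  have "((\<lambda>z. if y z = 0 \<and> ?E z = 0 then 1 else y z / ?E z) \<longlongrightarrow> 1) ?F"
    using assms unfolding is_pcf_U_def asymp_equiv_def by blast
  moreover have "eventually (\<lambda>z::complex. z \<noteq> 0) ?F"
    using eventually_not_equal_at_infinity by (rule filter_leD[OF inf_le1])
  then have "eventually (\<lambda>z. (if y z = 0 \<and> ?E z = 0 then 1 else y z / ?E z) = y z / ?E z) ?F"
    by eventually_elim auto
  ultimately show ?thesis by (rule Lim_transform_eventually)
qed

text \<open>\<open>is_pcf_U\<close> controls y but not its derivative. Bounding y on the whole unit
  disc around x and applying Cauchy's inequality gives the derivative the same bound.\<close>

lemma is_pcf_U_decay: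
  assumes y: "is_pcf_U a y" and a: "Re a > - 1/2"
  shows "((\<lambda>x. y (of_real x)) \<longlongrightarrow> 0) at_top" "((\<lambda>x. deriv y (of_real x)) \<longlongrightarrow> 0) at_top"
proof -
  let ?E = "\<lambda>z. z powr (- a - 1/2) * exp (- (z^2) / 4)"
  let ?S = "{z. \<bar>Arg z\<bar> \<le> 3/4 * pi - pi/4}"
  have hol: "y holomorphic_on UNIV" using y unfolding is_pcf_U_def by blast
  have "eventually (\<lambda>z. norm (y z / ?E z - 1) < 1) (inf at_infinity (principal ?S))"
    using tendstoD[OF is_pcf_U_ratio_tendsto[OF y, of "pi/4"], of 1] by (simp add: dist_norm)
  then obtain R where R: "\<And>z. norm z \<ge> R \<Longrightarrow> \<bar>Arg z\<bar> \<le> 3/4 * pi - pi/4 \<Longrightarrow> norm (y z / ?E z - 1) < 1"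
    unfolding eventually_inf_principal eventually_at_infinity by auto
  define C where "C = 2 * exp (pi * \<bar>Im a\<bar>)"
  \<comment> \<open>On the unit disc around x the real part of z^2 is at least (x - 1)^2 - 1 = x^2 -
    2x. The power of norm z is at most 1 because Re a > -1/2, and the factor 2 in C allows the
    quotient to deviate from 1 by less than 1.\<close>
  define B where "B = (\<lambda>x::real. C * exp (- (x^2 - 2 * x) / 4))"
  have bound: "norm (y z) \<le> B x" if x: "x \<ge> 2" "x \<ge> R + 1" and z: "norm (of_real x - z) \<le> 1" for x z
  proof -
    have "\<bar>x - Re z\<bar> \<le> 1" "\<bar>Im z\<bar> \<le> 1"
      using z abs_Re_le_cmod[of "of_real x - z"] abs_Im_le_cmod[of "of_real x - z"] by auto
    then have rz: "Re z \<ge> x - 1" by linarith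
    then have Rez: "Re z \<ge> 1" using x by linarith
    then have nz: "norm z \<ge> 1" "norm z \<ge> R" using rz x complex_Re_le_cmod[of z] by linarith+
    have z0: "z \<noteq> 0" using nz by auto
    have "\<bar>Arg z\<bar> < pi / 2" using Rez z0 Re_Ln_pos_lt[of z] Arg_eq_Im_Ln[OF z0] by auto
    then have "norm (y z / ?E z - 1) < 1" using nz by (intro R) auto
    then have "norm (y z / ?E z) < 2" using norm_triangle_sub[of "y z / ?E z" 1] by simp
    then have "norm (y z) \<le> 2 * norm (?E z)" using z0 by (simp add: norm_divide field_simps)
    also have "norm (?E z) = norm z powr (- Re a - 1/2) * exp (Im a * Arg z) * exp (- Re (z^2) / 4)"
      by (simp add: norm_mult norm_powr_complex)
    also have "\<dots> \<le> 1 * exp (pi * \<bar>Im a\<bar>) * exp (- (x^2 - 2 * x) / 4)"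
    proof (intro mult_mono)
      have "norm z powr (- Re a - 1/2) \<le> norm z powr 0" using nz a by (intro powr_mono) auto
      then show "norm z powr (- Re a - 1/2) \<le> 1" using z0 by simp
      have "Im a * Arg z \<le> \<bar>Im a\<bar> * \<bar>Arg z\<bar>" by (metis abs_ge_self abs_mult)
      also have "\<dots> \<le> \<bar>Im a\<bar> * pi" using Arg_bounded[of z] by (intro mult_left_mono) auto
      finally show "exp (Im a * Arg z) \<le> exp (pi * \<bar>Im a\<bar>)" by (simp add: mult.commute)
      have "(Re z)^2 \<ge> (x - 1)^2" using rz x by (intro power_mono) auto
      moreover have "(Im z)^2 \<le> 1" using \<open>\<bar>Im z\<bar> \<le> 1\<close> by (simp add: abs_square_le_1)
      moreover have "Re (z^2) = (Re z)^2 - (Im z)^2" by (simp add: power2_eq_square)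
      ultimately have "x^2 - 2 * x \<le> Re (z^2)" by (simp add: power2_diff)
      then show "exp (- Re (z^2) / 4) \<le> exp (- (x^2 - 2 * x) / 4)" by simp
    qed auto
    finally show ?thesis unfolding B_def C_def by simp
  qed
  have B: "(B \<longlongrightarrow> 0) at_top" unfolding B_def by real_asymp
  have ev: "eventually (\<lambda>x::real. x \<ge> 2 \<and> x \<ge> R + 1) at_top"
    by (intro eventually_conj eventually_ge_at_top)
  show "((\<lambda>x. y (of_real x)) \<longlongrightarrow> 0) at_top"
    by (rule Lim_null_comparison[OF _ B]) (use ev in eventually_elim, auto intro!: bound)
  show "((\<lambda>x. deriv y (of_real x)) \<longlongrightarrow> 0) at_top"
  proof (rule Lim_null_comparison[OF _ B])
    show "eventually (\<lambda>x. norm (deriv y (of_real x)) \<le> B x) at_top"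
      using ev
    proof eventually_elim
      case (elim x)
      have "norm ((deriv ^^ 1) y (of_real x)) \<le> fact 1 * B x / 1 ^ 1"
        using elim by (intro Cauchy_inequality holomorphic_on_subset[OF hol] bound
            holomorphic_on_imp_continuous_on) auto
      then show ?case by simp
    qed
  qed
qed

lemma filterlim_of_real_sector:
  assumes "\<delta> \<le> 3/4 * pi"
  shows "filterlim complex_of_real (inf at_infinity (principal {z. \<bar>Arg z\<bar> \<le> 3/4 * pi - \<delta>})) at_top"
proof -
  have "filterlim complex_of_real at_infinity at_top"
    by (rule filterlim_of_real_at_infinity)
  moreover have "eventually (\<lambda>x. complex_of_real x \<in> {z. \<bar>Arg z\<bar> \<le> 3/4 * pi - \<delta>}) at_top"
    using eventually_gt_at_top[of 0] by eventually_elim (use assms in auto)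
  ultimately show ?thesis by (simp add: filterlim_inf filterlim_principal)
qed

text \<open>Two candidates and their derivatives decay along the positive real axis, so their constant Wronskian
  is \<open>0\<close>.\<close>

theorem is_pcf_U_unique:
  assumes y1: "is_pcf_U a y1" and y2: "is_pcf_U a y2" and a: "Re a > - 1/2"
  shows "y1 = y2"
proof -
  have hol: "y1 holomorphic_on UNIV" "y2 holomorphic_on UNIV" using y1 y2 unfolding is_pcf_U_def by auto
  have ode: "deriv (deriv y1) z = (1/4 * z^2 + a) * y1 z" "deriv (deriv y2) z = (1/4 * z^2 + a) * y2 z" for z
    using y1 y2 unfolding is_pcf_U_def by auto
  obtain c0 where c0: "\<And>z. y1 z * deriv y2 z - deriv y1 z * y2 z = c0"
    using wronskian_constant[OF hol ode] by blast
  have "((\<lambda>x. y1 (of_real x) * deriv y2 (of_real x) - deriv y1 (of_real x) * y2 (of_real x)) \<longlongrightarrow> 0 * 0 - 0 * 0) at_top"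
    by (intro tendsto_intros is_pcf_U_decay[OF y1 a] is_pcf_U_decay[OF y2 a])
  then have "((\<lambda>x::real. c0) \<longlongrightarrow> 0) at_top" by (simp add: c0)
  then have c0_0: "c0 = 0" by (simp add: tendsto_const_iff)
  let ?E = "\<lambda>z. z powr (- a - 1/2) * exp (- (z^2) / 4)"
  have lim: "((\<lambda>x. y (of_real x) / ?E (of_real x)) \<longlongrightarrow> 1) at_top" if "is_pcf_U a y" for y
    using filterlim_compose[OF is_pcf_U_ratio_tendsto[OF that, of "pi/4"] filterlim_of_real_sector] by simp
  have nz: "eventually (\<lambda>x. y2 (of_real x) \<noteq> 0) at_top"
  proof -
    have "eventually (\<lambda>x. dist (y2 (of_real x) / ?E (of_real x)) 1 < 1) at_top"
      by (rule tendstoD[OF lim[OF y2]]) simp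
    then show ?thesis by eventually_elim auto
  qed
  then obtain x0 :: real where x0: "y2 (of_real x0) \<noteq> 0"
    using eventually_happens by force
  have "isCont y2 (of_real x0)"
    using hol(2) by (simp add: holomorphic_on_imp_differentiable_at field_differentiable_imp_continuous_at)
  then obtain e where e: "e > 0" "\<And>z. dist (of_real x0) z < e \<Longrightarrow> y2 z \<noteq> 0"
    using continuous_at_avoid[of "of_real x0" y2 0] x0 by blast
  \<comment> \<open>A vanishing Wronskian makes the quotient constant only where y2 has no zero,
    hence first on a ball. The identity theorem extends y1 = c * y2 to the plane, and the common
    normalisation at infinity forces c = 1.\<close>
  have "\<exists>c. \<forall>z\<in>ball (of_real x0) e. y1 z / y2 z = c"
  proof (rule has_field_derivative_zero_constant)
    show "convex (ball (complex_of_real x0) e)" by simp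
    fix z assume z: "z \<in> ball (complex_of_real x0) e"
    then have "y2 z \<noteq> 0" using e by auto
    then have "((\<lambda>z. y1 z / y2 z) has_field_derivative (deriv y1 z * y2 z - y1 z * deriv y2 z) / (y2 z * y2 z)) (at z)"
      by (intro DERIV_divide holomorphic_derivI[OF hol(1)] holomorphic_derivI[OF hol(2)]) auto
    moreover have "deriv y1 z * y2 z - y1 z * deriv y2 z = 0" using c0[of z] c0_0 by simp
    ultimately show "((\<lambda>z. y1 z / y2 z) has_field_derivative 0) (at z within ball (of_real x0) e)"
      by (simp add: has_field_derivative_at_within)
  qed
  then obtain c where c: "\<And>z. z \<in> ball (of_real x0) e \<Longrightarrow> y1 z / y2 z = c" by auto
  have eq: "y1 z = c * y2 z" for z
  proof (rule analytic_continuation_open[where s = "ball (of_real x0) e" and s' = UNIV and f = y1 and g = "\<lambda>z. c * y2 z"])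
    show "ball (complex_of_real x0) e \<noteq> {}" using e by simp
    show "y1 z = c * y2 z" if "z \<in> ball (complex_of_real x0) e" for z
      using c[OF that] e that by (auto simp: field_simps)
  qed (use hol in \<open>auto intro!: holomorphic_intros\<close>)
  have "((\<lambda>x. y1 (of_real x) / ?E (of_real x)) \<longlongrightarrow> c * 1) at_top"
    unfolding eq using tendsto_mult_left[OF lim[OF y2], of c] by simp
  with lim[OF y1] have "c = 1" using tendsto_unique[of at_top] by force
  with eq show ?thesis by auto
qed

section \<open>Existence: the integral has the required asymptotics and solves the equation\<close>

lemma Gamma_nz: "Re z > 0 \<Longrightarrow> Gamma z \<noteq> 0" for z :: complex
  by (auto simp only: Gamma_eq_zero_iff nonpos_Ints_def) auto

lemma inverse_square_tendsto_0: "((\<lambda>z. K / norm z ^ 2) \<longlongrightarrow> 0) (at_infinity :: complex filter)"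
  by (intro tendsto_divide_0[OF tendsto_const] filterlim_at_top_imp_at_infinity filterlim_pow_at_top
      filterlim_norm_at_top) simp

lemma gauss_int_tendsto_sector:
  assumes \<alpha>: "Re \<alpha> > 0" and \<delta>: "\<delta> > 0"
  shows "((\<lambda>z. z powr \<alpha> * gauss_int \<alpha> 1 z) \<longlongrightarrow> Gamma \<alpha>)
           (inf at_infinity (principal {z. \<bar>Arg z\<bar> \<le> 3/4 * pi - \<delta>}))" (is "(_ \<longlongrightarrow> _) ?F")
proof -
  obtain K where K: "\<And>z. z \<noteq> 0 \<Longrightarrow> \<bar>Arg z\<bar> \<le> 3/4 * pi - \<delta> \<Longrightarrow>
      norm (z powr \<alpha> * gauss_int \<alpha> 1 z - Gamma \<alpha>) \<le> K / norm z ^ 2"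
    using gauss_int_asymptotic_sector[OF \<alpha> \<delta>] by metis
  have "eventually (\<lambda>z. norm (z powr \<alpha> * gauss_int \<alpha> 1 z - Gamma \<alpha>) \<le> K / norm z ^ 2) ?F"
    unfolding eventually_inf_principal using eventually_not_equal_at_infinity[of 0]
    by eventually_elim (use K in auto)
  then have "((\<lambda>z. z powr \<alpha> * gauss_int \<alpha> 1 z - Gamma \<alpha>) \<longlongrightarrow> 0) ?F"
    using tendsto_mono[OF inf_le1 inverse_square_tendsto_0] by (rule Lim_null_comparison)
  then show ?thesis by (simp add: LIM_zero_iff)
qed

definition pcf_int :: "complex \<Rightarrow> complex \<Rightarrow> complex" where
  "pcf_int a z = exp (- (z^2) / 4) * gauss_int (a + 1/2) 1 z / Gamma (a + 1/2)"

text \<open>The derivative of \<open>pcf_int\<close>, kept in closed form because its value at the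
  origin and its own behaviour at infinity are used later.\<close>

definition pcf_int' :: "complex \<Rightarrow> complex \<Rightarrow> complex" where
  "pcf_int' a z = - exp (- (z^2) / 4) *
     (z / 2 * gauss_int (a + 1/2) 1 z + gauss_int (a + 3/2) 1 z) / Gamma (a + 1/2)"

lemma DERIV_gaussian_mult:
  fixes g :: "complex \<Rightarrow> complex"
  assumes "(g has_field_derivative g') (at z)"
  shows "((\<lambda>z. exp (- (z^2) / 4) * g z) has_field_derivative exp (- (z^2) / 4) * (g' - z / 2 * g z)) (at z)"
  by (rule DERIV_cong, (rule derivative_eq_intros assms refl | simp)+) (simp add: algebra_simps)

context
  fixes a :: complex
  assumes a: "Re a > - 1/2"
begin

lemma pcf_int_deriv: "(pcf_int a has_field_derivative pcf_int' a z) (at z)"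
proof -
  have "((\<lambda>q. gauss_int (a + 1/2) 1 q) has_field_derivative - gauss_int (a + 3/2) 1 z) (at z)"
    using gauss_int_deriv_q[of "a + 1/2" 1 z] a by (simp add: add.commute)
  from DERIV_cdivide[OF DERIV_gaussian_mult[OF this], of "Gamma (a + 1/2)"]
  show ?thesis unfolding pcf_int_def[abs_def] pcf_int'_def by (rule DERIV_cong) (simp add: algebra_simps)
qed

lemma pcf_int'_deriv: "(pcf_int' a has_field_derivative (1/4 * z^2 + a) * pcf_int a z) (at z)"
proof -
  define g0 where "g0 = gauss_int (a + 1/2) 1"
  define g1 where "g1 = gauss_int (a + 3/2) 1"
  define g2 where "g2 = gauss_int (a + 5/2) 1"
  have d: "(g0 has_field_derivative - g1 z) (at z)" "(g1 has_field_derivative - g2 z) (at z)"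
    using gauss_int_deriv_q[of "a + 1/2" 1 z] gauss_int_deriv_q[of "a + 3/2" 1 z] a
    by (simp_all add: g0_def g1_def g2_def add.commute)
  \<comment> \<open>The recurrence at p = 1 eliminates the third integral; this is the source of the
    parabolic cylinder equation.\<close>
  have rec: "g2 z = (a + 1/2) * g0 z - z * g1 z"
    using gauss_int_recurrence[of "a + 1/2" 1 z] a by (simp add: g0_def g1_def g2_def add.commute)
  have "((\<lambda>z. z / 2 * g0 z + g1 z) has_field_derivative 1 / 2 * g0 z - z / 2 * g1 z - g2 z) (at z)"
    by (rule DERIV_cong, (rule derivative_eq_intros d refl | simp)+)
  from DERIV_cdivide[OF DERIV_minus[OF DERIV_gaussian_mult[OF this]], of "Gamma (a + 1/2)"]
  have "(pcf_int' a has_field_derivative - (exp (- (z^2) / 4) * (1 / 2 * g0 z - z / 2 * g1 z - g2 z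
      - z / 2 * (z / 2 * g0 z + g1 z))) / Gamma (a + 1/2)) (at z)"
    unfolding pcf_int'_def[abs_def] by (simp add: g0_def g1_def)
  also have "1 / 2 * g0 z - z / 2 * g1 z - g2 z - z / 2 * (z / 2 * g0 z + g1 z) = - ((1/4 * z^2 + a) * g0 z)"
    unfolding rec by (simp add: algebra_simps power2_eq_square)
  finally show ?thesis unfolding pcf_int_def g0_def by (simp add: mult_ac)
qed

lemma is_pcf_U_pcf_int: "is_pcf_U a (pcf_int a)"
proof -
  have d1: "deriv (pcf_int a) = pcf_int' a" using pcf_int_deriv DERIV_imp_deriv by blast
  have d2: "deriv (pcf_int' a) z = (1/4 * z^2 + a) * pcf_int a z" for z
    using pcf_int'_deriv DERIV_imp_deriv by blast
  have \<alpha>: "Re (a + 1/2) > 0" using a by simp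
  have G0: "Gamma (a + 1/2) \<noteq> 0"
    using \<alpha> by (rule Gamma_nz)
  show ?thesis unfolding is_pcf_U_def
  proof (intro conjI allI impI)
    show "pcf_int a holomorphic_on UNIV"
      by (rule holomorphic_onI) (metis field_differentiable_def pcf_int_deriv field_differentiable_at_within)
    show "deriv (deriv (pcf_int a)) z - (1 / 4 * z\<^sup>2 + a) * pcf_int a z = 0" for z
      unfolding d1 d2 by simp
    fix \<delta> :: real assume \<delta>: "\<delta> > 0"
    let ?F = "inf at_infinity (principal {z. \<bar>Arg z\<bar> \<le> 3/4 * pi - \<delta>})"
    show "pcf_int a \<sim>[?F] (\<lambda>z. z powr (- a - 1/2) * exp (- (z^2) / 4))"
    proof (rule asymp_equivI')
      have "((\<lambda>z. z powr (a + 1/2) * gauss_int (a + 1/2) 1 z / Gamma (a + 1/2)) \<longlongrightarrow> Gamma (a + 1/2) / Gamma (a + 1/2)) ?F"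
        using G0 by (intro tendsto_divide gauss_int_tendsto_sector \<alpha> \<delta> tendsto_const)
      then have "((\<lambda>z. z powr (a + 1/2) * gauss_int (a + 1/2) 1 z / Gamma (a + 1/2)) \<longlongrightarrow> 1) ?F"
        using G0 by simp
      moreover have "z powr (a + 1/2) * gauss_int (a + 1/2) 1 z / Gamma (a + 1/2) =
          pcf_int a z / (z powr (- a - 1/2) * exp (- (z^2) / 4))" for z
      proof -
        have "z powr (- a - 1/2) = inverse (z powr (a + 1/2))"
          using powr_minus[of z "a + 1/2"] by simp
        then show ?thesis unfolding pcf_int_def by (simp add: field_simps)
      qed
      ultimately show "((\<lambda>z. pcf_int a z / (z powr (- a - 1/2) * exp (- (z^2) / 4))) \<longlongrightarrow> 1) ?F"
        by simp
    qed
  qed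
qed

theorem is_pcf_U_pcf_U: "is_pcf_U a (pcf_U a)"
  unfolding pcf_U_def by (rule theI[of "is_pcf_U a", OF is_pcf_U_pcf_int]) (rule is_pcf_U_unique[OF _ is_pcf_U_pcf_int a])

theorem pcf_U_eq: "pcf_U a = pcf_int a"
  by (rule is_pcf_U_unique[OF is_pcf_U_pcf_U is_pcf_U_pcf_int a])

end

text \<open>The substitution s = t^2 / 2 turns the Gaussian moment into Euler's integral with
  exponent \<alpha> / 2.\<close>

lemma gauss_int_at_0:
  assumes \<alpha>: "Re \<alpha> > 0"
  shows "gauss_int \<alpha> 1 0 = 2 powr (\<alpha> / 2 - 1) * Gamma (\<alpha> / 2)"
proof -
  define f where "f = (\<lambda>s. 2 powr (\<alpha> / 2 - 1) * gauss_kernel (\<alpha> / 2) 0 1 s)"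
  have eq: "t *\<^sub>R f (t^2 / 2) = gauss_kernel \<alpha> 1 0 t" if t: "t > 0" for t :: real
  proof -
    have L: "Ln (complex_of_real (t^2 / 2)) = of_real (2 * ln t - ln 2)"
      using t by (subst Ln_of_real) (auto simp: ln_div ln_realpow)
    have L2: "Ln (2::complex) = of_real (ln 2)" using Ln_of_real[of 2] by simp
    have L3: "Ln (complex_of_real t) = of_real (ln t)" using t by (rule Ln_of_real)
    have et: "complex_of_real t = exp (of_real (ln t))" using t by (simp add: exp_of_real)
    have "t *\<^sub>R f (t^2 / 2) = exp (of_real (ln t)) * exp ((\<alpha> / 2 - 1) * of_real (ln 2)) *
        exp ((\<alpha> / 2 - 1) * of_real (2 * ln t - ln 2)) * exp (- of_real (t^2 / 2))"
      unfolding f_def gauss_kernel_def using t L by (simp add: scaleR_conv_of_real powr_def L2 et[symmetric] L3 mult_ac)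
    also have "\<dots> = exp ((\<alpha> - 1) * of_real (ln t)) * exp (- of_real (t^2 / 2))"
      by (simp add: exp_add[symmetric] algebra_simps)
    also have "\<dots> = gauss_kernel \<alpha> 1 0 t"
      unfolding gauss_kernel_def using t by (simp add: powr_def L3)
    finally show ?thesis .
  qed
  have int1: "set_integrable lborel {0<..} (gauss_kernel \<alpha> 1 0)"
    using \<alpha> by (intro gauss_kernel_integrable) auto
  have int2: "set_integrable lborel {0<..} f"
    unfolding f_def using \<alpha> by (intro set_integrable_mult_right gauss_kernel_integrable) auto
  have "(LBINT s=ereal 0..\<infinity>. f s) = (LBINT t=ereal 0..\<infinity>. t *\<^sub>R f (t^2 / 2))"
  proof (rule interval_integral_substitution_integrable)
    show "DERIV (\<lambda>t. t^2 / 2) x :> x" for x :: real by (auto intro!: derivative_eq_intros)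
    show "isCont f (x^2 / 2)" if "ereal 0 < ereal x" for x
      unfolding f_def using that by (intro continuous_intros isCont_gauss_kernel) auto
    have "((\<lambda>t::real. ereal (t^2 / 2)) \<longlongrightarrow> ereal (0^2 / 2)) (at_right 0)"
      by (intro tendsto_intros) auto
    then have "((\<lambda>t::real. ereal (t^2 / 2)) \<longlongrightarrow> ereal 0) (at_right 0)" by simp
    then show "((ereal \<circ> (\<lambda>t. t^2 / 2) \<circ> real_of_ereal) \<longlongrightarrow> ereal 0) (at_right (ereal 0))"
      unfolding ereal_tendsto_simps1 by (simp only: o_def)
    have "filterlim (\<lambda>t::real. t^2 / 2) at_top at_top" by real_asymp
    then show "((ereal \<circ> (\<lambda>t. t^2 / 2) \<circ> real_of_ereal) \<longlongrightarrow> \<infinity>) (at_left \<infinity>)"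
      unfolding ereal_tendsto_simps1 by (simp add: o_def tendsto_PInfty_eq_at_top)
    have "set_integrable lborel {0<..} (\<lambda>x. x *\<^sub>R f (x^2 / 2)) \<longleftrightarrow> set_integrable lborel {0<..} (gauss_kernel \<alpha> 1 0)"
      by (intro set_integrable_cong refl) (auto simp: eq)
    then show "set_integrable lborel (einterval (ereal 0) \<infinity>) (\<lambda>x. x *\<^sub>R f (x^2 / 2))"
      using int1 by simp
    show "set_integrable lborel (einterval (ereal 0) \<infinity>) f" using int2 by simp
  qed auto
  then have "(LBINT s:{0<..}. f s) = (LBINT t:{0<..}. t *\<^sub>R f (t^2 / 2))"
    by (simp only: interval_integral_to_infinity_eq)
  also have "\<dots> = gauss_int \<alpha> 1 0"
    unfolding gauss_int_def by (intro set_lebesgue_integral_cong) (auto simp: eq)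
  also have "(LBINT s:{0<..}. f s) = 2 powr (\<alpha> / 2 - 1) * Gamma (\<alpha> / 2)"
    using gauss_int_0_1[of "\<alpha> / 2"] \<alpha> unfolding f_def by (simp add: gauss_int_def)
  finally show ?thesis by simp
qed

context
  fixes a :: complex
  assumes a: "Re a > - 1/2"
begin

lemma pcf_U_at_0: "pcf_U a 0 = 2 powr (a / 2 - 3/4) * Gamma (a / 2 + 1/4) / Gamma (a + 1/2)"
proof -
  have e: "(a + 1/2) / 2 = a / 2 + 1/4" "a / 2 + 1/4 - 1 = a / 2 - 3/4" by (simp_all add: add_divide_distrib)
  have "gauss_int (a + 1/2) 1 0 = 2 powr (a / 2 - 3/4) * Gamma (a / 2 + 1/4)"
    using gauss_int_at_0[of "a + 1/2"] a unfolding e by simp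
  then show ?thesis by (simp add: pcf_U_eq[OF a] pcf_int_def)
qed

lemma pcf_int'_at_0: "pcf_int' a 0 = - (2 powr (a / 2 - 1/4) * Gamma (a / 2 + 3/4) / Gamma (a + 1/2))"
proof -
  have e: "(a + 3/2) / 2 = a / 2 + 3/4" "a / 2 + 3/4 - 1 = a / 2 - 1/4" by (simp_all add: add_divide_distrib)
  have "gauss_int (a + 3/2) 1 0 = 2 powr (a / 2 - 1/4) * Gamma (a / 2 + 3/4)"
    using gauss_int_at_0[of "a + 3/2"] a unfolding e by simp
  then show ?thesis by (simp add: pcf_int'_def)
qed

text \<open>Of the two integrals in \<open>pcf_int'\<close>, the one weighted with z / 2 dominates
  and yields -1/2; the other is smaller by a factor of order z^(-2).\<close>

lemma pcf_int'_ratio_tendsto: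
  assumes \<delta>: "\<delta> > 0"
  shows "((\<lambda>z. pcf_int' a z / (z * (z powr (- a - 1/2) * exp (- (z^2) / 4)))) \<longlongrightarrow> - 1/2)
           (inf at_infinity (principal {z. \<bar>Arg z\<bar> \<le> 3/4 * pi - \<delta>}))" (is "(_ \<longlongrightarrow> _) ?F")
proof -
  have inv: "((\<lambda>z. 1 / z^2) \<longlongrightarrow> 0) ?F"
    by (rule Lim_null_comparison[OF _ tendsto_mono[OF inf_le1 inverse_square_tendsto_0[of 1]]]) (auto simp: norm_divide norm_power)
  have G0: "Gamma (a + 1/2) \<noteq> 0" using a by (intro Gamma_nz) simp
  have "((\<lambda>z. - (1/2 * (z powr (a + 1/2) * gauss_int (a + 1/2) 1 z) +
                z powr (a + 3/2) * gauss_int (a + 3/2) 1 z * (1 / z^2)) / Gamma (a + 1/2))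
        \<longlongrightarrow> - (1/2 * Gamma (a + 1/2) + Gamma (a + 3/2) * 0) / Gamma (a + 1/2)) ?F"
    using a G0 by (intro tendsto_intros gauss_int_tendsto_sector[OF _ \<delta>] inv) auto
  also have "- (1/2 * Gamma (a + 1/2) + Gamma (a + 3/2) * 0) / Gamma (a + 1/2) = - 1/2"
    using G0 by simp
  finally show ?thesis
  proof (rule Lim_transform_eventually)
    have "eventually (\<lambda>z::complex. z \<noteq> 0) ?F"
      using eventually_not_equal_at_infinity by (rule filter_leD[OF inf_le1])
    then show "eventually (\<lambda>z. - (1/2 * (z powr (a + 1/2) * gauss_int (a + 1/2) 1 z) +
                z powr (a + 3/2) * gauss_int (a + 3/2) 1 z * (1 / z^2)) / Gamma (a + 1/2)
         = pcf_int' a z / (z * (z powr (- a - 1/2) * exp (- (z^2) / 4)))) ?F"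
    proof eventually_elim
      case (elim z)
      have 1: "z powr (- a - 1/2) = inverse (z powr (a + 1/2))"
        using powr_minus[of z "a + 1/2"] by simp
      have 2: "z powr (a + 3/2) = z powr (a + 1/2) * z"
        using powr_add[of z "a + 1/2" 1] elim by (simp add: add.commute)
      have 3: "z powr (a + 1/2) \<noteq> 0" using elim by simp
      show ?case unfolding pcf_int'_def 1 2 using elim 3 G0
        by (simp add: divide_simps) (simp add: algebra_simps power2_eq_square)
    qed
  qed
qed

end

section \<open>The phase of the Gamma function\<close>

text \<open>The line Re z = 1/2 avoids the cut of \<open>ln_Gamma\<close>, so its imaginary part is
  a continuous argument of Gamma there, real-valued logarithm and hence 0 at u = 0.\<close>

lemma phi2_candidate:
  "continuous_on UNIV (\<lambda>u. Im (ln_Gamma (1/2 + \<i> * complex_of_real u / 2)))" (is ?A)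
  "Im (ln_Gamma (1/2 + \<i> * complex_of_real 0 / 2)) = 0" (is ?B)
  "is_Arg (Gamma (1/2 + \<i> * complex_of_real u / 2)) (Im (ln_Gamma (1/2 + \<i> * complex_of_real u / 2)))" (is ?C)
proof -
  have nn: "1/2 + \<i> * complex_of_real u / 2 \<notin> \<real>\<^sub>\<le>\<^sub>0" for u
    by (auto simp: complex_nonpos_Reals_iff)
  have "continuous_on UNIV (\<lambda>u. ln_Gamma (1/2 + \<i> * complex_of_real u / 2))"
    by (rule continuous_on_compose2[OF continuous_on_ln_Gamma_complex[of "- \<real>\<^sub>\<le>\<^sub>0"]])
       (use nn in \<open>auto intro!: continuous_intros\<close>)
  then show ?A by (rule continuous_on_Im)
  have "ln_Gamma (complex_of_real (1/2)) = of_real (ln_Gamma (1/2))"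
    by (rule ln_Gamma_complex_of_real) simp
  then show ?B by simp
  define z where "z = 1/2 + \<i> * complex_of_real u / 2"
  have "z \<notin> \<int>\<^sub>\<le>\<^sub>0" unfolding z_def by (auto elim!: nonpos_Ints_cases simp: complex_eq_iff)
  then have G: "Gamma z = exp (ln_Gamma z)" by (simp add: Gamma_complex_altdef)
  show ?C unfolding is_Arg_def z_def[symmetric] G norm_exp_eq_Re
    by (rule exp_eq_polar[unfolded cis_conv_exp])
qed

text \<open>Two continuous choices differ by a continuous function with values in 2 pi times the
  integers, hence by a constant.\<close>

lemma phi2_eqI:
  assumes c: "continuous_on UNIV \<phi>" "continuous_on UNIV \<psi>" and "\<phi> 0 = 0" "\<psi> 0 = 0"
    and arg: "\<And>u. is_Arg (Gamma (1/2 + \<i> * complex_of_real u / 2)) (\<phi> u)"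
      "\<And>u. is_Arg (Gamma (1/2 + \<i> * complex_of_real u / 2)) (\<psi> u)"
  shows "\<phi> = (\<psi> :: real \<Rightarrow> real)"
proof -
  have int: "\<exists>n::int. \<phi> u - \<psi> u = 2 * pi * of_int n" for u
  proof -
    define z where "z = Gamma (1/2 + \<i> * complex_of_real u / 2)"
    have "z \<noteq> 0" unfolding z_def by (auto simp only: Gamma_eq_zero_iff nonpos_Ints_def) (auto simp: complex_eq_iff)
    then have "exp (\<i> * of_real (\<phi> u)) = exp (\<i> * of_real (\<psi> u))"
      using arg[of u, folded z_def] unfolding is_Arg_def
      by (metis mult_left_cancel norm_eq_zero of_real_eq_0_iff)
    then obtain n :: int where "\<i> * of_real (\<phi> u) = \<i> * of_real (\<psi> u) + of_int (2 * n) * (of_real pi) * \<i>"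
      unfolding exp_eq by auto
    then have "Im (\<i> * of_real (\<phi> u)) = Im (\<i> * of_real (\<psi> u) + of_int (2 * n) * (of_real pi) * \<i>)" by simp
    then show ?thesis by (intro exI[of _ n]) simp
  qed
  have "(\<lambda>u. \<phi> u - \<psi> u) constant_on UNIV"
  proof (rule continuous_discrete_range_constant)
    fix x :: real
    show "\<exists>e>0. \<forall>y. y \<in> UNIV \<and> \<phi> y - \<psi> y \<noteq> \<phi> x - \<psi> x \<longrightarrow> e \<le> norm (\<phi> y - \<psi> y - (\<phi> x - \<psi> x))"
    proof (intro exI[of _ "2 * pi"] conjI allI impI)
      fix y assume "y \<in> UNIV \<and> \<phi> y - \<psi> y \<noteq> \<phi> x - \<psi> x"
      moreover obtain m n :: int where mn: "\<phi> y - \<psi> y = 2 * pi * of_int m" "\<phi> x - \<psi> x = 2 * pi * of_int n"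
        using int by metis
      ultimately have "m \<noteq> n" by auto
      then have "1 \<le> \<bar>m - n\<bar>" by linarith
      then have "1 \<le> \<bar>real_of_int (m - n)\<bar>" by linarith
      then have "2 * pi * 1 \<le> 2 * pi * \<bar>real_of_int (m - n)\<bar>" by (intro mult_left_mono) auto
      also have "\<dots> = norm (\<phi> y - \<psi> y - (\<phi> x - \<psi> x))"
      proof -
        have "\<phi> y - \<psi> y - (\<phi> x - \<psi> x) = 2 * pi * real_of_int (m - n)"
          unfolding mn by (simp add: algebra_simps)
        then show ?thesis by (simp add: abs_mult)
      qed
      finally show "2 * pi \<le> norm (\<phi> y - \<psi> y - (\<phi> x - \<psi> x))" by simp
    qed simp
  qed (auto intro!: continuous_intros c)
  then obtain c where "\<And>u. \<phi> u - \<psi> u = c" unfolding constant_on_def by auto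
  from this[of 0] this show ?thesis using assms(3,4) by (auto simp: fun_eq_iff)
qed

lemma phi2_eq: "phi2 u = Im (ln_Gamma (1/2 + \<i> * complex_of_real u / 2))"
proof -
  have "phi2 = (\<lambda>u. Im (ln_Gamma (1/2 + \<i> * complex_of_real u / 2)))"
    unfolding phi2_def
    apply (rule the_equality)
    apply (intro conjI allI phi2_candidate)
    apply (rule phi2_eqI) apply (auto intro: phi2_candidate(1,3) simp: phi2_candidate(2)[simplified]) done
  then show ?thesis by (rule fun_cong)
qed

lemma is_Arg_phi2: "is_Arg (Gamma (1/2 + \<i> * complex_of_real u / 2)) (phi2 u)"
  unfolding phi2_eq by (rule phi2_candidate)

text \<open>Gamma commutes with conjugation, so u -> - phi2 (- u) is again a continuous argument
  vanishing at 0. Needed because W(-u/2, .) involves \<open>rho (- u)\<close>.\<close>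

lemma phi2_minus: "phi2 (- u) = - phi2 u"
proof -
  have c: "continuous_on UNIV phi2" unfolding phi2_eq[abs_def] by (rule phi2_candidate)
  have 0: "phi2 0 = 0" unfolding phi2_eq by (rule phi2_candidate)
  have "(\<lambda>u. - phi2 (- u)) = phi2"
  proof (rule phi2_eqI)
    fix u
    define z where "z = Gamma (1/2 + \<i> * complex_of_real (- u) / 2)"
    have z: "Gamma (1/2 + \<i> * complex_of_real u / 2) = cnj z"
      unfolding z_def cnj_Gamma by simp
    have "z = of_real (norm z) * exp (\<i> * of_real (phi2 (- u)))"
      using is_Arg_phi2[of "- u"] unfolding is_Arg_def z_def .
    then have "cnj z = of_real (norm (cnj z)) * exp (\<i> * of_real (- phi2 (- u)))"
    proof -
      assume "z = of_real (norm z) * exp (\<i> * of_real (phi2 (- u)))"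
      then have A: "cnj z = cnj (of_real (norm z) * exp (\<i> * of_real (phi2 (- u))))" by (rule arg_cong)
      have B: "cnj (of_real r * exp (\<i> * of_real t)) = of_real r * exp (\<i> * of_real (- t))" for r t
        by (simp add: exp_cnj)
      show ?thesis unfolding complex_mod_cnj by (rule trans[OF A B])
    qed
    then show "is_Arg (Gamma (1/2 + \<i> * complex_of_real u / 2)) (- phi2 (- u))"
      unfolding z is_Arg_def .
  qed (use c 0 is_Arg_phi2 in \<open>auto intro!: continuous_intros continuous_on_compose2[OF c]\<close>)
  then show ?thesis by (metis minus_minus)
qed

text \<open>The summand is \<open>arctan (y / t)\<close> at \<open>t = k + 1/2\<close>, written so as to be smooth at \<open>t = 0\<close>; \<open>F\<close> is its
  antiderivative.\<close>

lemma sum_arctan_bound: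
  fixes y :: real assumes y: "y > 0"
  defines "F \<equiv> \<lambda>t. t * (pi/2 - arctan (t / y)) + y / 2 * ln (t^2 + y^2)"
  shows "\<bar>F (real n) - F 0 - (\<Sum>k<n. pi/2 - arctan ((real k + 1/2) / y))\<bar> \<le> pi / 4"
proof -
  define f where "f = (\<lambda>t. pi/2 - arctan (t / y))"
  have F: "(F has_real_derivative f t) (at t)" for t
  proof -
    have p: "t^2 + y^2 > 0" using y by (simp add: add_nonneg_pos)
    have ad: "((\<lambda>t. arctan (t / y)) has_real_derivative y / (t^2 + y^2)) (at t)"
    proof -
      have "((\<lambda>t. arctan (t / y)) has_real_derivative inverse (1 + (t / y)^2) * (1 / y)) (at t)"
        by (rule DERIV_chain2[OF DERIV_arctan]) (use y in \<open>auto intro!: derivative_eq_intros\<close>)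
      moreover have "1 + (t / y)^2 = (t^2 + y^2) / y^2" using y by (simp add: field_simps)
      ultimately show ?thesis using y by (simp add: power2_eq_square)
    qed
    have ld: "((\<lambda>t. ln (t^2 + y^2)) has_real_derivative 2 * t / (t^2 + y^2)) (at t)"
      using p by (auto intro!: derivative_eq_intros)
    from DERIV_add[OF DERIV_mult[OF DERIV_ident DERIV_diff[OF DERIV_const[of "pi/2"] ad]] DERIV_cmult[OF ld, of "y/2"]]
    show ?thesis unfolding F_def f_def by (rule DERIV_cong) (simp add: mult.commute)
  qed
  have mono: "f s \<ge> f t" if "s \<le> t" for s t
    using that y unfolding f_def by (simp add: arctan_le_iff divide_right_mono)
  \<comment> \<open>As f decreases, its mean over a cell differs from the midpoint value by at most
    half of the drop over the cell. The drops telescope to less than pi/2 in total, whence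
    pi/4.\<close>
  have cell: "\<bar>F (real (Suc k)) - F (real k) - f (real k + 1/2)\<bar> \<le> 1/2 * (f (real k) - f (real (Suc k)))" for k
  proof -
    obtain c1 where c1: "real k < c1" "c1 < real k + 1/2" "F (real k + 1/2) - F (real k) = (real k + 1/2 - real k) * f c1"
      using MVT2[of "real k" "real k + 1/2" F f] F by auto
    obtain c2 where c2: "real k + 1/2 < c2" "c2 < real (Suc k)" "F (real (Suc k)) - F (real k + 1/2) = (real (Suc k) - (real k + 1/2)) * f c2"
      using MVT2[of "real k + 1/2" "real (Suc k)" F f] F by auto
    have "f (real k) \<ge> f c1" "f c1 \<ge> f (real k + 1/2)" "f (real k + 1/2) \<ge> f c2" "f c2 \<ge> f (real (Suc k))"
      using c1 c2 by (auto intro!: mono)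
    moreover have "F (real k + 1/2) = F (real k) + f c1 / 2" "F (real (Suc k)) = F (real k + 1/2) + f c2 / 2"
      using c1(3) c2(3) by (simp_all add: field_simps)
    ultimately show ?thesis by argo
  qed
  have "\<bar>F (real n) - F 0 - (\<Sum>k<n. f (real k + 1/2))\<bar> \<le> 1/2 * (f 0 - f (real n))"
  proof (induction n)
    case (Suc n)
    have "F (real (Suc n)) - F 0 - (\<Sum>k<Suc n. f (real k + 1/2)) =
        (F (real n) - F 0 - (\<Sum>k<n. f (real k + 1/2))) + (F (real (Suc n)) - F (real n) - f (real n + 1/2))"
      by simp
    then show ?case using Suc cell[of n] abs_triangle_ineq[of "F (real n) - F 0 - (\<Sum>k<n. f (real k + 1/2))"
         "F (real (Suc n)) - F (real n) - f (real n + 1/2)"] by argo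
  qed simp
  also have "\<dots> \<le> pi / 4" using arctan_ubound[of "real n / y"] unfolding f_def by simp
  finally show ?thesis unfolding f_def .
qed

text \<open>In Euler's limit for \<open>ln_Gamma\<close> the imaginary part is y * ln n minus a sum
  of arguments, which \<open>sum_arctan_bound\<close> replaces by an explicit antiderivative. A
  bounded error is enough, since the estimate only has to single out one multiple of pi
  later.\<close>

lemma Im_ln_Gamma_half_bound:
  fixes y :: real assumes y: "y > 0"
  shows "\<bar>Im (ln_Gamma (1/2 + \<i> * complex_of_real y)) - (y * ln y - y)\<bar> \<le> pi / 4"
proof -
  define z where "z = 1/2 + \<i> * complex_of_real y"
  define F where "F = (\<lambda>t. t * (pi/2 - arctan (t / y)) + y / 2 * ln (t^2 + y^2))"
  define S where "S = (\<lambda>n. \<Sum>k<n. pi/2 - arctan ((real k + 1/2) / y))"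
  have at: "Im (Ln w) = pi/2 - arctan (Re w / y)" if "Re w > 0" "Im w = y" for w
  proof -
    have "Im (Ln w) = arctan (y / Re w)" using that by (subst Im_Ln_eq) (auto simp: complex_eq_iff)
    also have "\<dots> = pi/2 - arctan (Re w / y)"
      using arctan_inverse[of "Re w / y"] that y by (simp add: sgn_if inverse_eq_divide)
    finally show ?thesis .
  qed
  have im: "Im (ln_Gamma_series z n) = y * ln (real n) - S (Suc n)" if n: "n > 0" for n
  proof -
    have 1: "Im (Ln (z / of_nat k + 1)) = pi/2 - arctan ((real k + 1/2) / y)" if "k \<ge> 1" for k
    proof -
      have k: "real k > 0" using that by simp
      have "z / of_nat k + 1 = of_real (1 / real k) * (z + of_nat k)" using k by (simp add: field_simps)
      then have "Im (Ln (z / of_nat k + 1)) = Im (Ln (z + of_nat k))"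
      proof -
        assume e: "z / of_nat k + 1 = of_real (1 / real k) * (z + of_nat k)"
        have "z + of_nat k \<noteq> 0" using y by (auto simp: z_def complex_eq_iff)
        then show ?thesis unfolding e using k
          by (simp add: Ln_times_of_real Ln_of_real del: of_real_divide of_real_1)
      qed
      also have "\<dots> = pi/2 - arctan (Re (z + of_nat k) / y)"
        by (rule at) (auto simp: z_def)
      finally show ?thesis by (simp add: z_def add.commute)
    qed
    have "Im (Ln z) = pi/2 - arctan ((real 0 + 1/2) / y)" using at[of z] by (simp add: z_def)
    moreover have "Im (\<Sum>k=1..n. Ln (z / of_nat k + 1)) = (\<Sum>k=1..n. pi/2 - arctan ((real k + 1/2) / y))"
      unfolding Im_sum by (intro sum.cong refl 1) auto
    moreover have "S (Suc n) = (pi/2 - arctan ((real 0 + 1/2) / y)) + (\<Sum>k=1..n. pi/2 - arctan ((real k + 1/2) / y))"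
      unfolding S_def lessThan_Suc_atMost sum.atMost_shift
      by (simp add: sum.atLeast1_atMost_eq)
    moreover have "Im (z * Ln (of_nat n)) = y * ln (real n)"
      using n by (simp add: Ln_of_nat z_def)
    ultimately show ?thesis unfolding ln_Gamma_series_def by simp
  qed
  have "z \<notin> \<int>\<^sub>\<le>\<^sub>0" unfolding z_def using y by (auto elim!: nonpos_Ints_cases simp: complex_eq_iff)
  then have "(\<lambda>n. Im (ln_Gamma_series z n)) \<longlonglongrightarrow> Im (ln_Gamma z)"
    by (intro tendsto_Im ln_Gamma_complex_LIMSEQ)
  \<comment> \<open>F (n + 1) = y * ln n + y + o(1), and F 0 = y * ln y.\<close>
  moreover have "(\<lambda>n. y * ln (real n) - F (real (Suc n)) + F 0) \<longlonglongrightarrow> y * ln y - y"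
  proof -
    have "(\<lambda>n. y * ln (real n) - F (real (Suc n))) \<longlonglongrightarrow> - y"
      unfolding F_def using y by real_asymp
    moreover have "F 0 = y * ln y" unfolding F_def using y by (simp add: ln_realpow)
    ultimately show ?thesis using tendsto_add[OF _ tendsto_const, of _ "- y" sequentially "F 0"] by simp
  qed
  note lims = calculation this
  have "(\<lambda>n. \<bar>Im (ln_Gamma_series z n) - (y * ln (real n) - F (real (Suc n)) + F 0)\<bar>) \<longlonglongrightarrow> \<bar>Im (ln_Gamma z) - (y * ln y - y)\<bar>"
    by (rule tendsto_rabs[OF tendsto_diff[OF lims]])
  moreover have "eventually (\<lambda>n. \<bar>Im (ln_Gamma_series z n) - (y * ln (real n) - F (real (Suc n)) + F 0)\<bar> \<le> pi / 4) sequentially"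
    using eventually_gt_at_top[of 0]
  proof eventually_elim
    case (elim n)
    have "\<bar>F (real (Suc n)) - F 0 - S (Suc n)\<bar> \<le> pi / 4"
      unfolding F_def S_def using sum_arctan_bound[OF y, of "Suc n"] by simp
    then show ?case using im[OF elim] by (simp add: abs_le_iff)
  qed
  ultimately show ?thesis unfolding z_def by (intro tendsto_upperbound) auto
qed

section \<open>The connection formula\<close>

text \<open>Energy argument: D^2 + D'^2 grows at most like exp ((1 + M) x), so it stays 0 once it is
  0.\<close>

lemma linear_ivp_unique:
  fixes f D D' :: "real \<Rightarrow> real"
  assumes D: "\<And>x. (D has_real_derivative D' x) (at x)"
    and D': "\<And>x. (D' has_real_derivative f x * D x) (at x)"
    and f: "\<And>x. 0 \<le> x \<Longrightarrow> x \<le> X \<Longrightarrow> \<bar>f x\<bar> \<le> M" and "0 \<le> X" and "D 0 = 0" "D' 0 = 0"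
  shows "D X = 0"
proof -
  define h where "h = (\<lambda>x. ((D x)^2 + (D' x)^2) * exp (- (1 + M) * x))"
  have "h 0 \<ge> h X"
  proof (rule DERIV_nonpos_imp_nonincreasing[OF \<open>0 \<le> X\<close>])
    fix x assume x: "0 \<le> x" "x \<le> X"
    have "(h has_real_derivative (2 * D x * D' x * (1 + f x) - (1 + M) * ((D x)^2 + (D' x)^2)) * exp (- (1 + M) * x)) (at x)"
      unfolding h_def by (rule DERIV_cong, (rule derivative_eq_intros D D' refl)+) (simp add: algebra_simps power2_eq_square)
    moreover have "2 * D x * D' x * (1 + f x) \<le> (1 + M) * ((D x)^2 + (D' x)^2)"
    proof -
      have M: "\<bar>1 + f x\<bar> \<le> 1 + M" using f[OF x] by linarith
      have "2 * D x * D' x * (1 + f x) \<le> \<bar>2 * D x * D' x\<bar> * \<bar>1 + f x\<bar>" by (metis abs_ge_self abs_mult)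
      also have "\<dots> \<le> ((D x)^2 + (D' x)^2) * (1 + M)"
      proof (rule mult_mono[OF _ M])
        have "0 \<le> (\<bar>D x\<bar> - \<bar>D' x\<bar>)^2" by simp
        then show "\<bar>2 * D x * D' x\<bar> \<le> (D x)^2 + (D' x)^2" by (simp add: power2_diff abs_mult)
      qed auto
      finally show ?thesis by (simp add: mult.commute)
    qed
    ultimately show "\<exists>y. (h has_real_derivative y) (at x) \<and> y \<le> 0"
      by (intro exI conjI) (auto intro: mult_nonpos_nonneg)
  qed
  then have "((D X)^2 + (D' X)^2) * exp (- (1 + M) * X) \<le> 0" unfolding h_def using assms by simp
  then have "(D X)^2 + (D' X)^2 \<le> 0" by (simp add: mult_le_0_iff)
  then show ?thesis by (simp add: sum_power2_le_zero_iff)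
qed

text \<open>\<open>weber_k (2 * b)\<close> is the positive root k of k^2 + 2 T k = 1. Equivalently
  (1 + i k)^2 = 2 k (T + i), so T + i has argument 2 arctan k.\<close>

lemma weber_k_alt:
  fixes b :: real defines "T \<equiv> exp (pi * b)"
  shows "weber_k (2 * b) > 0" "1 - (weber_k (2 * b))^2 = 2 * T * weber_k (2 * b)"
proof -
  have e: "exp (pi * (2 * b)) = T^2" "exp (pi * (2 * b) / 2) = T"
    unfolding T_def by (simp_all add: exp_double[symmetric] mult_ac)
  have T: "T > 0" unfolding T_def by simp
  have s: "(sqrt (1 + T^2))^2 = 1 + T^2" by simp
  have "sqrt (T^2) < sqrt (1 + T^2)" by (rule real_sqrt_less_mono) simp
  then show "weber_k (2 * b) > 0" unfolding weber_k_def e using T by simp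
  show "1 - (weber_k (2 * b))^2 = 2 * T * weber_k (2 * b)"
    unfolding weber_k_def e power2_diff s by (simp add: algebra_simps power2_eq_square)
qed

text \<open>2 k (T + i e) is the square of 1 + i e k, so v is a real multiple of 1 + i e k; the sign
  ambiguity of the square root does not affect the ratio of imaginary to real part.\<close>

lemma proportional_of_square:
  fixes k T P :: real
  assumes k: "k > 0" "1 - k^2 = 2 * T * k" and P: "P > 0"
    and v: "v^2 = of_real P * (of_real T + \<i> * of_real e)" and e: "e = 1 \<or> e = -1"
  shows "Im v = e * k * Re v"
proof -
  define r where "r = sqrt (P / (2 * k))"
  have r: "r^2 * (2 * k) = P" using k P unfolding r_def by simp
  define u where "u = of_real r * (1 + \<i> * of_real (e * k))"
  have "u^2 = of_real (r^2) * (of_real (1 - k^2) + \<i> * of_real (2 * e * k))"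
    using e unfolding u_def by (auto simp: complex_eq_iff power2_eq_square algebra_simps)
  also have "\<dots> = of_real (r^2 * (2 * k)) * (of_real T + \<i> * of_real e)"
    unfolding k(2) by (simp add: algebra_simps)
  finally have "v^2 = u^2" unfolding v r by simp
  then have "v = u \<or> v = - u" by (simp add: power2_eq_iff)
  then show ?thesis unfolding u_def by auto
qed

lemma exp_half_pi_i: "exp (of_real pi * \<i> / 2) = \<i>"
  by (simp add: complex_eq_iff Re_exp Im_exp)

lemma exp_minus_i_pi_quarter_sq: "(exp (- (complex_of_real pi * \<i> / 4)))^2 = - \<i>"
proof -
  have "(exp (- (complex_of_real pi * \<i> / 4)))^2 = exp (- (of_real pi / 2 * \<i>))"
    by (simp add: exp_double[symmetric] mult_ac)
  then show ?thesis by (simp add: exp_minus exp_half_pi_i)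
qed

text \<open>Squaring removes all square roots and branches: by duplication and reflection, the squares of the value and
  of the derivative at the origin have explicit arguments.\<close>

lemma pcf_origin_squares:
  fixes b :: real
  defines "a \<equiv> \<i> * of_real b" and "c \<equiv> exp (\<i> * of_real (rho (2 * b)))" and "T \<equiv> exp (pi * b)"
  obtains P P' where "P > 0" "P' > 0"
    "(c * pcf_U a 0)^2 = of_real P * (of_real T + \<i> * of_real 1)"
    "(c * (exp (- (of_real pi * \<i> / 4)) * pcf_int' a 0))^2 = of_real P' * (of_real T + \<i> * of_real (- 1))"
proof -
  define g0 where "g0 = Gamma (a + 1/2)"
  define g1 where "g1 = Gamma (a / 2 + 1/4)"
  define g3 where "g3 = Gamma (a / 2 + 3/4)"
  define N where "N = norm g0"
  define z where "z = a / 2 + 1/4"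
  define S where "S = sin (of_real pi * z)"
  define E where "E = exp (\<i> * of_real (pi / 4))"
  define y where "y = pi * b / 2"
  define D where "D = exp ((1/2 - a) * of_real (ln 2)) * of_real (sqrt pi)"
  define p where "p = 2 powr (a / 2 - 3/4)"
  define q where "q = 2 powr (a / 2 - 1/4)"
  have a: "Re a > - 1/2" "Re a = 0" unfolding a_def by auto
  have nz: "g0 \<noteq> 0" "g1 \<noteq> 0" "g3 \<noteq> 0" unfolding g0_def g1_def g3_def a_def by (auto intro!: Gamma_nz)
  then have N: "N > 0" unfolding N_def by simp
  have npi: "w \<notin> \<int>\<^sub>\<le>\<^sub>0" if "Re w > 0" for w :: complex using that by (auto elim!: nonpos_Ints_cases)
  have dup: "g1 * g3 = D * g0"
  proof -
    have e: "a / 2 + 1/4 + 1/2 = a / 2 + 3/4" "1 - 2 * (a / 2 + 1/4) = 1/2 - a" "2 * (a / 2 + 1/4) = a + 1/2"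
      by (simp_all add: algebra_simps)
    show ?thesis
      using Gamma_legendre_duplication[of "a / 2 + 1/4"] npi[of "a / 2 + 1/4"] npi[of "a / 2 + 3/4"] a
      unfolding e g0_def g1_def g3_def D_def by simp
  qed
  \<comment> \<open>As a is imaginary, the conjugate of a/2 + 3/4 is 1 - z with z = a/2 + 1/4, so
    the reflection formula applies.\<close>
  have refl: "g1 * cnj g3 = of_real pi / S"
  proof -
    have "cnj g3 = Gamma (1 - z)" unfolding g3_def cnj_Gamma z_def a_def by (simp add: complex_eq_iff)
    then show ?thesis unfolding S_def g1_def using Gamma_reflection_complex[of z] unfolding z_def by simp
  qed
  have EE: "E^2 = \<i>" "E * cnj E = 1"
  proof -
    have "E^2 = exp (of_real pi / 2 * \<i>)" unfolding E_def by (simp add: exp_double[symmetric] mult_ac)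
    then show "E^2 = \<i>" by (simp add: exp_half_pi_i)
    show "E * cnj E = 1" unfolding E_def by (simp add: exp_cnj exp_add[symmetric] flip: exp_minus)
  qed
  have Sform: "S = (E * of_real (exp (- y)) - cnj E * of_real (exp y)) / (2 * \<i>)"
  proof -
    have "\<i> * (of_real pi * z) = \<i> * of_real (pi / 4) + of_real (- y)"
      unfolding z_def a_def y_def by (simp add: complex_eq_iff)
    then have "exp (\<i> * (of_real pi * z)) = E * of_real (exp (- y))"
      unfolding E_def by (simp only: exp_add exp_of_real)
    moreover have "- (\<i> * (of_real pi * z)) = - (\<i> * of_real (pi / 4)) + of_real y"
      unfolding z_def a_def y_def by (simp add: complex_eq_iff)
    then have "exp (- (\<i> * (of_real pi * z))) = exp (- (\<i> * of_real (pi / 4))) * of_real (exp y)"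
      by (simp only: exp_add exp_of_real)
    moreover have "exp (- (\<i> * of_real (pi / 4))) = cnj E" unfolding E_def by (simp add: exp_cnj)
    ultimately show ?thesis unfolding S_def sin_exp_eq by simp
  qed
  have T: "T * exp (- y) = exp y" unfolding T_def y_def by (simp add: exp_add[symmetric])
  have ES: "- \<i> * E * S = of_real (exp (- y) / 2) * (of_real T - \<i>)"
  proof -
    have "- \<i> * E * S = - (E^2 * of_real (exp (- y)) - (E * cnj E) * of_real (exp y)) / 2"
      unfolding Sform by (simp add: field_simps power2_eq_square)
    also have "\<dots> = (of_real (T * exp (- y)) - \<i> * of_real (exp (- y))) / 2" unfolding EE T by simp
    finally show ?thesis by (simp add: algebra_simps)
  qed
  have ES': "E * cnj S = of_real (exp (- y) / 2) * (of_real T + \<i>)"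
  proof -
    have cS: "cnj S = (E * of_real (exp y) - cnj E * of_real (exp (- y))) / (2 * \<i>)"
      unfolding Sform by (simp add: field_simps)
    have "E * cnj S = (E^2 * of_real (exp y) - (E * cnj E) * of_real (exp (- y))) / (2 * \<i>)"
      unfolding cS by (simp add: field_simps power2_eq_square)
    also have "\<dots> = (of_real (T * exp (- y)) + \<i> * of_real (exp (- y))) / 2" unfolding EE T by (simp add: field_simps)
    finally show ?thesis by (simp add: algebra_simps)
  qed
  have S0: "S \<noteq> 0" using refl nz by auto
  \<comment> \<open>Squaring doubles \<open>rho\<close> to phi2 + pi/4, so the transcendental phase
    becomes the algebraic factor g0 / norm g0.\<close>
  have c2: "c^2 = g0 / of_real N * E"
  proof -
    have "g0 = of_real N * exp (\<i> * of_real (phi2 (2 * b)))"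
      using is_Arg_phi2[of "2 * b"] unfolding is_Arg_def g0_def N_def a_def by (simp add: add.commute)
    then have "g0 / of_real N = exp (\<i> * of_real (phi2 (2 * b)))" using N by simp
    moreover have "c^2 = exp (\<i> * of_real (phi2 (2 * b)) + \<i> * of_real (pi / 4))"
      unfolding c_def rho_def exp_double[symmetric] by (simp add: algebra_simps)
    ultimately show ?thesis unfolding E_def by (simp add: exp_add)
  qed
  have L2: "Ln (2::complex) = of_real (ln 2)" using Ln_of_real[of 2] by simp
  have pD: "p^2 * D = of_real (sqrt pi / 2)"
  proof -
    have "p^2 * D = exp (2 * ((a / 2 - 3/4) * of_real (ln 2)) + (1/2 - a) * of_real (ln 2)) * of_real (sqrt pi)"
      unfolding p_def D_def powr_def L2 exp_add by (simp add: exp_double)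
    also have "2 * ((a / 2 - 3/4) * of_real (ln 2)) + (1/2 - a) * of_real (ln 2) = of_real (- ln 2)"
      by (simp add: algebra_simps)
    finally show ?thesis unfolding exp_of_real by (simp add: exp_minus)
  qed
  have qD: "q^2 * D = of_real (sqrt pi)"
  proof -
    have "q^2 * D = exp (2 * ((a / 2 - 1/4) * of_real (ln 2)) + (1/2 - a) * of_real (ln 2)) * of_real (sqrt pi)"
      unfolding q_def D_def powr_def L2 exp_add by (simp add: exp_double)
    also have "2 * ((a / 2 - 1/4) * of_real (ln 2)) + (1/2 - a) * of_real (ln 2) = 0"
      by (simp add: algebra_simps)
    finally show ?thesis by simp
  qed
  define P where "P = sqrt pi / 2 * pi * exp (- y) / 2 / (N * (norm g3)^2 * (norm S)^2)"
  define P' where "P' = sqrt pi * (norm g3)^2 / (N * pi) * exp (- y) / 2"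
  have pos: "P > 0" "P' > 0" unfolding P_def P'_def using N nz S0 by auto
  \<comment> \<open>One factor g0 cancels against c^2, the other is traded by duplication for g1 *
    g3. What remains, g1 / g3, is g1 * cnj g3 over a positive number, so reflection leaves only 1 /
    S, whose argument is explicit.\<close>
  have "(c * pcf_U a 0)^2 = c^2 * p^2 * g1^2 / g0^2"
    unfolding pcf_U_at_0[OF a(1)] p_def g0_def g1_def by (simp add: power_mult_distrib power_divide)
  also have "\<dots> = E * (p^2 * D) * (g1^2 / (of_real N * (D * g0)))"
    unfolding c2 using nz N by (simp add: D_def field_simps power2_eq_square)
  also have "\<dots> = E * (p^2 * D) * (g1 * cnj g3) / (of_real N * (g3 * cnj g3))"
    unfolding dup[symmetric] using nz by (simp add: field_simps power2_eq_square)
  also have "\<dots> = (E * cnj S) * (p^2 * D) * of_real pi / (of_real N * (g3 * cnj g3) * (S * cnj S))"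
    unfolding refl using S0 by (simp add: field_simps)
  also have "\<dots> = of_real P * (of_real T + \<i> * of_real 1)"
    unfolding ES' pD complex_norm_square[symmetric] P_def by (simp add: mult_ac)
  finally have 1: "(c * pcf_U a 0)^2 = of_real P * (of_real T + \<i> * of_real 1)" .
  note om = exp_minus_i_pi_quarter_sq
  have "(c * (exp (- (of_real pi * \<i> / 4)) * pcf_int' a 0))^2 = c^2 * (exp (- (of_real pi * \<i> / 4)))^2 * (q^2 * g3^2 / g0^2)"
    unfolding pcf_int'_at_0[OF a(1)] q_def g0_def g3_def by (simp add: power_mult_distrib power_divide)
  also have "\<dots> = - \<i> * E * (q^2 * D) * (g3^2 / (of_real N * (D * g0)))"
    unfolding c2 om using nz N by (simp add: D_def field_simps power2_eq_square)
  also have "\<dots> = - \<i> * E * (q^2 * D) * (g3 * cnj g3) / (of_real N * (g1 * cnj g3))"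
    unfolding dup[symmetric] using nz by (simp add: field_simps power2_eq_square)
  also have "\<dots> = (- \<i> * E * S) * (q^2 * D) * (g3 * cnj g3) / (of_real N * of_real pi)"
    unfolding refl using S0 by (simp add: field_simps)
  also have "\<dots> = of_real P' * (of_real T + \<i> * of_real (- 1))"
    unfolding ES qD complex_norm_square[symmetric] P'_def by (simp add: mult_ac)
  finally have 2: "(c * (exp (- (of_real pi * \<i> / 4)) * pcf_int' a 0))^2 = of_real P' * (of_real T + \<i> * of_real (- 1))" .
  from that[OF pos 1 2] show ?thesis .
qed

text \<open>On the ray the equation has the real and even coefficient b - x^2/4, so the imaginary
  part and the reflected real part satisfy one and the same real initial value problem once their
  data at 0 agree.\<close>

lemma pcf_U_connection:
  fixes b x :: real
  assumes x: "x \<ge> 0"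
  defines "a \<equiv> \<i> * of_real b" and "c \<equiv> exp (\<i> * of_real (rho (2 * b)))"
    and "\<omega> \<equiv> exp (- (of_real pi * \<i> / 4))"
  shows "weber_k (2 * b) * Re (c * pcf_U a (of_real (- x) * \<omega>)) = Im (c * pcf_U a (of_real x * \<omega>))"
proof -
  define k where "k = weber_k (2 * b)"
  have a: "Re a > - 1/2" unfolding a_def by simp
  obtain P P' where P: "P > 0" "P' > 0"
    "(c * pcf_U a 0)^2 = of_real P * (of_real (exp (pi * b)) + \<i> * of_real 1)"
    "(c * (\<omega> * pcf_int' a 0))^2 = of_real P' * (of_real (exp (pi * b)) + \<i> * of_real (- 1))"
    by (rule pcf_origin_squares[of b, folded a_def c_def \<omega>_def])
  have 0: "Im (c * pcf_U a 0) = k * Re (c * pcf_U a 0)"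
    using proportional_of_square[OF weber_k_alt P(1,3)] unfolding k_def by simp
  \<comment> \<open>The square of the derivative has -i where that of the value has +i; the
    resulting -k matches the sign that reflection x -> -x gives to derivatives.\<close>
  have 1: "Im (c * (\<omega> * pcf_int' a 0)) = - k * Re (c * (\<omega> * pcf_int' a 0))"
    using proportional_of_square[OF weber_k_alt P(2,4)] unfolding k_def by simp
  have w2: "\<omega>^2 = - \<i>" unfolding \<omega>_def by (rule exp_minus_i_pi_quarter_sq)
  define y0 where "y0 = (\<lambda>z. c * pcf_U a (z * \<omega>))"
  define y1 where "y1 = (\<lambda>z. c * (\<omega> * pcf_int' a (z * \<omega>)))"
  have d0: "(y0 has_field_derivative y1 z) (at z)" for z
  proof -
    have "((\<lambda>z. pcf_U a (z * \<omega>)) has_field_derivative pcf_int' a (z * \<omega>) * \<omega>) (at z)"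
      unfolding pcf_U_eq[OF a] by (rule DERIV_chain2[OF pcf_int_deriv[OF a]]) (auto intro!: derivative_eq_intros)
    from DERIV_cmult[OF this, of c] show ?thesis unfolding y0_def y1_def by (simp add: mult_ac)
  qed
  have d1: "(y1 has_field_derivative (of_real b - z^2 / 4) * y0 z) (at z)" for z
  proof -
    have "((\<lambda>z. pcf_int' a (z * \<omega>)) has_field_derivative ((1/4 * (z * \<omega>)^2 + a) * pcf_U a (z * \<omega>)) * \<omega>) (at z)"
      unfolding pcf_U_eq[OF a] by (rule DERIV_chain2[OF pcf_int'_deriv[OF a]]) (auto intro!: derivative_eq_intros)
    from DERIV_cmult[OF this, of "c * \<omega>"]
    have "(y1 has_field_derivative c * \<omega> * ((1/4 * (z * \<omega>)^2 + a) * pcf_U a (z * \<omega>) * \<omega>)) (at z)"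
      unfolding y1_def by (simp add: mult_ac)
    also have "c * \<omega> * ((1/4 * (z * \<omega>)^2 + a) * pcf_U a (z * \<omega>) * \<omega>) = (\<omega>^2 * (1/4 * z^2 * \<omega>^2 + a)) * (c * pcf_U a (z * \<omega>))"
      by (simp add: power2_eq_square mult_ac)
    also have "\<omega>^2 * (1/4 * z^2 * \<omega>^2 + a) = of_real b - z^2 / 4"
      unfolding w2 a_def by (simp add: algebra_simps)
    finally show ?thesis unfolding y0_def .
  qed
  define D where "D = (\<lambda>x. k * Re (y0 (of_real (- x))) - Im (y0 (of_real x)))"
  define D' where "D' = (\<lambda>x. - k * Re (y1 (of_real (- x))) - Im (y1 (of_real x)))"
  have vd: "((\<lambda>x. Re (f (of_real x))) has_real_derivative Re f') (at x)"
    "((\<lambda>x. Im (f (of_real x))) has_real_derivative Im f') (at x)"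
    if "(f has_field_derivative f') (at (of_real x))" for f f' and x :: real
    using bounded_linear.has_vector_derivative[OF bounded_linear_Re has_vector_derivative_real_field[OF that]]
      bounded_linear.has_vector_derivative[OF bounded_linear_Im has_vector_derivative_real_field[OF that]]
    by (simp_all add: has_real_derivative_iff_has_vector_derivative)
  have vdm: "((\<lambda>x. Re (f (of_real (- x)))) has_real_derivative - Re f') (at x)"
    if "(f has_field_derivative f') (at (of_real (- x)))" for f f' and x :: real
    using DERIV_chain2[OF vd(1)[OF that] DERIV_minus[OF DERIV_ident]] by simp
  have "D x = 0"
  proof (rule linear_ivp_unique[where f = "\<lambda>x. b - x^2 / 4" and X = x and M = "\<bar>b\<bar> + x^2" and D' = D'])
    show "(D has_real_derivative D' x) (at x)" for x
      unfolding D_def D'_def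
      by (rule DERIV_cong[OF DERIV_diff[OF DERIV_cmult[OF vdm[OF d0]] vd(2)[OF d0]]]) simp
    show "(D' has_real_derivative (b - x^2 / 4) * D x) (at x)" for x
    proof -
      have d1': "(y1 has_field_derivative complex_of_real (b - x^2 / 4) * y0 (of_real x)) (at (of_real x))" for x
        using d1[of "of_real x"] by simp
      have re: "Re (of_real r * z) = r * Re z" "Im (of_real r * z) = r * Im z" for r z by simp_all
      show ?thesis unfolding D_def D'_def
        by (rule DERIV_cong[OF DERIV_diff[OF DERIV_cmult[OF vdm[OF d1'[of "- x"]]] vd(2)[OF d1'[of x]]]])
           (simp only: re power2_minus, simp add: algebra_simps)
    qed
    show "\<bar>b - t^2 / 4\<bar> \<le> \<bar>b\<bar> + x^2" if "0 \<le> t" "t \<le> x" for t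
    proof -
      have "t^2 \<le> x^2" using that by (intro power_mono) auto
      moreover have "t^2 \<ge> 0" by simp
      ultimately show ?thesis by linarith
    qed
    show "D 0 = 0" using 0 unfolding D_def y0_def by simp
    show "D' 0 = 0" using 1 unfolding D'_def y1_def by simp
  qed (use x in simp)
  then show ?thesis unfolding D_def y0_def k_def by simp
qed

section \<open>The coefficients\<close>

lemma pderiv_surj:
  fixes p :: "real poly"
  shows "\<exists>q. pderiv q = p"
proof -
  define q where "q = (\<Sum>i\<le>degree p. monom (coeff p i / real (Suc i)) (Suc i))"
  have "pderiv q = (\<Sum>i\<le>degree p. monom (coeff p i) i)"
    unfolding q_def higher_pderiv_sum[of 1, simplified] by (intro sum.cong refl) (simp add: pderiv_monom)
  also have "\<dots> = p" by (simp add: poly_as_sum_of_monoms)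
  finally show ?thesis ..
qed

lemma LBINT_pderiv:
  fixes q :: "real poly"
  shows "(LBINT p=ereal a..ereal b. poly (pderiv q) p) = poly q b - poly q a"
  by (rule interval_integral_FTC_finite)
     (auto intro!: continuous_intros DERIV_subset[OF poly_DERIV]
       simp flip: has_real_derivative_iff_has_vector_derivative)

lemma deriv_poly: "deriv (poly p) = poly (pderiv p)" for p :: "real poly"
  by (rule ext) (rule DERIV_imp_deriv[OF poly_DERIV])

text \<open>The integral in the recursion is evaluated by an antiderivative q. Its derivative is
  exported along with the polynomial form, because both the differentiated recurrence and the parity
  argument start from it.\<close>

lemma E_bar_poly_step:
  assumes s: "s \<ge> 2" and e: "\<And>j. 1 \<le> j \<Longrightarrow> j \<le> s \<Longrightarrow> E_bar j = poly (e j)"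
  obtains q where
    "E_bar (s + 1) = poly (smult (- 1/2) ([:1, 0, -1:]^2 * pderiv (e s) + (q - [:poly q (sigma s):])))"
    "pderiv q = [:1, 0, -1:]^2 * (\<Sum>j=1..s-1. pderiv (e j) * pderiv (e (s - j)))"
proof -
  define r where "r = [:1, 0, -1:]^2 * (\<Sum>j=1..s-1. pderiv (e j) * pderiv (e (s - j)))"
  obtain q where q: "pderiv q = r" using pderiv_surj by blast
  have d: "deriv (E_bar j) = poly (pderiv (e j))" if "1 \<le> j" "j \<le> s" for j
    using e[OF that] deriv_poly by simp
  have "E_bar (s + 1) \<beta> = poly (smult (- 1/2) ([:1, 0, -1:]^2 * pderiv (e s) + (q - [:poly q (sigma s):]))) \<beta>" for \<beta>
  proof -
    have "(1 - p^2)^2 * (\<Sum>j = 1..s - 1. deriv (E_bar j) p * deriv (E_bar (s - j)) p) = poly (pderiv q) p" for p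
    proof -
      have "(\<Sum>j = 1..s - 1. deriv (E_bar j) p * deriv (E_bar (s - j)) p) =
            (\<Sum>j = 1..s - 1. poly (pderiv (e j)) p * poly (pderiv (e (s - j))) p)"
        by (intro sum.cong refl) (auto simp: d)
      then show ?thesis unfolding q r_def by (simp add: poly_sum power2_eq_square algebra_simps)
    qed
    then have "E_bar (s + 1) \<beta> = - (1/2) * (1 - \<beta>^2)^2 * poly (pderiv (e s)) \<beta>
        - 1/2 * (poly q \<beta> - poly q (sigma s))"
      using E_bar_rec[OF s, of \<beta>] s by (simp add: d LBINT_pderiv)
    then show ?thesis by (simp add: power2_eq_square algebra_simps)
  qed
  then show ?thesis using that[of q] q unfolding r_def by blast
qed

lemma E_bar_1_poly: "E_bar 1 = poly [:0, 1/4, 0, -5/24:]"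
  by (auto simp: fun_eq_iff power2_eq_square algebra_simps)

text \<open>Exhibits the second coefficient as -1/2 (1 - \<beta>^2)^2 times the derivative of the
  first, that is, the recursion at s = 1 with an empty sum.\<close>

lemma E_bar_2_poly: "E_bar 2 = poly (smult (- 1/2) ([:1, 0, -1:]^2 * [:1/4, 0, -5/8:]))"
proof
  fix x
  have "E_bar 2 x = 1/16 * (1 - x^2)^2 * (5 * x^2 - 2)" by (simp only: numeral_2_eq_2 E_bar.simps)
  then show "E_bar 2 x = poly (smult (- 1/2) ([:1, 0, -1:]^2 * [:1/4, 0, -5/8:])) x"
    by (simp add: power2_eq_square field_simps)
qed

lemma E_bar_is_poly: "\<exists>p. E_bar s = poly p"
proof (induction s rule: less_induct)
  case (less s)
  consider "s = 0" | "s = 1" | "s = 2" | "s \<ge> 3" by linarith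
  then show ?case
  proof cases
    case 1
    then have "E_bar s = poly 0" by (auto simp: fun_eq_iff)
    then show ?thesis by blast
  next
    case 4
    obtain e where e: "\<And>j. j < s \<Longrightarrow> E_bar j = poly (e j)" using less by metis
    have s1: "s - 1 + 1 = s" using 4 by simp
    show ?thesis
    proof (rule E_bar_poly_step[of "s - 1" e])
      show "2 \<le> s - 1" using 4 by simp
      show "E_bar j = poly (e j)" if "1 \<le> j" "j \<le> s - 1" for j using e[of j] that 4 by simp
    next
      fix q assume "E_bar (s - 1 + 1) = poly (smult (- 1/2) ([:1, 0, -1:]^2 * pderiv (e (s - 1)) + (q - [:poly q (sigma (s - 1)):])))"
      then show ?thesis unfolding s1 by blast
    qed
  next
    case 2
    show ?thesis unfolding 2 by (rule exI, rule E_bar_1_poly)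
  next
    case 3
    show ?thesis unfolding 3 by (rule exI, rule E_bar_2_poly)
  qed
qed

definition E_poly :: "nat \<Rightarrow> real poly" where "E_poly s = (SOME p. E_bar s = poly p)"

lemma E_bar_eq_poly: "E_bar s = poly (E_poly s)"
  unfolding E_poly_def by (rule someI_ex[OF E_bar_is_poly])

text \<open>\<open>D_poly s\<close> is the \<open>\<xi>\<close>-derivative of \<open>E_bar s\<close> as a polynomial in \<open>\<beta>\<close>, since
  \<open>d\<beta>/d\<xi> = (1 - \<beta>\<^sup>2)\<^sup>2\<close>.\<close>

definition D_poly :: "nat \<Rightarrow> real poly" where
  "D_poly s = [:1, 0, -1:]^2 * pderiv (E_poly s)"

lemma D_poly_1: "D_poly 1 = [:1, 0, -1:]^2 * [:1/4, 0, -5/8:]"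
proof -
  have "poly (E_poly 1) = poly [:0, 1/4, 0, -5/24:]" using E_bar_1_poly E_bar_eq_poly by metis
  then have "E_poly 1 = [:0, 1/4, 0, -5/24:]" by (simp only: poly_eq_poly_eq_iff)
  then show ?thesis unfolding D_poly_def by (simp add: pderiv_pCons)
qed

text \<open>Differentiating the recursion removes the constants of integration. What is left is the
  coefficientwise form of the Riccati equation, valid from s = 1 on.\<close>

lemma D_poly_rec:
  assumes s: "s \<ge> 1"
  shows "2 * D_poly (s + 1) + [:1, 0, -1:]^2 * pderiv (D_poly s) + (\<Sum>j=1..s-1. D_poly j * D_poly (s - j)) = 0"
proof -
  let ?B = "[:1, 0, -1:]^2 :: real poly"
  have "\<exists>r. E_poly (s + 1) = smult (- 1/2) (D_poly s + r) \<and>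
     pderiv r = ?B * (\<Sum>j=1..s-1. pderiv (E_poly j) * pderiv (E_poly (s - j)))"
  proof (cases "s = 1")
    case True
    have "poly (E_poly 2) = poly (smult (- 1/2) (D_poly 1))"
      unfolding D_poly_1 using E_bar_2_poly E_bar_eq_poly[of 2] by (simp only:)
    then have "E_poly 2 = smult (- 1/2) (D_poly 1)" by (simp only: poly_eq_poly_eq_iff)
    then show ?thesis unfolding True by (intro exI[of _ 0]) (simp add: numeral_2_eq_2)
  next
    case False
    then have s2: "s \<ge> 2" using s by simp
    obtain q where q: "E_bar (s + 1) = poly (smult (- 1/2) (?B * pderiv (E_poly s) + (q - [:poly q (sigma s):])))"
      "pderiv q = ?B * (\<Sum>j=1..s-1. pderiv (E_poly j) * pderiv (E_poly (s - j)))"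
      by (rule E_bar_poly_step[OF s2, of E_poly, OF E_bar_eq_poly])
    have "E_poly (s + 1) = smult (- 1/2) (D_poly s + (q - [:poly q (sigma s):]))"
      using q(1) E_bar_eq_poly[of "s + 1"] unfolding D_poly_def by (simp only: poly_eq_poly_eq_iff)
    then show ?thesis using q(2)
      by (intro exI[of _ "q - [:poly q (sigma s):]"]) (simp add: pderiv_diff pderiv_pCons)
  qed
  then obtain r where r: "E_poly (s + 1) = smult (- 1/2) (D_poly s + r)"
     "pderiv r = ?B * (\<Sum>j=1..s-1. pderiv (E_poly j) * pderiv (E_poly (s - j)))" by blast
  have h: "2 * (b * smult (- 1/2) x) = - (b * x)" for b x :: "real poly"
    by (simp add: numeral_poly)
  have "2 * D_poly (s + 1) = - (?B * (pderiv (D_poly s) + pderiv r))"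
    unfolding D_poly_def[of "s + 1"] r(1) pderiv_smult pderiv_add h ..
  moreover have "?B * pderiv r = (\<Sum>j=1..s-1. D_poly j * D_poly (s - j))"
    unfolding r(2) D_poly_def by (simp add: sum_distrib_left mult_ac)
  ultimately show ?thesis by (simp add: ring_distribs)
qed

text \<open>From index 4 on, an even index arises from an odd one, where \<open>sigma\<close> is 1,
  so the integral is empty at \<beta> = 1; the other term has the factor (1 - \<beta>^2)^2. Thus the
  even coefficients do not change the modulus at infinity.\<close>

lemma E_bar_even_at_1: "even s \<Longrightarrow> E_bar s 1 = 0"
proof -
  assume s: "even s"
  have "s \<noteq> 1" using s by auto
  then consider "s = 0" | "s = 2" | "s \<ge> 3" by linarith
  then show ?thesis
  proof cases
    case 3
    then have "odd (s - 1)" "s - 1 \<ge> 2" "s - 1 + 1 = s" using s by auto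
    then show ?thesis using E_bar_rec[of "s - 1" 1] by (simp add: sigma_def one_ereal_def[symmetric])
  next
    case 2
    show ?thesis unfolding 2 E_bar_2_poly by simp
  qed simp
qed

text \<open>The integrand at stage t has parity (-1)^t. For odd t its antiderivative is even; for
  even t the lower limit \<open>sigma t\<close> = 0 makes the integral odd.\<close>

lemma E_bar_parity: "s \<ge> 1 \<Longrightarrow> E_bar s (- \<beta>) = (- 1) ^ s * E_bar s \<beta>"
proof (induction s arbitrary: \<beta> rule: less_induct)
  case (less s)
  consider "s = 1" | "s = 2" | "s \<ge> 3" using less.prems by linarith
  then show ?case
  proof cases
    case 3
    define t where "t = s - 1"
    have t: "t \<ge> 2" "s = t + 1" using 3 unfolding t_def by auto
    have dpar: "poly (pderiv (E_poly j)) (- \<beta>) = - ((- 1) ^ j) * poly (pderiv (E_poly j)) \<beta>"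
      if "1 \<le> j" "j \<le> t" for j \<beta>
    proof -
      have 1: "((\<lambda>b. poly (E_poly j) (- b)) has_real_derivative - poly (pderiv (E_poly j)) (- \<beta>)) (at \<beta>)"
        by (rule DERIV_cong[OF DERIV_chain2[OF poly_DERIV DERIV_minus[OF DERIV_ident]]]) simp
      have "j < s" using that t by simp
      have 2: "(\<lambda>b. poly (E_poly j) (- b)) = (\<lambda>b. (- 1) ^ j * poly (E_poly j) b)"
        using less.IH[OF \<open>j < s\<close> that(1)] by (simp only: E_bar_eq_poly)
      have "- poly (pderiv (E_poly j)) (- \<beta>) = (- 1) ^ j * poly (pderiv (E_poly j)) \<beta>"
        by (rule DERIV_unique[OF 1[unfolded 2] DERIV_cmult[OF poly_DERIV]])
      then show ?thesis by simp
    qed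
    let ?B = "[:1, 0, -1:]^2 :: real poly"
    obtain q where q: "E_bar (t + 1) = poly (smult (- 1/2) (?B * pderiv (E_poly t) + (q - [:poly q (sigma t):])))"
      "pderiv q = ?B * (\<Sum>j=1..t-1. pderiv (E_poly j) * pderiv (E_poly (t - j)))"
      by (rule E_bar_poly_step[OF t(1), of E_poly, OF E_bar_eq_poly])
    have B: "poly ?B (- b) = poly ?B b" for b by (simp add: power2_eq_square)
    have dq: "poly (pderiv q) (- b) = (- 1) ^ t * poly (pderiv q) b" for b
    proof -
      have "poly (pderiv (E_poly j)) (- b) * poly (pderiv (E_poly (t - j))) (- b) =
            (- 1) ^ t * (poly (pderiv (E_poly j)) b * poly (pderiv (E_poly (t - j))) b)" if "j \<in> {1..t-1}" for j
      proof -
        have j: "1 \<le> j" "j \<le> t" "1 \<le> t - j" "t - j \<le> t" "j + (t - j) = t" using that t by auto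
        then have "(- 1 :: real) ^ t = (- 1) ^ j * (- 1) ^ (t - j)" by (metis power_add)
        then show ?thesis unfolding dpar[OF j(1,2)] dpar[OF j(3,4)] by (simp add: mult_ac)
      qed
      then have "(\<Sum>j=1..t-1. poly (pderiv (E_poly j)) (- b) * poly (pderiv (E_poly (t - j))) (- b)) =
          (- 1) ^ t * (\<Sum>j=1..t-1. poly (pderiv (E_poly j)) b * poly (pderiv (E_poly (t - j))) b)"
        unfolding sum_distrib_left by (intro sum.cong refl) auto
      then show ?thesis unfolding q(2) poly_mult poly_sum B by (simp add: mult_ac)
    qed
    have d0: "((\<lambda>b. poly q (- b) + (- 1) ^ t * poly q b) has_real_derivative 0) (at b)" for b
    proof -
      have "((\<lambda>b. poly q (- b) + (- 1) ^ t * poly q b) has_real_derivative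
          poly (pderiv q) (- b) * (- 1) + (- 1) ^ t * poly (pderiv q) b) (at b)"
        by (rule DERIV_add[OF DERIV_chain2[OF poly_DERIV DERIV_minus[OF DERIV_ident]] DERIV_cmult[OF poly_DERIV]])
      then show ?thesis using dq[of b] by simp
    qed
    have const: "poly q (- \<beta>) + (- 1) ^ t * poly q \<beta> = poly q (- x) + (- 1) ^ t * poly q x" for x
      by (rule DERIV_isconst_all[where f = "\<lambda>b. poly q (- b) + (- 1) ^ t * poly q b"]) (use d0 in blast)
    have Q: "poly q (- \<beta>) - poly q (sigma t) = - ((- 1) ^ t) * (poly q \<beta> - poly q (sigma t))"
    proof (cases "even t")
      case True
      then show ?thesis using const[of 0] by (simp add: sigma_def)
    next
      case False
      then show ?thesis using const[of 0] by (simp add: sigma_def)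
    qed
    have E: "E_bar (t + 1) b = - 1/2 * (poly ?B b * poly (pderiv (E_poly t)) b + (poly q b - poly q (sigma t)))" for b
      by (simp only: q(1) poly_smult poly_add poly_mult poly_diff poly_pCons poly_0 mult_zero_right add_0_right)
    have D: "poly (pderiv (E_poly t)) (- \<beta>) = - ((- 1) ^ t) * poly (pderiv (E_poly t)) \<beta>"
      using dpar[of t \<beta>] t by simp
    have alg: "- 1/2 * (b * (- s * p) + - s * r) = s * (- 1) * (- 1/2 * (b * p + r))" for b s p r :: real
      by (simp add: field_simps)
    have "E_bar (t + 1) (- \<beta>) = (- 1) ^ (t + 1) * E_bar (t + 1) \<beta>"
      unfolding E Q B D power_add power_one_right by (rule alg)
    then show ?thesis using t by simp
  next
    case 2
    show ?thesis unfolding 2 E_bar_2_poly by (simp add: power2_eq_square algebra_simps)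
  qed simp
qed

lemma E_bar_odd_at_0: "odd s \<Longrightarrow> E_bar s 0 = 0"
  using E_bar_parity[of s 0] by (cases "s = 0") auto

section \<open>The Riccati residual\<close>

text \<open>The \<xi>-derivative of the truncated exponent i u \<xi> plus the sum of
  \<open>E_bar j\<close> / (i u)^j, as a function of b = \<beta>; \<open>lg_Q\<close> is in turn the
  \<xi>-derivative of \<open>lg_P\<close>.\<close>

definition lg_P :: "nat \<Rightarrow> real \<Rightarrow> real \<Rightarrow> complex" where
  "lg_P n u b = \<i> * of_real u + (\<Sum>j=1..n. of_real (poly (D_poly j) b) / (\<i> * of_real u) ^ j)"

definition lg_Q :: "nat \<Rightarrow> real \<Rightarrow> real \<Rightarrow> complex" where
  "lg_Q n u b = (\<Sum>j=1..n. of_real ((1 - b^2)^2 * poly (pderiv (D_poly j)) b) / (\<i> * of_real u) ^ j)"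

text \<open>The residual u^2 + P^2 + dP/d\<xi> - Schwarzian of the Riccati equation; by
  \<open>schwarzian_eq\<close> the last term is the Schwarzian of the change from x to
  \<xi>.\<close>

definition lg_R :: "nat \<Rightarrow> real \<Rightarrow> real \<Rightarrow> complex" where
  "lg_R n u b = of_real (u^2) + (lg_P n u b)^2 + lg_Q n u b - 2 * of_real (poly (D_poly 1) b)"

lemma sum_pairs_le:
  fixes f :: "nat \<Rightarrow> nat \<Rightarrow> 'a::comm_monoid_add"
  shows "(\<Sum>(j, l)\<in>{(j, l)\<in>{1..n} \<times> {1..n}. j + l \<le> n}. f j l) = (\<Sum>k=1..n. \<Sum>j=1..k-1. f j (k - j))"
proof -
  have "(\<Sum>k=1..n. \<Sum>j=1..k-1. f j (k - j)) = (\<Sum>(k, j)\<in>(SIGMA k:{1..n}. {1..k-1}). f j (k - j))"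
    by (rule sum.Sigma) auto
  also have "\<dots> = (\<Sum>(j, l)\<in>{(j, l)\<in>{1..n} \<times> {1..n}. j + l \<le> n}. f j l)"
    by (rule sum.reindex_bij_witness[where i = "\<lambda>(j, l). (j + l, j)" and j = "\<lambda>(k, j). (j, k - j)"]) auto
  finally show ?thesis ..
qed

text \<open>By the recurrence for the coefficients all terms of order less than \<open>n\<close> cancel in the Riccati residual
  \<open>lg_R\<close>.\<close>

lemma lg_R_eq:
  assumes u: "u > 0" and n: "n \<ge> 1"
  defines "c \<equiv> 1 / (\<i> * of_real u)" and "d \<equiv> \<lambda>j b. complex_of_real (poly (D_poly j) b)"
  shows "lg_R n u b = - 2 * d (n + 1) b * c ^ n
    + (\<Sum>(j, l)\<in>{(j, l)\<in>{1..n} \<times> {1..n}. j + l > n}. d j b * c ^ j * (d l b * c ^ l))"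
proof -
  define d' where "d' = (\<lambda>j. complex_of_real ((1 - b^2)^2 * poly (pderiv (D_poly j)) b))"
  define f where "f = (\<lambda>j l. d j b * c ^ j * (d l b * c ^ l))"
  have c0: "c \<noteq> 0" using u unfolding c_def by simp
  have cu: "\<i> * of_real u = 1 / c" unfolding c_def by simp
  have u2: "complex_of_real (u^2) = - ((1 / c)^2)" unfolding cu[symmetric] by (simp add: power_mult_distrib)
  have rec: "2 * d (k + 1) b + d' k + (\<Sum>j=1..k-1. d j b * d (k - j) b) = 0" if "k \<ge> 1" for k
  proof -
    have "poly (2 * D_poly (k + 1) + [:1, 0, -1:]^2 * pderiv (D_poly k) + (\<Sum>j=1..k-1. D_poly j * D_poly (k - j))) b = 0"
      unfolding D_poly_rec[OF that] by simp
    moreover have "poly ([:1, 0, -1:]^2) b = (1 - b^2)^2" by (simp add: power2_eq_square algebra_simps)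
    moreover have "poly (2 * p) b = 2 * poly p b" for p :: "real poly" by simp
    ultimately have "2 * poly (D_poly (k + 1)) b + (1 - b^2)^2 * poly (pderiv (D_poly k)) b
        + (\<Sum>j=1..k-1. poly (D_poly j) b * poly (D_poly (k - j)) b) = 0"
      by (simp only: poly_add poly_mult poly_sum)
    then have "complex_of_real (2 * poly (D_poly (k + 1)) b + (1 - b^2)^2 * poly (pderiv (D_poly k)) b
        + (\<Sum>j=1..k-1. poly (D_poly j) b * poly (D_poly (k - j)) b)) = of_real 0" by (simp only:)
    then show ?thesis unfolding d_def d'_def by simp
  qed
  define S where "S = (\<Sum>j=1..n. d j b * c ^ j)"
  have SS: "S^2 = (\<Sum>(j, l)\<in>{(j, l)\<in>{1..n} \<times> {1..n}. j + l > n}. f j l) + (\<Sum>k=1..n. c ^ k * (\<Sum>j=1..k-1. d j b * d (k - j) b))"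
  proof -
    have "S^2 = (\<Sum>(j, l)\<in>{1..n} \<times> {1..n}. f j l)"
      unfolding power2_eq_square S_def f_def by (simp add: sum_product sum.cartesian_product)
    also have "{1..n} \<times> {1..n} = {(j, l)\<in>{1..n} \<times> {1..n}. j + l > n} \<union> {(j, l)\<in>{1..n} \<times> {1..n}. j + l \<le> n}"
      by auto
    also have "(\<Sum>(j, l)\<in>\<dots>. f j l) = (\<Sum>(j, l)\<in>{(j, l)\<in>{1..n} \<times> {1..n}. j + l > n}. f j l)
        + (\<Sum>(j, l)\<in>{(j, l)\<in>{1..n} \<times> {1..n}. j + l \<le> n}. f j l)"
      by (rule sum.union_disjoint) (auto intro: finite_subset[of _ "{1..n} \<times> {1..n}"])
    also have "(\<Sum>(j, l)\<in>{(j, l)\<in>{1..n} \<times> {1..n}. j + l \<le> n}. f j l) = (\<Sum>k=1..n. \<Sum>j=1..k-1. f j (k - j))"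
      by (rule sum_pairs_le)
    also have "\<dots> = (\<Sum>k=1..n. c ^ k * (\<Sum>j=1..k-1. d j b * d (k - j) b))"
    proof (intro sum.cong refl)
      fix k assume "k \<in> {1..n}"
      have "f j (k - j) = c ^ k * (d j b * d (k - j) b)" if "j \<in> {1..k-1}" for j
      proof -
        have "j + (k - j) = k" using that by auto
        then have "c ^ k = c ^ j * c ^ (k - j)" by (metis power_add)
        then show ?thesis unfolding f_def by (simp add: mult_ac)
      qed
      then show "(\<Sum>j=1..k-1. f j (k - j)) = c ^ k * (\<Sum>j=1..k-1. d j b * d (k - j) b)"
        unfolding sum_distrib_left by (intro sum.cong refl) auto
    qed
    finally show ?thesis .
  qed
  have inv: "x / (\<i> * of_real u) ^ j = x * c ^ j" for x j
    unfolding c_def by (simp add: power_divide)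
  have P: "lg_P n u b = 1 / c + S" unfolding lg_P_def inv S_def d_def unfolding cu ..
  have Q: "lg_Q n u b = (\<Sum>k=1..n. d' k * c ^ k)" unfolding lg_Q_def inv d'_def ..
  \<comment> \<open>Division by c shifts the index by one. The lowest term cancels the Schwarzian,
    and at the top the coefficient n + 1, absent from the truncation, has to be added and
    subtracted.\<close>
  have cS: "2 * S / c - 2 * d 1 b = (\<Sum>k=1..n. 2 * d (k + 1) b * c ^ k) - 2 * d (n + 1) b * c ^ n"
  proof -
    have "2 * S / c = (\<Sum>j=1..n. 2 * d j b * c ^ (j - 1))"
      unfolding S_def sum_distrib_left sum_divide_distrib
    proof (intro sum.cong refl)
      fix j assume "j \<in> {1..n}"
      then have "c ^ j = c * c ^ (j - 1)" by (metis atLeastAtMost_iff not_one_le_zero power_eq_if)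
      then show "2 * (d j b * c ^ j) / c = 2 * d j b * c ^ (j - 1)" using c0 by simp
    qed
    also have "\<dots> = (\<Sum>k<n. 2 * d (k + 1) b * c ^ k)"
      by (rule sum.reindex_bij_witness[where i = Suc and j = "\<lambda>j. j - 1"]) auto
    also have "\<dots> = (\<Sum>k\<in>insert 0 {1..n}. 2 * d (k + 1) b * c ^ k) - 2 * d (n + 1) b * c ^ n"
    proof -
      have "insert 0 {1..n} = {..<Suc n}" by auto
      then show ?thesis by simp
    qed
    finally show ?thesis by simp
  qed
  have "lg_R n u b = (2 * S / c - 2 * d 1 b) + S^2 + (\<Sum>k=1..n. d' k * c ^ k)"
    unfolding lg_R_def P Q u2 by (simp add: power2_sum d_def)
  also have "\<dots> = - 2 * d (n + 1) b * c ^ n + (\<Sum>(j, l)\<in>{(j, l)\<in>{1..n} \<times> {1..n}. j + l > n}. f j l)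
     + (\<Sum>k=1..n. c ^ k * (2 * d (k + 1) b + d' k + (\<Sum>j=1..k-1. d j b * d (k - j) b)))"
    unfolding cS SS by (simp add: sum.distrib ring_distribs mult_ac)
  also have "(\<Sum>k=1..n. c ^ k * (2 * d (k + 1) b + d' k + (\<Sum>j=1..k-1. d j b * d (k - j) b))) = 0"
    by (intro sum.neutral ballI) (use rec in simp)
  finally show ?thesis unfolding f_def by simp
qed

lemma D_poly_bound:
  obtains K where "K \<ge> 0" "\<And>b. 0 \<le> b \<Longrightarrow> b \<le> 1 \<Longrightarrow> \<bar>poly (D_poly j) b\<bar> \<le> K * (1 - b^2)^2"
proof -
  have "compact (poly (pderiv (E_poly j)) ` {0..1})"
    by (intro compact_continuous_image continuous_intros) auto
  then have "bounded (poly (pderiv (E_poly j)) ` {0..1})" by (rule compact_imp_bounded)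
  then obtain K where K: "K > 0" "\<And>b. b \<in> {0..1} \<Longrightarrow> \<bar>poly (pderiv (E_poly j)) b\<bar> \<le> K"
    unfolding bounded_pos by auto
  have "\<bar>poly (D_poly j) b\<bar> \<le> K * (1 - b^2)^2" if "0 \<le> b" "b \<le> 1" for b
  proof -
    have "poly ([:1, 0, -1:]^2) b = (1 - b^2)^2" by (simp add: power2_eq_square algebra_simps)
    then have "poly (D_poly j) b = poly (pderiv (E_poly j)) b * (1 - b^2)^2"
      unfolding D_poly_def poly_mult by simp
    then show ?thesis using K(2)[of b] that by (simp add: abs_mult mult_right_mono)
  qed
  then show ?thesis using that K by (meson less_imp_le)
qed

text \<open>The factor (1 - b^2)^2 is retained because it is d\<beta>/d\<xi> and so makes both
  bounds integrable along \<xi>. Each product in the residual contains it twice; one copy is kept,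
  the other is at most 1.\<close>

lemma lg_bounds:
  assumes n: "n \<ge> 1"
  obtains M where "M \<ge> 0"
    "\<And>u b. u \<ge> 1 \<Longrightarrow> 0 \<le> b \<Longrightarrow> b \<le> 1 \<Longrightarrow> norm (lg_P n u b - \<i> * of_real u) \<le> M * (1 - b^2)^2"
    "\<And>u b. u \<ge> 1 \<Longrightarrow> 0 \<le> b \<Longrightarrow> b \<le> 1 \<Longrightarrow> norm (lg_R n u b) \<le> M * (1 - b^2)^2 / u ^ n"
proof -
  have "\<exists>K. \<forall>j. K j \<ge> 0 \<and> (\<forall>b. 0 \<le> b \<longrightarrow> b \<le> 1 \<longrightarrow> \<bar>poly (D_poly j) b\<bar> \<le> K j * (1 - b^2)^2)"
    by (rule choice) (meson D_poly_bound)
  then obtain K where K: "\<And>j. K j \<ge> 0" "\<And>j b. 0 \<le> b \<Longrightarrow> b \<le> 1 \<Longrightarrow> \<bar>poly (D_poly j) b\<bar> \<le> K j * (1 - b^2)^2"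
    by blast
  define T where "T = {(j, l)\<in>{1..n} \<times> {1..n}. j + l > n}"
  have T: "finite T" unfolding T_def by (auto intro: finite_subset[of _ "{1..n} \<times> {1..n}"])
  define M where "M = (\<Sum>j=1..n. K j) + (2 * K (n + 1) + (\<Sum>(j, l)\<in>T. K j * K l))"
  have M1: "0 \<le> (\<Sum>j=1..n. K j)" by (intro sum_nonneg K)
  have M2: "0 \<le> 2 * K (n + 1) + (\<Sum>(j, l)\<in>T. K j * K l)"
    using K(1) by (intro add_nonneg_nonneg sum_nonneg) auto
  have "norm (lg_P n u b - \<i> * of_real u) \<le> M * (1 - b^2)^2 \<and> norm (lg_R n u b) \<le> M * (1 - b^2)^2 / u ^ n"
    if u: "u \<ge> 1" and b: "0 \<le> b" "b \<le> 1" for u b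
  proof
    have u0: "u > 0" using u by simp
    have b2: "0 \<le> 1 - b^2" "1 - b^2 \<le> 1" using b by (auto simp: power_le_one_iff abs_square_le_1)
    then have B: "(1 - b^2)^2 \<le> 1" by (intro power_le_one) auto
    have pw: "u ^ j \<ge> 1" for j using u by (rule one_le_power)
    have "norm (lg_P n u b - \<i> * of_real u) \<le> (\<Sum>j=1..n. K j * (1 - b^2)^2)"
    proof -
      have "lg_P n u b - \<i> * of_real u = (\<Sum>j=1..n. of_real (poly (D_poly j) b) / (\<i> * of_real u) ^ j)"
        unfolding lg_P_def by simp
      also have "norm \<dots> \<le> (\<Sum>j=1..n. K j * (1 - b^2)^2)"
      proof (rule sum_norm_le)
        fix j
        have "norm (complex_of_real (poly (D_poly j) b) / (\<i> * of_real u) ^ j) = \<bar>poly (D_poly j) b\<bar> / u ^ j"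
          using u by (simp add: norm_divide norm_power norm_mult)
        also have "\<dots> \<le> \<bar>poly (D_poly j) b\<bar> / 1" using pw[of j] by (intro divide_left_mono) auto
        also have "\<dots> \<le> K j * (1 - b^2)^2" using K(2)[OF b] by simp
        finally show "norm (complex_of_real (poly (D_poly j) b) / (\<i> * of_real u) ^ j) \<le> K j * (1 - b^2)^2" .
      qed
      finally show ?thesis .
    qed
    also have "\<dots> = (\<Sum>j=1..n. K j) * (1 - b^2)^2" by (simp add: sum_distrib_right)
    also have "\<dots> \<le> M * (1 - b^2)^2" unfolding M_def using M2 by (intro mult_right_mono) auto
    finally show "norm (lg_P n u b - \<i> * of_real u) \<le> M * (1 - b^2)^2" .
    define c where "c = 1 / (\<i> * complex_of_real u)"
    define d where "d = (\<lambda>j. complex_of_real (poly (D_poly j) b))"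
    have nc: "norm c ^ j = 1 / u ^ j" for j using u unfolding c_def by (simp add: norm_divide norm_mult power_divide)
    have R: "lg_R n u b = - 2 * d (n + 1) * c ^ n + (\<Sum>(j, l)\<in>T. d j * c ^ j * (d l * c ^ l))"
      using lg_R_eq[OF u0 n, of b] unfolding c_def d_def T_def .
    have nd: "norm (d j) \<le> K j * (1 - b^2)^2" for j unfolding d_def using K(2)[OF b] by simp
    have nd1: "norm (d j) \<le> K j" for j
      using nd[of j] mult_left_mono[OF B K(1)[of j]] by simp
    have "norm (lg_R n u b) \<le> norm (- 2 * d (n + 1) * c ^ n) + norm (\<Sum>(j, l)\<in>T. d j * c ^ j * (d l * c ^ l))"
      unfolding R by (rule norm_triangle_ineq)
    also have "norm (- 2 * d (n + 1) * c ^ n) \<le> 2 * K (n + 1) * (1 - b^2)^2 / u ^ n"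
      using nd[of "n + 1"] u by (simp add: norm_mult norm_power nc divide_right_mono)
    also have "norm (\<Sum>(j, l)\<in>T. d j * c ^ j * (d l * c ^ l)) \<le> (\<Sum>(j, l)\<in>T. K j * K l * ((1 - b^2)^2 / u ^ n))"
    proof (rule sum_norm_le)
      fix p assume "p \<in> T"
      then obtain j l where p: "p = (j, l)" "j + l > n" unfolding T_def by auto
      have "norm (d j * c ^ j * (d l * c ^ l)) = norm (d j) * norm (d l) * (1 / u ^ (j + l))"
        by (simp add: norm_mult norm_power nc power_add)
      also have "\<dots> \<le> (K j * (1 - b^2)^2) * K l * (1 / u ^ n)"
      proof (intro mult_mono nd nd1)
        have "u ^ n \<le> u ^ (j + l)" using u p by (intro power_increasing) auto
        then show "1 / u ^ (j + l) \<le> 1 / u ^ n" using u by (intro divide_left_mono) auto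
      qed (use K(1) u in auto)
      finally show "norm (case p of (j, l) \<Rightarrow> d j * c ^ j * (d l * c ^ l)) \<le> (case p of (j, l) \<Rightarrow> K j * K l * ((1 - b^2)^2 / u ^ n))"
        unfolding p by (simp add: mult_ac)
    qed
    also have "\<dots> = (\<Sum>(j, l)\<in>T. K j * K l) * ((1 - b^2)^2 / u ^ n)"
      by (simp only: sum_distrib_right case_prod_unfold)
    finally have "norm (lg_R n u b) \<le> (2 * K (n + 1) + (\<Sum>(j, l)\<in>T. K j * K l)) * ((1 - b^2)^2 / u ^ n)"
      by (simp add: ring_distribs add_divide_distrib)
    also have "\<dots> \<le> M * ((1 - b^2)^2 / u ^ n)" unfolding M_def using M1 u by (intro mult_right_mono) auto
    finally show "norm (lg_R n u b) \<le> M * (1 - b^2)^2 / u ^ n" by simp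
  qed
  moreover have "M \<ge> 0" unfolding M_def using M1 M2 by simp
  ultimately show ?thesis using that by blast
qed

section \<open>The Liouville-Green transformation\<close>

text \<open>With s = sqrt (1 + x^2) the last two parts say d\<beta>/dx = s^(-3) and d\<xi>/dx = s,
  so d\<beta>/d\<xi> = s^(-4) = (1 - \<beta>^2)^2.\<close>

lemma sqrt_1_plus_sq_derivs:
  fixes x :: real
  shows "((\<lambda>x. sqrt (1 + x^2)) has_real_derivative x / sqrt (1 + x^2)) (at x)"
    "((\<lambda>x. 1 / sqrt (1 + x^2)) has_real_derivative - x / sqrt (1 + x^2) ^ 3) (at x)"
    "(beta_bar has_real_derivative 1 / sqrt (1 + x^2) ^ 3) (at x)"
    "(xi_bar has_real_derivative sqrt (1 + x^2)) (at x)"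
proof -
  define s where "s = sqrt (1 + x^2)"
  have p: "1 + x^2 > 0" by (simp add: add_pos_nonneg)
  then have s: "s > 0" "s^2 = 1 + x^2" unfolding s_def by auto
  show 1: "((\<lambda>x. sqrt (1 + x^2)) has_real_derivative x / sqrt (1 + x^2)) (at x)"
    using p by (auto intro!: derivative_eq_intros simp: field_simps)
  have 2: "((\<lambda>x. 1 / sqrt (1 + x^2)) has_real_derivative - (x / s) / s^2) (at x)"
  proof -
    have "sqrt (1 + x^2) \<noteq> 0" using s(1) unfolding s_def by linarith
    from DERIV_inverse_fun[OF 1 this, unfolded inverse_eq_divide] show ?thesis
      by (rule DERIV_cong) (simp add: s_def numeral_2_eq_2)
  qed
  then show "((\<lambda>x. 1 / sqrt (1 + x^2)) has_real_derivative - x / sqrt (1 + x^2) ^ 3) (at x)"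
    unfolding s_def[symmetric] by (simp add: power3_eq_cube power2_eq_square mult.assoc)
  have "((\<lambda>x. x * (1 / sqrt (1 + x^2))) has_real_derivative 1 * (1 / s) + (- (x / s) / s^2) * x) (at x)"
    using DERIV_mult[OF DERIV_ident 2] unfolding s_def by simp
  moreover have "1 * (1 / s) + (- (x / s) / s^2) * x = 1 / s^3"
  proof -
    have "1 * (1 / s) + (- (x / s) / s^2) * x = (s^2 - x^2) / s^3"
      using s(1) by (simp add: field_simps power2_eq_square power3_eq_cube)
    then show ?thesis using s(2) by simp
  qed
  ultimately show "(beta_bar has_real_derivative 1 / sqrt (1 + x^2) ^ 3) (at x)"
    unfolding beta_bar_def[abs_def] s_def by (simp add: add.commute)
  have xs: "x + s > 0"
  proof -
    have "\<bar>x\<bar> < s" using s p unfolding s_def by (metis less_add_one add.commute real_sqrt_abs real_sqrt_less_iff)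
    then show ?thesis by linarith
  qed
  have l: "((\<lambda>x. ln (x + sqrt (1 + x^2))) has_real_derivative (1 / s)) (at x)"
  proof -
    have "((\<lambda>x. x + sqrt (1 + x^2)) has_real_derivative 1 + x / s) (at x)"
      unfolding s_def by (rule DERIV_add[OF DERIV_ident 1])
    from DERIV_chain2[OF DERIV_ln[OF xs[unfolded s_def]] this]
    have "((\<lambda>x. ln (x + sqrt (1 + x^2))) has_real_derivative inverse (x + s) * (1 + x / s)) (at x)"
      unfolding s_def .
    moreover have "inverse (x + s) * (1 + x / s) = 1 / s" using xs s by (simp add: field_simps)
    ultimately show ?thesis by simp
  qed
  have "((\<lambda>x. 1/2 * (x * sqrt (1 + x^2)) + 1/2 * ln (x + sqrt (1 + x^2))) has_real_derivative
      1/2 * (1 * s + (x / s) * x) + 1/2 * (1 / s)) (at x)"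
    using DERIV_add[OF DERIV_cmult[OF DERIV_mult[OF DERIV_ident 1]] DERIV_cmult[OF l], of "1/2" "1/2"]
    unfolding s_def[symmetric] .
  moreover have "1/2 * (1 * s + (x / s) * x) + 1/2 * (1 / s) = s"
  proof -
    have "1/2 * (1 * s + (x / s) * x) + 1/2 * (1 / s) = (s^2 + (1 + x^2)) / (2 * s)"
      using s(1) by (simp add: field_simps power2_eq_square)
    also have "\<dots> = s" unfolding s(2)[symmetric] using s(1) by (simp add: field_simps power2_eq_square)
    finally show ?thesis .
  qed
  moreover have "xi_bar = (\<lambda>x. 1/2 * (x * sqrt (1 + x^2)) + 1/2 * ln (x + sqrt (1 + x^2)))"
    unfolding xi_bar_def by (auto simp: fun_eq_iff add.commute mult_ac)
  ultimately show "(xi_bar has_real_derivative sqrt (1 + x^2)) (at x)" unfolding s_def by simp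
qed

lemma beta_bar_sq: "1 - (beta_bar x)^2 = 1 / (1 + x^2)"
proof -
  have p: "1 + x^2 > 0" by (simp add: add_pos_nonneg)
  then show ?thesis unfolding beta_bar_def by (simp add: power_divide add.commute field_simps)
qed

lemma beta_bar_bounds: "x \<ge> 0 \<Longrightarrow> 0 \<le> beta_bar x" "beta_bar x \<le> 1"
proof -
  have "(beta_bar x)^2 \<le> 1" using beta_bar_sq[of x] by (smt (verit) divide_nonneg_nonneg zero_le_power2)
  then show "beta_bar x \<le> 1" by (simp add: abs_square_le_1 abs_le_iff)
qed (simp add: beta_bar_def)

lemma beta_bar_tendsto_1: "(beta_bar \<longlongrightarrow> 1) at_top"
  unfolding beta_bar_def[abs_def] by real_asymp

text \<open>\<open>Li\<close> is the reciprocal of an approximate solution with logarithmic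
  derivative \<open>ell\<close>, h is the quotient and g its \<xi>-derivative. The term x T^2 / 2 in
  \<open>ell\<close> belongs to the amplitude (1 + x^2)^(-1/4), which also produces the Schwarzian
  in R.\<close>

lemma liouville_green_transform:
  fixes y y1 Li P Q :: "real \<Rightarrow> complex" and u x :: real
  defines "S \<equiv> \<lambda>x. complex_of_real (sqrt (1 + x^2))"
  defines "T \<equiv> \<lambda>x. complex_of_real (1 / sqrt (1 + x^2))"
  defines "ell \<equiv> \<lambda>x. S x * P x - of_real x * T x * T x / 2"
  defines "h \<equiv> \<lambda>x. y x * Li x" and "g \<equiv> \<lambda>x. (y1 x - ell x * y x) * Li x * T x"
  defines "R \<equiv> of_real (u^2) + (P x)^2 + Q x - of_real ((2 - 3 * x^2) / (4 * (1 + x^2)^3))"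
  assumes y: "(y has_vector_derivative y1 x) (at x)"
    and y1: "(y1 has_vector_derivative - of_real (u^2 * (1 + x^2)) * y x) (at x)"
    and Li: "(Li has_vector_derivative - ell x * Li x) (at x)"
    and P: "(P has_vector_derivative S x * Q x) (at x)"
  shows "(h has_vector_derivative S x * g x) (at x)"
    "(g has_vector_derivative - 2 * S x * P x * g x - S x * R * h x) (at x)"
proof -
  have p: "1 + x^2 > 0" by (simp add: add_pos_nonneg)
  define X where "X = complex_of_real x"
  have ST: "S x * T x = 1" unfolding S_def T_def of_real_mult[symmetric] using p by simp
  have S2: "S x ^ 2 = 1 + X^2" unfolding S_def X_def of_real_power[symmetric] using p by simp
  have h: "(h has_vector_derivative y x * (- ell x * Li x) + y1 x * Li x) (at x)"
    unfolding h_def by (rule has_vector_derivative_mult[OF y Li])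
  have "S x * g x = (S x * T x) * ((y1 x - ell x * y x) * Li x)" unfolding g_def by (simp add: mult_ac)
  then have "S x * g x = y x * (- ell x * Li x) + y1 x * Li x" unfolding ST by (simp add: algebra_simps)
  then show "(h has_vector_derivative S x * g x) (at x)" using h by simp
  have dS: "(S has_vector_derivative X * T x) (at x)"
    unfolding S_def T_def X_def
    by (rule has_vector_derivative_eq_rhs[OF has_vector_derivative_of_real[OF sqrt_1_plus_sq_derivs(1)]]) simp
  have dT: "(T has_vector_derivative - (X * T x ^ 3)) (at x)"
    unfolding T_def X_def
    by (rule has_vector_derivative_eq_rhs[OF has_vector_derivative_of_real[OF sqrt_1_plus_sq_derivs(2)]])
       (simp add: power_divide)
  have dX: "(complex_of_real has_vector_derivative 1) (at x)"
    by (rule has_vector_derivative_eq_rhs[OF has_vector_derivative_of_real[OF DERIV_ident]]) simp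
  define ell' where "ell' = (S x * (S x * Q x) + (X * T x) * P x)
      - ((of_real x * T x * - (X * T x ^ 3) + (of_real x * - (X * T x ^ 3) + 1 * T x) * T x) / 2)"
  have dell: "(ell has_vector_derivative ell') (at x)"
    unfolding ell_def ell'_def
    by (intro has_vector_derivative_diff has_vector_derivative_mult has_vector_derivative_divide dS dT dX P)
  define w where "w = (y1 x - ell x * y x) * Li x"
  have dg: "(g has_vector_derivative w * - (X * T x ^ 3) +
      ((y1 x - ell x * y x) * (- ell x * Li x) +
       (- of_real (u^2 * (1 + x^2)) * y x - (ell x * y1 x + ell' * y x)) * Li x) * T x) (at x)"
    unfolding g_def w_def
    by (intro has_vector_derivative_mult has_vector_derivative_diff y y1 Li dell dT)
  have u: "complex_of_real (u^2 * (1 + x^2)) = of_real (u^2) * S x ^ 2"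
    unfolding S2 X_def by simp
  have psi: "complex_of_real ((2 - 3 * x^2) / (4 * (1 + x^2)^3)) = (2 - 3 * X^2) * T x ^ 6 / 4"
  proof -
    have "T x ^ 6 = 1 / (1 + X^2)^3"
    proof -
      have "(T x ^ 2) * (S x ^ 2) = 1" using ST by (metis mult.commute power_mult_distrib power_one)
      then have "T x ^ 2 = 1 / (S x ^ 2)" by (metis nonzero_eq_divide_eq mult_zero_right zero_neq_one)
      moreover have "T x ^ 6 = (T x ^ 2) ^ 3" by (simp flip: power_mult)
      ultimately show ?thesis unfolding S2 by (simp add: power_divide)
    qed
    then show ?thesis unfolding X_def by simp
  qed
  have T2: "T x ^ 2 = T x ^ 4 * (1 + X^2)"
  proof -
    have "T x ^ 4 * S x ^ 2 = T x ^ 2 * (S x * T x)^2" by (simp add: power_mult_distrib power2_eq_square power4_eq_xxxx)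
    then show ?thesis unfolding ST S2 by simp
  qed
  \<comment> \<open>The defect of the Riccati equation for \<open>ell\<close> in the variable x is
    S^2 times its defect in the variable \<xi>.\<close>
  have key: "of_real (u^2) * S x ^ 2 + ell' + ell x ^ 2 = S x ^ 2 * R"
  proof -
    define D where "D = of_real (u^2) * S x ^ 2 + ell' + ell x ^ 2 - S x ^ 2 * R"
    have "D = X * T x * P x * (1 - S x * T x) - T x ^ 2 / 2 + X^2 * T x ^ 4 * (5/4) + S x ^ 2 * ((2 - 3 * X^2) * T x ^ 6 / 4)"
      unfolding D_def R_def psi ell'_def ell_def X_def[symmetric]
      by (simp add: field_simps power2_eq_square power3_eq_cube power4_eq_xxxx)
    also have "S x ^ 2 * ((2 - 3 * X^2) * T x ^ 6 / 4) = (S x * T x)^2 * ((2 - 3 * X^2) * T x ^ 4 / 4)"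
      by (simp add: power_mult_distrib eval_nat_numeral)
    finally have "D = - (T x ^ 4 * (1 + X^2)) / 2 + X^2 * T x ^ 4 * (5/4) + (2 - 3 * X^2) * T x ^ 4 / 4"
      unfolding ST T2[symmetric] by simp
    also have "\<dots> = 0" by (simp add: field_simps)
    finally show ?thesis unfolding D_def by simp
  qed
  have e: "- of_real (u^2 * (1 + x^2)) * y x - ell' * y x = (ell x ^ 2 - S x ^ 2 * R) * y x"
    unfolding u key[symmetric] by (simp add: algebra_simps)
  have "w * - (X * T x ^ 3) + ((y1 x - ell x * y x) * (- ell x * Li x) +
       (- of_real (u^2 * (1 + x^2)) * y x - (ell x * y1 x + ell' * y x)) * Li x) * T x
     = w * - (X * T x ^ 3) - 2 * ell x * w * T x - (S x * T x) * S x * R * (y x * Li x)"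
  proof -
    have e': "(- of_real (u^2 * (1 + x^2)) * y x - (ell x * y1 x + ell' * y x)) =
        (ell x ^ 2 - S x ^ 2 * R) * y x - ell x * y1 x" unfolding e[symmetric] by simp
    show ?thesis unfolding w_def e' by (simp add: algebra_simps power2_eq_square)
  qed
  also have "\<dots> = - 2 * S x * P x * (w * T x) - S x * R * h x"
  proof -
    have "2 * ell x = 2 * S x * P x - X * T x * T x" unfolding ell_def X_def by simp
    then have "w * - (X * T x ^ 3) - 2 * ell x * w * T x = - 2 * S x * P x * (w * T x)"
      by (simp only:) (simp add: algebra_simps power3_eq_cube)
    then show ?thesis unfolding ST h_def by (simp add: mult_ac)
  qed
  also have "w * T x = g x" unfolding w_def g_def ..
  finally show "(g has_vector_derivative - 2 * S x * P x * g x - S x * R * h x) (at x)" using dg by simp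
qed

text \<open>\<open>F + a\<close> times \<open>exp (C * \<beta>)\<close> is nondecreasing, and its limit at infinity is \<open>a * exp C\<close>.\<close>

lemma gronwall_from_infinity:
  fixes F F' \<beta> \<beta>' :: "real \<Rightarrow> real"
  assumes F: "\<And>t. t \<ge> 0 \<Longrightarrow> (F has_real_derivative F' t) (at t)"
    and \<beta>: "\<And>t. t \<ge> 0 \<Longrightarrow> (\<beta> has_real_derivative \<beta>' t) (at t)"
    and le: "\<And>t. t \<ge> 0 \<Longrightarrow> - F' t \<le> C * \<beta>' t * (F t + a)"
    and lim: "(F \<longlongrightarrow> 0) at_top" "(\<beta> \<longlongrightarrow> 1) at_top"
    and pos: "C \<ge> 0" "\<beta> x \<ge> 0" "F x + a \<ge> 0" and x: "x \<ge> 0"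
  shows "F x + a \<le> a * exp C"
proof -
  define Z where "Z = (\<lambda>t. (F t + a) * exp (C * \<beta> t))"
  have mono: "Z x \<le> Z t" if "x \<le> t" for t
  proof (rule DERIV_nonneg_imp_nondecreasing[OF that])
    fix r assume "x \<le> r" "r \<le> t"
    then have r: "r \<ge> 0" using x by simp
    have "(Z has_real_derivative (F' r + C * \<beta>' r * (F r + a)) * exp (C * \<beta> r)) (at r)"
      unfolding Z_def
      by (rule DERIV_cong, (rule derivative_eq_intros F[OF r] \<beta>[OF r] refl)+) (simp add: algebra_simps)
    moreover have "(F' r + C * \<beta>' r * (F r + a)) * exp (C * \<beta> r) \<ge> 0"
      using le[OF r] by (intro mult_nonneg_nonneg) auto
    ultimately show "\<exists>y. (Z has_real_derivative y) (at r) \<and> y \<ge> 0" by blast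
  qed
  have "(Z \<longlongrightarrow> (0 + a) * exp (C * 1)) at_top" unfolding Z_def by (intro tendsto_intros lim)
  then have "Z x \<le> (0 + a) * exp (C * 1)"
    by (rule tendsto_lowerbound) (auto intro!: eventually_mono[OF eventually_ge_at_top[of x]] mono)
  moreover have "(F x + a) * 1 \<le> Z x" unfolding Z_def using pos by (intro mult_left_mono) auto
  ultimately show ?thesis by simp
qed

text \<open>With \<open>w2 = g / (2 * \<i> * u)\<close> and \<open>w1 = h + w2\<close> the terms of order \<open>u\<close> act on \<open>w2\<close> only, as a rotation, and drop out
  of the derivative of \<open>\<bar>w1 - 1\<bar>\<^sup>2 + \<bar>w2\<bar>\<^sup>2\<close>. This gains the factor \<open>1 / u\<close> without estimating oscillatory
  integrals.\<close>

lemma liouville_green_error: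
  fixes h g P R :: "real \<Rightarrow> complex" and u A M x :: real
  defines "s \<equiv> \<lambda>x::real. sqrt (1 + x^2)"
  assumes u: "u > 0" and A: "0 \<le> A" "A \<le> 1" and M: "M \<ge> 0"
    and h: "\<And>x. (h has_vector_derivative of_real (s x) * g x) (at x)"
    and g: "\<And>x. (g has_vector_derivative - 2 * of_real (s x) * P x * g x - of_real (s x) * R x * h x) (at x)"
    and P: "\<And>x. x \<ge> 0 \<Longrightarrow> norm (P x - \<i> * of_real u) \<le> M / s x ^ 4"
    and R: "\<And>x. x \<ge> 0 \<Longrightarrow> norm (R x) \<le> M / s x ^ 4 * u * A"
    and lim: "(h \<longlongrightarrow> 1) at_top" "(g \<longlongrightarrow> 0) at_top"
    and x: "x \<ge> 0"
  shows "norm (h x - 1) \<le> A * sqrt (2 * exp (12 * M))"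
proof -
  define w2 where "w2 = (\<lambda>x. g x / (2 * \<i> * of_real u))"
  define w1 where "w1 = (\<lambda>x. h x + w2 x)"
  define r where "r = (\<lambda>x. of_real (s x) * R x / (2 * \<i> * of_real u))"
  define q where "q = (\<lambda>x. of_real (s x) * (P x - \<i> * of_real u))"
  have gw: "g x = 2 * \<i> * of_real u * w2 x" for x unfolding w2_def using u by simp
  have w2': "(w2 has_vector_derivative - 2 * of_real (s x) * P x * w2 x - r x * h x) (at x)" for x
    unfolding w2_def r_def
    by (rule has_vector_derivative_eq_rhs[OF has_vector_derivative_divide[OF g]]) (simp add: diff_divide_distrib)
  have w1': "(w1 has_vector_derivative - 2 * q x * w2 x - r x * h x) (at x)" for x
  proof -
    have "(w1 has_vector_derivative of_real (s x) * g x + (- 2 * of_real (s x) * P x * w2 x - r x * h x)) (at x)"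
      unfolding w1_def by (rule has_vector_derivative_add[OF h w2'])
    then show ?thesis unfolding gw q_def by (simp add: algebra_simps)
  qed
  define F where "F = (\<lambda>x. (w1 x - 1) \<bullet> (w1 x - 1) + w2 x \<bullet> w2 x)"
  define F' where "F' = (\<lambda>x. 2 * ((w1 x - 1) \<bullet> (- 2 * q x * w2 x - r x * h x))
     + 2 * (w2 x \<bullet> (- 2 * of_real (s x) * P x * w2 x - r x * h x)))"
  have sq: "((\<lambda>x. w x \<bullet> w x) has_real_derivative 2 * (w x \<bullet> w')) (at x)"
    if "(w has_vector_derivative w') (at x)" for w :: "real \<Rightarrow> complex" and w' x
    using bounded_bilinear.has_vector_derivative[OF bounded_bilinear_inner that that]
    unfolding has_real_derivative_iff_has_vector_derivative by (simp add: inner_commute)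
  have dF: "(F has_real_derivative F' t) (at t)" for t
    unfolding F_def F'_def
    by (intro DERIV_add sq w2' has_vector_derivative_eq_rhs[OF has_vector_derivative_diff[OF w1' has_vector_derivative_const]]) simp
  have Fnn: "F t \<ge> 0" for t unfolding F_def by simp
  \<comment> \<open>Because h is near 1 rather than 0, the residual acts as an inhomogeneity of size
    A; adding A^2 to F makes the inequality homogeneous. The constant 12 is a round bound for the
    quadratic form estimated below.\<close>
  have le: "- F' t \<le> (12 * M) * (1 / s t ^ 3) * (F t + A^2)" if t: "t \<ge> 0" for t
  proof -
    define b where "b = M * (1 / s t ^ 3)"
    have s: "s t > 0" unfolding s_def by (simp add: add_pos_nonneg)
    have b: "b \<ge> 0" unfolding b_def using M s by simp
    define a1 a2 where "a1 = norm (w1 t - 1)" and "a2 = norm (w2 t)"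
    have nn: "a1 \<ge> 0" "a2 \<ge> 0" unfolding a1_def a2_def by auto
    have F: "F t = a1^2 + a2^2" unfolding F_def a1_def a2_def by (simp add: power2_norm_eq_inner)
    have hq: "norm (q t) \<le> b"
    proof -
      have "norm (q t) = s t * norm (P t - \<i> * of_real u)" unfolding q_def using s by (simp add: norm_mult)
      also have "\<dots> \<le> s t * (M / s t ^ 4)" using P[OF t] s by (intro mult_left_mono) auto
      also have "\<dots> = b" unfolding b_def using s by (simp add: eval_nat_numeral)
      finally show ?thesis .
    qed
    have hr: "norm (r t) \<le> b * A"
    proof -
      have "norm (r t) = s t * norm (R t) / (2 * u)" unfolding r_def using s u by (simp add: norm_mult norm_divide)
      also have "\<dots> \<le> s t * (M / s t ^ 4 * u * A) / (2 * u)" using R[OF t] s u by (intro divide_right_mono mult_left_mono) auto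
      also have "\<dots> = b * A / 2" unfolding b_def using s u by (simp add: eval_nat_numeral)
      also have "\<dots> \<le> b * A" using b A by simp
      finally show ?thesis .
    qed
    have hh: "norm (h t) \<le> 1 + a1 + a2"
    proof -
      have "h t = 1 + (w1 t - 1) - w2 t" unfolding w1_def by simp
      then have "norm (h t) \<le> norm (1 + (w1 t - 1)) + norm (w2 t)" by (metis norm_triangle_ineq4)
      also have "norm (1 + (w1 t - 1)) \<le> norm (1::complex) + norm (w1 t - 1)" by (rule norm_triangle_ineq)
      finally show ?thesis unfolding a1_def a2_def by simp
    qed
    have rh: "norm (r t * h t) \<le> b * A * (1 + a1 + a2)"
      unfolding norm_mult using hr hh by (intro mult_mono) (use b A in auto)
    have 1: "\<bar>(w1 t - 1) \<bullet> (- 2 * q t * w2 t - r t * h t)\<bar> \<le> a1 * (2 * b * a2 + b * A * (1 + a1 + a2))"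
    proof -
      have "norm (- 2 * q t * w2 t - r t * h t) \<le> norm (- 2 * q t * w2 t) + norm (r t * h t)"
        by (rule norm_triangle_ineq4)
      also have "norm (- 2 * q t * w2 t) = 2 * norm (q t) * a2" unfolding a2_def by (simp add: norm_mult)
      also have "\<dots> \<le> 2 * b * a2" using hq nn by (intro mult_right_mono) auto
      finally have "norm (- 2 * q t * w2 t - r t * h t) \<le> 2 * b * a2 + b * A * (1 + a1 + a2)" using rh by simp
      then have "norm (w1 t - 1) * norm (- 2 * q t * w2 t - r t * h t) \<le> a1 * (2 * b * a2 + b * A * (1 + a1 + a2))"
        unfolding a1_def[symmetric] using nn by (intro mult_left_mono)
      then show ?thesis using Cauchy_Schwarz_ineq2[of "w1 t - 1" "- 2 * q t * w2 t - r t * h t"] by linarith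
    qed
    have 2: "\<bar>w2 t \<bullet> (- 2 * of_real (s t) * P t * w2 t - r t * h t)\<bar> \<le> 2 * b * a2^2 + a2 * (b * A * (1 + a1 + a2))"
    proof -
      have rot: "w2 t \<bullet> (- 2 * of_real (s t) * P t * w2 t) = w2 t \<bullet> (- 2 * q t * w2 t)"
      proof -
        have "- 2 * of_real (s t) * P t * w2 t = - 2 * q t * w2 t + of_real (- 2 * s t * u) * (\<i> * w2 t)"
          unfolding q_def by (simp add: algebra_simps)
        moreover have "w2 t \<bullet> (of_real c * (\<i> * w2 t)) = 0" for c by (simp add: inner_complex_def algebra_simps)
        ultimately show ?thesis by (simp only: inner_add_right add_0_right)
      qed
      have "\<bar>w2 t \<bullet> (- 2 * q t * w2 t)\<bar> \<le> norm (w2 t) * norm (- 2 * q t * w2 t)" by (rule Cauchy_Schwarz_ineq2)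
      also have "\<dots> = 2 * norm (q t) * a2^2" unfolding a2_def by (simp add: norm_mult power2_eq_square)
      also have "\<dots> \<le> 2 * b * a2^2" using hq by (intro mult_right_mono) auto
      finally have i: "\<bar>w2 t \<bullet> (- 2 * q t * w2 t)\<bar> \<le> 2 * b * a2^2" .
      have "\<bar>w2 t \<bullet> (r t * h t)\<bar> \<le> norm (w2 t) * norm (r t * h t)" by (rule Cauchy_Schwarz_ineq2)
      also have "\<dots> \<le> a2 * (b * A * (1 + a1 + a2))" unfolding a2_def[symmetric] using rh nn by (intro mult_left_mono)
      finally show ?thesis using i unfolding inner_diff_right rot by linarith
    qed
    have "- F' t \<le> 2 * (a1 * (2 * b * a2 + b * A * (1 + a1 + a2))) + 2 * (2 * b * a2^2 + a2 * (b * A * (1 + a1 + a2)))"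
    proof -
      have "- (2 * X + 2 * Y) \<le> 2 * c + 2 * d" if "\<bar>X\<bar> \<le> c" "\<bar>Y\<bar> \<le> d" for X Y c d :: real
        using that by linarith
      from this[OF 1 2] show ?thesis unfolding F'_def .
    qed
    also have "\<dots> = b * (4 * (a1 * a2) + 4 * a2^2 + 2 * (A * (a1 + a2)^2) + 2 * (A * (a1 + a2)))"
      by (simp add: algebra_simps power2_eq_square)
    also have "\<dots> \<le> b * (12 * (a1^2 + a2^2 + A^2))"
    proof (rule mult_left_mono[OF _ b])
      have i1: "2 * (a1 * a2) \<le> a1^2 + a2^2" using zero_le_power2[of "a1 - a2"] by (simp add: power2_diff)
      have i2: "A * (a1 + a2)^2 \<le> 1 * (a1 + a2)^2" using A by (intro mult_right_mono) auto
      have i3: "2 * (A * (a1 + a2)) \<le> 2 * A^2 + a1^2 + a2^2"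
        using zero_le_power2[of "A - a1"] zero_le_power2[of "A - a2"] by (simp add: power2_diff algebra_simps)
      have i4: "(a1 + a2)^2 = a1^2 + a2^2 + 2 * (a1 * a2)" by (simp add: power2_sum)
      have i5: "0 \<le> a1^2" "0 \<le> a2^2" "0 \<le> A^2" by auto
      show "4 * (a1 * a2) + 4 * a2^2 + 2 * (A * (a1 + a2)^2) + 2 * (A * (a1 + a2)) \<le> 12 * (a1^2 + a2^2 + A^2)"
      proof -
        have "4 * p + 4 * y + 2 * r + 2 * t \<le> 12 * (x + y + z)"
          if "2 * p \<le> x + y" "r \<le> 1 * v" "2 * t \<le> 2 * z + x + y" "v = x + y + 2 * p" "0 \<le> x" "0 \<le> y" "0 \<le> z"
          for p r t v x y z :: real using that by argo
        from this[OF i1 i2 i3 i4 i5] show ?thesis .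
      qed
    qed
    finally show ?thesis unfolding F b_def by (simp add: mult_ac)
  qed
  have l2: "(w2 \<longlongrightarrow> 0) at_top" unfolding w2_def using tendsto_divide_zero[OF lim(2)] by simp
  have l1: "((\<lambda>x. w1 x - 1) \<longlongrightarrow> 1 + 0 - 1) at_top" unfolding w1_def by (intro tendsto_intros lim l2)
  have limF: "(F \<longlongrightarrow> 0) at_top"
    unfolding F_def using tendsto_add[OF tendsto_inner[OF l1 l1] tendsto_inner[OF l2 l2]] by simp
  have "F x + A^2 \<le> A^2 * exp (12 * M)"
    by (rule gronwall_from_infinity[where \<beta>' = "\<lambda>t. 1 / s t ^ 3" and F' = F' and \<beta> = beta_bar])
       (use dF sqrt_1_plus_sq_derivs(3) le limF beta_bar_tendsto_1 M beta_bar_bounds x Fnn in \<open>auto simp: s_def\<close>)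
  then have Fx: "F x \<le> A^2 * exp (12 * M)" by (smt (verit) zero_le_power2)
  have "h x - 1 = (w1 x - 1) - w2 x" unfolding w1_def by simp
  then have "norm (h x - 1) \<le> norm (w1 x - 1) + norm (w2 x)" by (metis norm_triangle_ineq4)
  then have "(norm (h x - 1))^2 \<le> (norm (w1 x - 1) + norm (w2 x))^2" by (intro power_mono) auto
  also have "\<dots> \<le> 2 * F x"
    unfolding F_def power2_norm_eq_inner[symmetric] using zero_le_power2[of "norm (w1 x - 1) - norm (w2 x)"]
    by (simp add: power2_sum power2_diff)
  also have "\<dots> \<le> 2 * (A^2 * exp (12 * M))" using Fx by simp
  also have "\<dots> = (A * sqrt (2 * exp (12 * M)))^2" by (simp add: power_mult_distrib)
  finally show ?thesis by (rule power2_le_imp_le) (use A in auto)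
qed

section \<open>The expansion along the ray\<close>

text \<open>A single sum in powers of 1 / (i u) is the form in which the recurrence cancels;
  \<open>lg_sum_eq\<close> recovers the real even and imaginary odd sums of
  \<open>LG_approx\<close>.\<close>

definition lg_sum :: "nat \<Rightarrow> real \<Rightarrow> real \<Rightarrow> complex" where
  "lg_sum n u b = (\<Sum>j=1..n. of_real (E_bar j b) / (\<i> * of_real u) ^ j)"

lemma sum_even_odd_split:
  fixes f :: "nat \<Rightarrow> 'a::comm_monoid_add"
  shows "(\<Sum>j=1..2*m+1. f j) = (\<Sum>s=1..m. f (2 * s)) + (\<Sum>s=0..m. f (2 * s + 1))"
  by (induction m) (simp_all add: ac_simps)

lemma lg_sum_eq:
  "lg_sum (2 * m + 1) u b = of_real (\<Sum>s=1..m. (-1)^s * E_bar (2 * s) b / u^(2 * s))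
     - \<i> * of_real (\<Sum>s=0..m. (-1)^s * E_bar (2 * s + 1) b / u^(2 * s + 1))"
proof -
  have i2: "\<i> ^ (2 * s) = (-1)^s" for s by (simp add: power_mult)
  have e: "of_real (E_bar (2 * s) b) / (\<i> * of_real u) ^ (2 * s)
      = complex_of_real ((-1)^s * E_bar (2 * s) b / u^(2 * s))" for s
  proof -
    have "(\<i> * complex_of_real u) ^ (2 * s) = (- 1) ^ s * of_real (u ^ (2 * s))"
      by (simp only: power_mult_distrib i2 of_real_power)
    then show ?thesis by (cases "even s") auto
  qed
  have o: "of_real (E_bar (2 * s + 1) b) / (\<i> * of_real u) ^ (2 * s + 1)
      = - \<i> * complex_of_real ((-1)^s * E_bar (2 * s + 1) b / u^(2 * s + 1))" for s
  proof -
    have "(\<i> * complex_of_real u) ^ (2 * s + 1) = ((- 1) ^ s * of_real (u ^ (2 * s + 1))) * \<i>"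
      unfolding power_mult_distrib power_add i2 power_one_right of_real_mult of_real_power by (simp only: mult_ac)
    then have "of_real (E_bar (2 * s + 1) b) / (\<i> * of_real u) ^ (2 * s + 1)
        = of_real (E_bar (2 * s + 1) b) / ((- 1) ^ s * complex_of_real (u ^ (2 * s + 1))) / \<i>"
      by (simp only: divide_divide_eq_left)
    then show ?thesis by (cases "even s") (simp_all del: power_Suc)
  qed
  show ?thesis unfolding lg_sum_def sum_even_odd_split e o of_real_sum sum_distrib_left
    by (simp add: sum_negf)
qed

section \<open>Restriction to the ray and the reciprocal approximation\<close>

definition pcf_ray :: "real \<Rightarrow> real \<Rightarrow> complex" where
  "pcf_ray u x = pcf_U (- (1/2) * \<i> * of_real u) (of_real (sqrt (2 * u) * x) * exp (- (of_real pi * \<i> / 4)))"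

definition pcf_ray' :: "real \<Rightarrow> real \<Rightarrow> complex" where
  "pcf_ray' u x = of_real (sqrt (2 * u)) * exp (- (of_real pi * \<i> / 4)) *
     pcf_int' (- (1/2) * \<i> * of_real u) (of_real (sqrt (2 * u) * x) * exp (- (of_real pi * \<i> / 4)))"

text \<open>The reciprocal of \<open>LG_approx\<close> by \<open>LG_inv_eq\<close>, written as a
  product so that its logarithmic derivative can be read off factor by factor.\<close>

definition LG_inv :: "nat \<Rightarrow> real \<Rightarrow> real \<Rightarrow> complex" where
  "LG_inv m u x = exp (\<i> * of_real (chi_hat m u - 1/8 * pi)) * of_real ((2 * u) powr (1/4)) / of_real (exp (pi * u / 8)) *
     (of_real ((1 + x^2) powr (1/4)) * exp (- (\<i> * of_real (u * xi_bar x) + lg_sum (2 * m + 1) u (beta_bar x))))"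

lemma LG_approx_alt:
  "LG_approx m u x = exp (- (\<i> * of_real (chi_hat m u - 1/8 * pi))) * of_real (exp (pi * u / 8)) /
       of_real ((2 * u) powr (1/4) * (1 + x^2) powr (1/4)) *
     exp (\<i> * of_real (u * xi_bar x) + lg_sum (2 * m + 1) u (beta_bar x))"
  unfolding LG_approx_def lg_sum_eq by (simp add: algebra_simps)

lemma LG_inv_eq: assumes u: "u > 0" shows "LG_inv m u x = 1 / LG_approx m u x"
proof -
  have "1 + x^2 > 0" by (simp add: add_pos_nonneg)
  then show ?thesis unfolding LG_inv_def LG_approx_alt using u
    by (simp only: exp_minus of_real_mult) (simp add: field_simps)
qed

lemma eta_bar_alt: "u > 0 \<Longrightarrow> 1 + eta_bar m u x = pcf_ray u x * LG_inv m u x"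
  unfolding eta_bar_def pcf_ray_def by (simp add: LG_inv_eq)

text \<open>The quarter power contributes x / (2 s^2) and the exponential -s times
  \<open>lg_P\<close>, since the x-derivative of \<open>E_bar j\<close> is s times
  \<open>D_poly j\<close>.\<close>

lemma LG_inv_deriv:
  defines "S \<equiv> \<lambda>x. complex_of_real (sqrt (1 + x^2))"
    and "T \<equiv> \<lambda>x. complex_of_real (1 / sqrt (1 + x^2))"
  shows "(LG_inv m u has_vector_derivative
     - (S x * lg_P (2 * m + 1) u (beta_bar x) - of_real x * T x * T x / 2) * LG_inv m u x) (at x)"
proof -
  define s where "s = sqrt (1 + x^2)"
  have p: "1 + x^2 > 0" by (simp add: add_pos_nonneg)
  then have s: "s > 0" "s^2 = 1 + x^2" unfolding s_def by auto
  have r: "((\<lambda>x. (1 + x^2) powr (1/4)) has_real_derivative x / (2 * s^2) * (1 + x^2) powr (1/4)) (at x)"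
  proof -
    have A: "((\<lambda>x. exp (1/4 * ln (1 + x^2))) has_real_derivative exp (1/4 * ln (1 + x^2)) * (1/4 * (1 / (1 + x^2) * (2 * x)))) (at x)"
      using p by (intro DERIV_chain2[OF DERIV_exp] DERIV_cmult DERIV_chain2[OF DERIV_ln_divide])
        (auto intro!: derivative_eq_intros)
    have pw: "exp (1/4 * ln (1 + x^2)) = (1 + x^2) powr (1/4)" for x :: real
    proof -
      have "1 + x^2 > 0" by (simp add: add_pos_nonneg)
      then show ?thesis by (simp add: powr_def)
    qed
    have C: "1/4 * (1 / (1 + x^2) * (2 * x)) = x / (2 * s^2)" unfolding s(2) using p by (simp add: field_simps)
    show ?thesis using A unfolding pw C by (simp only: mult.commute)
  qed
  have B: "(1 - (beta_bar x)^2)^2 = 1 / s^4"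
    unfolding beta_bar_sq s(2)[symmetric] by (simp add: power_divide flip: power_mult)
  have Ej: "((\<lambda>x. E_bar j (beta_bar x)) has_real_derivative s * poly (D_poly j) (beta_bar x)) (at x)" for j
  proof -
    have "poly (D_poly j) (beta_bar x) = poly ([:1, 0, -1:]^2) (beta_bar x) * poly (pderiv (E_poly j)) (beta_bar x)"
      unfolding D_poly_def poly_mult ..
    also have "poly ([:1, 0, -1:]^2) (beta_bar x) = (1 - (beta_bar x)^2)^2"
      by (simp add: power2_eq_square algebra_simps)
    finally have "s * poly (D_poly j) (beta_bar x) = poly (pderiv (E_poly j)) (beta_bar x) * (1 / s^3)"
      unfolding B using s(1) by (simp add: eval_nat_numeral)
    then show ?thesis unfolding E_bar_eq_poly
      using DERIV_chain2[OF poly_DERIV sqrt_1_plus_sq_derivs(3)[of x], of "E_poly j"] unfolding s_def by simp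
  qed
  define ph where "ph = (\<lambda>x. \<i> * of_real (u * xi_bar x) + lg_sum (2 * m + 1) u (beta_bar x))"
  have "((\<lambda>x. \<i> * complex_of_real (u * xi_bar x)) has_vector_derivative \<i> * of_real (u * s)) (at x)"
    unfolding s_def
    by (rule has_vector_derivative_mult_right[OF has_vector_derivative_of_real[OF DERIV_cmult[OF sqrt_1_plus_sq_derivs(4)]]])
  moreover have "((\<lambda>x. lg_sum (2 * m + 1) u (beta_bar x)) has_vector_derivative
      (\<Sum>j=1..2*m+1. of_real (s * poly (D_poly j) (beta_bar x)) / (\<i> * of_real u) ^ j)) (at x)"
    unfolding lg_sum_def
    by (rule has_vector_derivative_sum) (rule has_vector_derivative_divide[OF has_vector_derivative_of_real[OF Ej]])
  ultimately have "(ph has_vector_derivative \<i> * of_real (u * s) +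
      (\<Sum>j=1..2*m+1. of_real (s * poly (D_poly j) (beta_bar x)) / (\<i> * of_real u) ^ j)) (at x)"
    unfolding ph_def by (rule has_vector_derivative_add)
  also have "\<i> * of_real (u * s) + (\<Sum>j=1..2*m+1. of_real (s * poly (D_poly j) (beta_bar x)) / (\<i> * of_real u) ^ j)
     = S x * lg_P (2 * m + 1) u (beta_bar x)"
    unfolding lg_P_def ring_distribs sum_distrib_left S_def s_def[symmetric] by (simp add: mult_ac)
  finally have "(ph has_vector_derivative S x * lg_P (2 * m + 1) u (beta_bar x)) (at x)" .
  from field_vector_diff_chain_at[OF has_vector_derivative_minus[OF this] DERIV_exp]
  have e: "((\<lambda>x. exp (- ph x)) has_vector_derivative - (S x * lg_P (2 * m + 1) u (beta_bar x)) * exp (- ph x)) (at x)"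
    unfolding o_def .
  define K where "K = exp (\<i> * of_real (chi_hat m u - 1/8 * pi)) * of_real ((2 * u) powr (1/4)) / complex_of_real (exp (pi * u / 8))"
  have "((\<lambda>x. K * (of_real ((1 + x^2) powr (1/4)) * exp (- ph x))) has_vector_derivative
      K * (of_real ((1 + x^2) powr (1/4)) * (- (S x * lg_P (2 * m + 1) u (beta_bar x)) * exp (- ph x)) +
       of_real (x / (2 * s^2) * (1 + x^2) powr (1/4)) * exp (- ph x))) (at x)"
    by (rule has_vector_derivative_mult_right[OF has_vector_derivative_mult[OF has_vector_derivative_of_real[OF r] e]])
  moreover have "(\<lambda>x. K * (of_real ((1 + x^2) powr (1/4)) * exp (- ph x))) = LG_inv m u"
    unfolding LG_inv_def[abs_def] K_def ph_def ..
  moreover have "K * (of_real ((1 + x^2) powr (1/4)) * (- (S x * lg_P (2 * m + 1) u (beta_bar x)) * exp (- ph x)) +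
       of_real (x / (2 * s^2) * (1 + x^2) powr (1/4)) * exp (- ph x)) =
      - (S x * lg_P (2 * m + 1) u (beta_bar x) - of_real x * T x * T x / 2) * LG_inv m u x"
  proof -
    have T: "of_real x * T x * T x / 2 = of_real (x / (2 * s^2))"
      unfolding T_def s_def[symmetric] by (simp add: power2_eq_square)
    have L: "LG_inv m u x = K * (of_real ((1 + x^2) powr (1/4)) * exp (- ph x))"
      unfolding LG_inv_def K_def ph_def ..
    have "K * (p * (- a * e) + q * p * e) = - (a - q) * (K * (p * e))" for p a q e
      by (simp add: algebra_simps)
    then show ?thesis unfolding T L of_real_mult .
  qed
  ultimately show ?thesis by simp
qed

lemma lg_P_deriv:
  "((\<lambda>x. lg_P n u (beta_bar x)) has_vector_derivative
     of_real (sqrt (1 + x^2)) * lg_Q n u (beta_bar x)) (at x)"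
proof -
  define s where "s = sqrt (1 + x^2)"
  have p: "1 + x^2 > 0" by (simp add: add_pos_nonneg)
  then have s: "s > 0" "s^2 = 1 + x^2" unfolding s_def by auto
  have B: "(1 - (beta_bar x)^2)^2 = 1 / s^4"
    unfolding beta_bar_sq s(2)[symmetric] by (simp add: power_divide flip: power_mult)
  have Dj: "((\<lambda>x. poly (D_poly j) (beta_bar x)) has_real_derivative
      s * ((1 - (beta_bar x)^2)^2 * poly (pderiv (D_poly j)) (beta_bar x))) (at x)" for j
  proof -
    have "s * ((1 - (beta_bar x)^2)^2 * poly (pderiv (D_poly j)) (beta_bar x)) =
        poly (pderiv (D_poly j)) (beta_bar x) * (1 / s^3)"
      unfolding B using s(1) by (simp add: eval_nat_numeral)
    then show ?thesis
      using DERIV_chain2[OF poly_DERIV sqrt_1_plus_sq_derivs(3)[of x], of "D_poly j"] unfolding s_def by simp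
  qed
  have "((\<lambda>x. \<i> * of_real u + (\<Sum>j=1..n. of_real (poly (D_poly j) (beta_bar x)) / (\<i> * of_real u) ^ j)) has_vector_derivative
      0 + (\<Sum>j=1..n. of_real (s * ((1 - (beta_bar x)^2)^2 * poly (pderiv (D_poly j)) (beta_bar x))) / (\<i> * of_real u) ^ j)) (at x)"
    by (intro has_vector_derivative_add has_vector_derivative_const has_vector_derivative_sum
        has_vector_derivative_divide has_vector_derivative_of_real Dj)
  then show ?thesis unfolding lg_P_def lg_Q_def s_def[symmetric] sum_distrib_left by (simp add: mult_ac)
qed

text \<open>This is what singles out the first coefficient: the term of order u^0 in the Riccati
  residual has to vanish.\<close>

lemma schwarzian_eq: "(2 - 3 * x^2) / (4 * (1 + x^2)^3) = 2 * poly (D_poly 1) (beta_bar x)"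
proof -
  have p: "1 + x^2 > 0" by (simp add: add_pos_nonneg)
  define q where "q = 1 + x^2"
  have q: "q > 0" "x^2 = q - 1" using p unfolding q_def by auto
  have b2: "(beta_bar x)^2 = 1 - 1 / q" using beta_bar_sq[of x] unfolding q_def by simp
  have D1: "poly (D_poly 1) b = (1 - b^2)^2 * (1/4 - 5/8 * b^2)" for b
    unfolding D_poly_1 by (simp add: power2_eq_square algebra_simps)
  have "2 * poly (D_poly 1) (beta_bar x) = 2 * ((1 / q)^2 * (1/4 - 5/8 * (1 - 1/q)))"
    unfolding D1 b2 by simp
  also have "\<dots> = (2 - 3 * (q - 1)) / (4 * q^3)"
    using q by (simp add: field_simps power2_eq_square power3_eq_cube)
  finally show ?thesis unfolding q(2)[symmetric] unfolding q_def by simp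
qed

lemma pcf_ray_deriv:
  assumes u: "u > 0"
  shows "(pcf_ray u has_vector_derivative pcf_ray' u x) (at x)"
    "(pcf_ray' u has_vector_derivative - of_real (u^2 * (1 + x^2)) * pcf_ray u x) (at x)"
proof -
  define a where "a = - (1/2) * \<i> * complex_of_real u"
  have a: "Re a > - 1/2" unfolding a_def by simp
  define \<omega> where "\<omega> = exp (- (of_real pi * \<i> / 4))"
  define r where "r = complex_of_real (sqrt (2 * u))"
  have w2: "\<omega>^2 = - \<i>" unfolding \<omega>_def by (rule exp_minus_i_pi_quarter_sq)
  have r2: "r^2 = 2 * of_real u" unfolding r_def of_real_power[symmetric] using u by simp
  have "((\<lambda>z. pcf_int a (r * z * \<omega>)) has_field_derivative pcf_int' a (r * of_real x * \<omega>) * (r * \<omega>)) (at (of_real x))"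
    by (rule DERIV_chain2[OF pcf_int_deriv[OF a]]) (auto intro!: derivative_eq_intros)
  from has_vector_derivative_real_field[OF this]
  show "(pcf_ray u has_vector_derivative pcf_ray' u x) (at x)"
    unfolding pcf_ray_def[abs_def] pcf_ray'_def a_def[symmetric] pcf_U_eq[OF a] \<omega>_def[symmetric] r_def
    by (simp add: mult_ac)
  have "((\<lambda>z. r * \<omega> * pcf_int' a (r * z * \<omega>)) has_field_derivative
      r * \<omega> * ((1/4 * (r * of_real x * \<omega>)^2 + a) * pcf_int a (r * of_real x * \<omega>) * (r * \<omega>))) (at (of_real x))"
    by (rule DERIV_cmult[OF DERIV_chain2[OF pcf_int'_deriv[OF a]]]) (auto intro!: derivative_eq_intros)
  from has_vector_derivative_real_field[OF this]
  have "(pcf_ray' u has_vector_derivative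
      r * \<omega> * ((1/4 * (r * of_real x * \<omega>)^2 + a) * pcf_int a (r * of_real x * \<omega>) * (r * \<omega>))) (at x)"
    unfolding pcf_ray'_def[abs_def] a_def[symmetric] \<omega>_def[symmetric] r_def by (simp add: mult_ac)
  also have "r * \<omega> * ((1/4 * (r * of_real x * \<omega>)^2 + a) * pcf_int a (r * of_real x * \<omega>) * (r * \<omega>))
      = r^2 * \<omega>^2 * (1/4 * (r^2 * of_real x^2 * \<omega>^2) + a) * pcf_int a (r * of_real x * \<omega>)"
    by (simp only: power_mult_distrib power2_eq_square mult_ac)
  \<comment> \<open>Here r^2 \<omega>^2 = -2 i u and a = - i u / 2, so the bracket is - i u (1 +
    x^2) / 2.\<close>
  also have "r^2 * \<omega>^2 * (1/4 * (r^2 * of_real x^2 * \<omega>^2) + a) = - of_real (u^2 * (1 + x^2))"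
    unfolding w2 r2 a_def by (simp add: algebra_simps power2_eq_square)
  also have "pcf_int a (r * of_real x * \<omega>) = pcf_ray u x"
    unfolding pcf_ray_def a_def[symmetric] pcf_U_eq[OF a] \<omega>_def r_def by simp
  finally show "(pcf_ray' u has_vector_derivative - of_real (u^2 * (1 + x^2)) * pcf_ray u x) (at x)" .
qed


section \<open>Behaviour at the far end of the ray\<close>

lemma filterlim_ray:
  assumes c: "c > 0"
  shows "filterlim (\<lambda>x. of_real (c * x) * exp (- (of_real pi * \<i> / 4)))
    (inf at_infinity (principal {z. \<bar>Arg z\<bar> \<le> 3/4 * pi - pi/2})) at_top"
proof -
  define \<omega> where "\<omega> = exp (- (complex_of_real pi * \<i> / 4))"
  have n: "norm \<omega> = 1" unfolding \<omega>_def by simp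
  have A: "Arg \<omega> = - pi / 4" unfolding \<omega>_def by (subst Arg_exp) (auto intro: order_trans[of _ 0])
  have "filterlim (\<lambda>x. complex_of_real (c * x) * \<omega>) at_infinity at_top"
  proof (rule filterlim_norm_at_top_imp_at_infinity)
    have "filterlim (\<lambda>x. \<bar>c\<bar> * \<bar>x\<bar>) at_top at_top" using c by real_asymp
    then show "filterlim (\<lambda>x. norm (complex_of_real (c * x) * \<omega>)) at_top at_top"
      by (simp add: norm_mult n abs_mult)
  qed
  moreover have "eventually (\<lambda>x. complex_of_real (c * x) * \<omega> \<in> {z. \<bar>Arg z\<bar> \<le> 3/4 * pi - pi/2}) at_top"
    using eventually_gt_at_top[of 0]
  proof eventually_elim
    case (elim x)
    then have "Arg (complex_of_real (c * x) * \<omega>) = - pi / 4"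
      using c A by (subst Arg_times_of_real) auto
    then show ?case by simp
  qed
  ultimately show ?thesis unfolding \<omega>_def by (simp add: filterlim_inf filterlim_principal)
qed

lemma lg_sum_1: "lg_sum (2 * m + 1) u 1 = - \<i> * of_real (\<Sum>s=0..m. (-1)^s * E_bar (2 * s + 1) 1 / u^(2 * s + 1))"
  unfolding lg_sum_eq by (simp add: E_bar_even_at_1)

definition pcf_lead :: "complex \<Rightarrow> complex \<Rightarrow> complex" where
  "pcf_lead a z = z powr (- a - 1/2) * exp (- (z^2) / 4)"

text \<open>The constants in \<open>LG_approx\<close>, namely \<open>chi_hat\<close>, pi/8, exp (pi
  u / 8) and (2 u)^(1/4), are exactly those for which everything depending on u alone cancels; the
  three groups that remain in the exponent tend to 0 separately.\<close>

lemma LG_inv_mult_lead: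
  assumes u: "u > 0" and x: "x > 0"
  shows "LG_inv m u x * pcf_lead (- (1/2) * \<i> * of_real u) (of_real (sqrt (2 * u) * x) * exp (- (of_real pi * \<i> / 4))) =
    exp (of_real (ln (1 + x^2) / 4 - ln x / 2)
         - \<i> * of_real (u * (xi_bar x - x^2 / 2 - ln x / 2 - ln 2 / 2 - 1/4))
         - (lg_sum (2 * m + 1) u (beta_bar x) - lg_sum (2 * m + 1) u 1))"
proof -
  define O1 where "O1 = (\<Sum>s=0..m. (-1)^s * E_bar (2 * s + 1) 1 / u^(2 * s + 1))"
  define L where "L = lg_sum (2 * m + 1) u (beta_bar x)"
  define z where "z = of_real (sqrt (2 * u) * x) * exp (- (complex_of_real pi * \<i> / 4))"
  define lr where "lr = ln (2 * u) / 2 + ln x"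
  have p: "1 + x^2 > 0" by (simp add: add_pos_nonneg)
  have z0: "z \<noteq> 0" unfolding z_def using u x by simp
  have Lnz: "Ln z = of_real lr - \<i> * of_real (pi / 4)"
  proof -
    have "Ln z = of_real (ln (sqrt (2 * u) * x)) + Ln (exp (- (complex_of_real pi * \<i> / 4)))"
      unfolding z_def using u x by (simp add: Ln_times_of_real Ln_of_real del: of_real_mult)
    also have "Ln (exp (- (complex_of_real pi * \<i> / 4))) = - (complex_of_real pi * \<i> / 4)"
      by (rule Ln_exp) (auto intro: order_trans[of _ 0])
    also have "ln (sqrt (2 * u) * x) = lr" unfolding lr_def using u x by (simp add: ln_mult ln_sqrt)
    finally show ?thesis by (simp add: mult_ac)
  qed
  have z2: "z^2 = - \<i> * of_real (2 * u * x^2)"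
    unfolding z_def power_mult_distrib exp_minus_i_pi_quarter_sq
    using u by (simp add: power_mult_distrib flip: of_real_power)
  have chi: "chi_hat m u = u / 4 * (ln 2 + 1 - ln u) - O1"
    unfolding chi_hat_def O1_def using u by (simp add: ln_div ln_mult)
  have r1: "complex_of_real ((2 * u) powr (1/4)) = exp (of_real (1/4 * ln (2 * u)))"
    unfolding exp_of_real using u by (simp add: powr_def)
  have r2: "complex_of_real ((1 + x^2) powr (1/4)) = exp (of_real (1/4 * ln (1 + x^2)))"
    unfolding exp_of_real using p by (simp add: powr_def)
  have r3: "1 / complex_of_real (exp (pi * u / 8)) = exp (of_real (- (pi * u / 8)))"
    unfolding exp_of_real by (simp add: exp_minus inverse_eq_divide)
  have ln2u: "ln (2 * u) = ln 2 + ln u" using u by (simp add: ln_mult)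
  have "LG_inv m u x * pcf_lead (- (1/2) * \<i> * of_real u) z =
     exp (\<i> * of_real (chi_hat m u - 1/8 * pi)) * exp (of_real (1/4 * ln (2 * u))) * exp (of_real (- (pi * u / 8))) *
      (exp (of_real (1/4 * ln (1 + x^2))) * exp (- (\<i> * of_real (u * xi_bar x) + L))) *
      (exp ((- (- (1/2) * \<i> * of_real u) - 1/2) * (of_real lr - \<i> * of_real (pi / 4))) * exp (- (- \<i> * of_real (2 * u * x^2)) / 4))"
    unfolding LG_inv_def pcf_lead_def powr_def[of z] Lnz z2 L_def[symmetric] r1[symmetric] r2[symmetric] r3[symmetric]
    using z0 by simp
  also have "\<dots> = exp (\<i> * of_real (chi_hat m u - 1/8 * pi) + of_real (1/4 * ln (2 * u)) + of_real (- (pi * u / 8)) +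
      (of_real (1/4 * ln (1 + x^2)) + - (\<i> * of_real (u * xi_bar x) + L)) +
      ((- (- (1/2) * \<i> * of_real u) - 1/2) * (of_real lr - \<i> * of_real (pi / 4)) + - (- \<i> * of_real (2 * u * x^2)) / 4))"
    by (simp only: exp_add)
  also have "\<i> * of_real (chi_hat m u - 1/8 * pi) + of_real (1/4 * ln (2 * u)) + of_real (- (pi * u / 8)) +
      (of_real (1/4 * ln (1 + x^2)) + - (\<i> * of_real (u * xi_bar x) + L)) +
      ((- (- (1/2) * \<i> * of_real u) - 1/2) * (of_real lr - \<i> * of_real (pi / 4)) + - (- \<i> * of_real (2 * u * x^2)) / 4)
     = of_real (ln (1 + x^2) / 4 - ln x / 2)
         - \<i> * of_real (u * (xi_bar x - x^2 / 2 - ln x / 2 - ln 2 / 2 - 1/4))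
         - (L - - \<i> * of_real O1)"
    unfolding chi lr_def ln2u by (simp add: complex_eq_iff) (simp add: field_simps)
  finally show ?thesis unfolding lg_sum_1 O1_def z_def L_def .
qed

lemma LG_inv_mult_lead_tendsto:
  assumes u: "u > 0"
  shows "((\<lambda>x. LG_inv m u x * pcf_lead (- (1/2) * \<i> * of_real u)
     (of_real (sqrt (2 * u) * x) * exp (- (of_real pi * \<i> / 4)))) \<longlongrightarrow> 1) at_top"
proof -
  have "isCont (lg_sum n u) b" for n b
    unfolding lg_sum_def E_bar_eq_poly divide_inverse by (intro continuous_intros)
  then have 1: "((\<lambda>x. lg_sum n u (beta_bar x)) \<longlongrightarrow> lg_sum n u 1) at_top" for n
    by (rule isCont_tendsto_compose[OF _ beta_bar_tendsto_1])
  have 2: "((\<lambda>x. ln (1 + x^2) / 4 - ln x / 2 :: real) \<longlongrightarrow> 0) at_top" by real_asymp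
  \<comment> \<open>\<xi> = x^2/2 + ln (2 x) / 2 + 1/4 + o(1).\<close>
  have 3: "((\<lambda>x. xi_bar x - x^2 / 2 - ln x / 2 - ln 2 / 2 - 1/4) \<longlongrightarrow> 0) at_top"
    unfolding xi_bar_def by real_asymp
  let ?Z = "\<lambda>x. exp (of_real (ln (1 + x^2) / 4 - ln x / 2)
         - \<i> * of_real (u * (xi_bar x - x^2 / 2 - ln x / 2 - ln 2 / 2 - 1/4))
         - (lg_sum (2 * m + 1) u (beta_bar x) - lg_sum (2 * m + 1) u 1))"
  have "(?Z \<longlongrightarrow> exp (of_real 0 - \<i> * of_real (u * 0) - (lg_sum (2 * m + 1) u 1 - lg_sum (2 * m + 1) u 1))) at_top"
    by (intro tendsto_intros 1 2 3)
  then have "(?Z \<longlongrightarrow> 1) at_top" by simp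
  then show ?thesis
    by (rule Lim_transform_eventually)
       (use eventually_gt_at_top[of 0] in eventually_elim, rule LG_inv_mult_lead[OF u, symmetric])
qed

text \<open>The second limit is the product of -1/2 from \<open>pcf_int'_ratio_tendsto\<close> with
  the squared scaling factor -2 i u of the ray. It is the starting value for g in the error
  estimate.\<close>

lemma pcf_ray_mult_LG_inv_tendsto:
  assumes u: "u > 0"
  defines "T \<equiv> \<lambda>x. complex_of_real (1 / sqrt (1 + x^2))"
  shows "((\<lambda>x. pcf_ray u x * LG_inv m u x) \<longlongrightarrow> 1) at_top"
    "((\<lambda>x. pcf_ray' u x * LG_inv m u x * T x) \<longlongrightarrow> \<i> * of_real u) at_top"
proof -
  define a where "a = - (1/2) * \<i> * complex_of_real u"
  have a: "Re a > - 1/2" unfolding a_def by simp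
  define \<omega> where "\<omega> = exp (- (complex_of_real pi * \<i> / 4))"
  define c where "c = sqrt (2 * u)"
  have c: "c > 0" "c^2 = 2 * u" unfolding c_def using u by auto
  define z where "z = (\<lambda>x. complex_of_real (c * x) * \<omega>)"
  have fz: "filterlim z (inf at_infinity (principal {z. \<bar>Arg z\<bar> \<le> 3/4 * pi - pi/2})) at_top"
    unfolding z_def \<omega>_def by (rule filterlim_ray[OF c(1)])
  have LE: "((\<lambda>x. LG_inv m u x * pcf_lead a (z x)) \<longlongrightarrow> 1) at_top"
    using LG_inv_mult_lead_tendsto[OF u] unfolding z_def c_def \<omega>_def a_def .
  have r1: "((\<lambda>x. pcf_U a (z x) / pcf_lead a (z x)) \<longlongrightarrow> 1) at_top"
    using filterlim_compose[OF is_pcf_U_ratio_tendsto[OF is_pcf_U_pcf_U[OF a], of "pi/2"] fz]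
    unfolding pcf_lead_def by simp
  have r2: "((\<lambda>x. pcf_int' a (z x) / (z x * pcf_lead a (z x))) \<longlongrightarrow> - 1/2) at_top"
    using filterlim_compose[OF pcf_int'_ratio_tendsto[OF a, of "pi/2"] fz]
    unfolding pcf_lead_def by simp
  have nz: "pcf_lead a (z x) \<noteq> 0" "z x \<noteq> 0" if "x > 0" for x
    using that c unfolding pcf_lead_def z_def \<omega>_def by auto
  have "((\<lambda>x. (pcf_U a (z x) / pcf_lead a (z x)) * (LG_inv m u x * pcf_lead a (z x))) \<longlongrightarrow> 1 * 1) at_top"
    by (rule tendsto_mult[OF r1 LE])
  then have "((\<lambda>x. (pcf_U a (z x) / pcf_lead a (z x)) * (LG_inv m u x * pcf_lead a (z x))) \<longlongrightarrow> 1) at_top" by simp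
  then show "((\<lambda>x. pcf_ray u x * LG_inv m u x) \<longlongrightarrow> 1) at_top"
  proof (rule Lim_transform_eventually)
    show "eventually (\<lambda>x. (pcf_U a (z x) / pcf_lead a (z x)) * (LG_inv m u x * pcf_lead a (z x)) = pcf_ray u x * LG_inv m u x) at_top"
      using eventually_gt_at_top[of 0]
    proof eventually_elim
      case (elim x)
      show ?case using nz(1)[OF elim] unfolding pcf_ray_def a_def[symmetric] z_def c_def \<omega>_def by simp
    qed
  qed
  have "((\<lambda>x. (of_real c * \<omega>)^2 * of_real (beta_bar x) * (pcf_int' a (z x) / (z x * pcf_lead a (z x))) * (LG_inv m u x * pcf_lead a (z x)))
     \<longlongrightarrow> (of_real c * \<omega>)^2 * of_real 1 * (- 1/2) * 1) at_top"
    by (intro tendsto_intros r2 LE beta_bar_tendsto_1)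
  also have "(of_real c * \<omega>)^2 * of_real 1 * (- 1/2) * 1 = \<i> * of_real u"
  proof -
    have "(of_real c * \<omega>)^2 = of_real (c^2) * (- \<i>)"
      unfolding power_mult_distrib \<omega>_def exp_minus_i_pi_quarter_sq by simp
    then show ?thesis unfolding c(2) by simp
  qed
  finally show "((\<lambda>x. pcf_ray' u x * LG_inv m u x * T x) \<longlongrightarrow> \<i> * of_real u) at_top"
  proof (rule Lim_transform_eventually)
    show "eventually (\<lambda>x. (of_real c * \<omega>)^2 * of_real (beta_bar x) * (pcf_int' a (z x) / (z x * pcf_lead a (z x))) * (LG_inv m u x * pcf_lead a (z x))
       = pcf_ray' u x * LG_inv m u x * T x) at_top"
      using eventually_gt_at_top[of 0]
    proof eventually_elim
      case (elim x)
      have bT: "complex_of_real (beta_bar x) = of_real x * T x"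
        unfolding beta_bar_def T_def by (simp add: add.commute)
      have "(of_real c * \<omega>)^2 * of_real (beta_bar x) * (pcf_int' a (z x) / (z x * pcf_lead a (z x))) * (LG_inv m u x * pcf_lead a (z x))
        = of_real c * \<omega> * (z x * T x) * (pcf_int' a (z x) / (z x * pcf_lead a (z x))) * (LG_inv m u x * pcf_lead a (z x))"
        unfolding bT by (simp add: z_def power2_eq_square mult_ac)
      also have "\<dots> = of_real c * \<omega> * pcf_int' a (z x) * LG_inv m u x * T x"
        using nz[OF elim] by simp
      finally show ?case unfolding pcf_ray'_def a_def[symmetric] z_def c_def \<omega>_def .
    qed
  qed
qed

lemma lg_P_tendsto: "((\<lambda>x. lg_P n u (beta_bar x)) \<longlongrightarrow> \<i> * of_real u) at_top"
proof -
  have "isCont (lg_P n u) b" for b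
    unfolding lg_P_def divide_inverse by (intro continuous_intros)
  then have "((\<lambda>x. lg_P n u (beta_bar x)) \<longlongrightarrow> lg_P n u 1) at_top"
    by (rule isCont_tendsto_compose[OF _ beta_bar_tendsto_1])
  moreover have "poly (D_poly j) 1 = 0" for j unfolding D_poly_def by simp
  then have "lg_P n u 1 = \<i> * of_real u" unfolding lg_P_def by simp
  ultimately show ?thesis by simp
qed

section \<open>The relative error \<open>eta_bar\<close>\<close>

theorem eta_bar_tendsto_0:
  assumes u: "u > 0"
  shows "(eta_bar m u \<longlongrightarrow> 0) at_top"
proof -
  have "((\<lambda>x. pcf_ray u x * LG_inv m u x - 1) \<longlongrightarrow> 1 - 1) at_top"
    by (intro tendsto_diff pcf_ray_mult_LG_inv_tendsto u tendsto_const)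
  then show ?thesis unfolding eta_bar_alt[OF u, symmetric] by simp
qed

theorem eta_bar_bound:
  obtains C where "C \<ge> 0" "\<And>u x. u \<ge> 1 \<Longrightarrow> x \<ge> 0 \<Longrightarrow> norm (eta_bar m u x) \<le> C / u ^ (2 * m + 2)"
proof -
  define n where "n = 2 * m + 1"
  have n: "n \<ge> 1" unfolding n_def by simp
  obtain M where M: "M \<ge> 0"
    "\<And>u b. u \<ge> 1 \<Longrightarrow> 0 \<le> b \<Longrightarrow> b \<le> 1 \<Longrightarrow> norm (lg_P n u b - \<i> * of_real u) \<le> M * (1 - b^2)^2"
    "\<And>u b. u \<ge> 1 \<Longrightarrow> 0 \<le> b \<Longrightarrow> b \<le> 1 \<Longrightarrow> norm (lg_R n u b) \<le> M * (1 - b^2)^2 / u ^ n"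
    using lg_bounds[OF n] by blast
  have "norm (eta_bar m u x) \<le> sqrt (2 * exp (12 * M)) / u ^ (2 * m + 2)" if u: "u \<ge> 1" and x: "x \<ge> 0" for u x
  proof -
    have u0: "u > 0" using u by simp
    define S where "S = (\<lambda>x. complex_of_real (sqrt (1 + x^2)))"
    define T where "T = (\<lambda>x. complex_of_real (1 / sqrt (1 + x^2)))"
    define P where "P = (\<lambda>x. lg_P n u (beta_bar x))"
    define R where "R = (\<lambda>x. lg_R n u (beta_bar x))"
    define ell where "ell = (\<lambda>x. S x * P x - of_real x * T x * T x / 2)"
    define h where "h = (\<lambda>x. pcf_ray u x * LG_inv m u x)"
    define g where "g = (\<lambda>x. (pcf_ray' u x - ell x * pcf_ray u x) * LG_inv m u x * T x)"
    have Req: "R x = of_real (u^2) + (P x)^2 + lg_Q n u (beta_bar x) - of_real ((2 - 3 * x^2) / (4 * (1 + x^2)^3))" for x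
      unfolding R_def P_def lg_R_def schwarzian_eq by simp
    note tr = liouville_green_transform[where P = P and Q = "\<lambda>x. lg_Q n u (beta_bar x)" and Li = "LG_inv m u" and u = u,
        OF pcf_ray_deriv[OF u0]]
    have Li: "(LG_inv m u has_vector_derivative - ell x * LG_inv m u x) (at x)" for x
      using LG_inv_deriv[of m u x] unfolding ell_def S_def T_def P_def n_def .
    have dP: "(P has_vector_derivative S x * lg_Q n u (beta_bar x)) (at x)" for x
      unfolding P_def S_def by (rule lg_P_deriv)
    have s4: "(1 - (beta_bar x)^2)^2 = 1 / sqrt (1 + x^2) ^ 4" for x
    proof -
      have "1 + x^2 > 0" by (simp add: add_pos_nonneg)
      then have "sqrt (1 + x^2) ^ 2 = 1 + x^2" by simp
      then have "sqrt (1 + x^2) ^ 4 = (1 + x^2)^2" by (metis power2_eq_square power4_eq_xxxx mult.assoc)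
      then show ?thesis unfolding beta_bar_sq by (simp add: power_divide)
    qed
    have lim_h: "(h \<longlongrightarrow> 1) at_top" unfolding h_def by (rule pcf_ray_mult_LG_inv_tendsto(1)[OF u0])
    \<comment> \<open>The derivative quotient and P * h both tend to i u, so they cancel; the
      amplitude term decays like x / s^3.\<close>
    have lim_g: "(g \<longlongrightarrow> 0) at_top"
    proof -
      have ST: "S x * T x = 1" for x
      proof -
        have "1 + x^2 > 0" by (simp add: add_pos_nonneg)
        then show ?thesis unfolding S_def T_def of_real_mult[symmetric] by simp
      qed
      have "((\<lambda>x::real. x * (1 / sqrt (1 + x^2)) * (1 / sqrt (1 + x^2)) * (1 / sqrt (1 + x^2)) / 2) \<longlongrightarrow> 0) at_top"
        by real_asymp
      from tendsto_of_real[OF this, where 'a = complex]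
      have "((\<lambda>x. of_real x * T x * T x * T x / 2) \<longlongrightarrow> of_real 0) at_top"
        unfolding T_def by (simp only: of_real_mult of_real_divide of_real_numeral)
      from tendsto_diff[OF pcf_ray_mult_LG_inv_tendsto(2)[OF u0, of m, folded T_def]
          tendsto_mult[OF tendsto_diff[OF lg_P_tendsto[of n u] this] lim_h]]
      have "((\<lambda>x. pcf_ray' u x * LG_inv m u x * T x - (P x - of_real x * T x * T x * T x / 2) * h x)
          \<longlongrightarrow> 0) at_top"
        unfolding P_def T_def by simp
      moreover have "(\<lambda>x. pcf_ray' u x * LG_inv m u x * T x - (P x - of_real x * T x * T x * T x / 2) * h x) = g"
      proof
        fix x
        have "g x = pcf_ray' u x * LG_inv m u x * T x - (P x * (S x * T x) - of_real x * T x * T x * T x / 2) * h x"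
          unfolding g_def ell_def h_def by (simp add: algebra_simps)
        then show "pcf_ray' u x * LG_inv m u x * T x - (P x - of_real x * T x * T x * T x / 2) * h x = g x"
          unfolding ST by simp
      qed
      ultimately show ?thesis by simp
    qed
    \<comment> \<open>The residual is of size u^(-n) = u * A with n = 2m + 1; the surplus factor u
      is regained in \<open>liouville_green_error\<close> by dividing g by 2 i u.\<close>
    define A where "A = 1 / u ^ (2 * m + 2)"
    have un: "u ^ k \<ge> 1" for k using u by (rule one_le_power)
    have A: "0 \<le> A" "A \<le> 1" unfolding A_def using un[of "2 * m + 2"] u0 by auto
    have "norm (h x - 1) \<le> A * sqrt (2 * exp (12 * M))"
    proof (rule liouville_green_error[OF u0 A M(1) _ _ _ _ lim_h lim_g x])
      show "(h has_vector_derivative of_real (sqrt (1 + x^2)) * g x) (at x)" for x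
        using tr(1)[OF Li[unfolded ell_def S_def T_def] dP[unfolded S_def]]
        unfolding h_def g_def ell_def S_def T_def .
      show "(g has_vector_derivative - 2 * of_real (sqrt (1 + x^2)) * P x * g x - of_real (sqrt (1 + x^2)) * R x * h x) (at x)" for x
        using tr(2)[OF Li[unfolded ell_def S_def T_def] dP[unfolded S_def]]
        unfolding Req h_def g_def ell_def S_def T_def .
      fix x :: real assume x: "x \<ge> 0"
      show "norm (P x - \<i> * of_real u) \<le> M / sqrt (1 + x^2) ^ 4"
        using M(2)[OF u beta_bar_bounds(1)[OF x] beta_bar_bounds(2)] unfolding P_def s4 by simp
      have "1 / u ^ n = u * A" unfolding A_def n_def using u0 by simp
      then show "norm (R x) \<le> M / sqrt (1 + x^2) ^ 4 * u * A"
        using M(3)[OF u beta_bar_bounds(1)[OF x] beta_bar_bounds(2)] unfolding R_def s4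
        by (simp add: divide_inverse mult.assoc)
    qed
    then show ?thesis unfolding h_def eta_bar_alt[OF u0, symmetric] A_def by simp
  qed
  then show ?thesis using that[of "sqrt (2 * exp (12 * M))"] by simp
qed


section \<open>Weber functions and the phase error\<close>

lemma weber_k_minus: "weber_k (- u) = k_bar u"
  unfolding weber_k_def k_bar_def by simp

text \<open>With t = exp (- pi u / 2), \<open>k_bar u\<close> is sqrt (1 + t^2) - t. Its exponential
  closeness to 1 is what pins down the phase at the origin beyond all powers of 1/u.\<close>

lemma k_bar_bounds: "k_bar u > 0" "k_bar u \<le> 1" "1 - k_bar u \<le> exp (- pi * u / 2)"
proof -
  show "k_bar u > 0" using weber_k_alt(1)[of "- u / 2"] weber_k_minus[of u] by simp
  define t where "t = exp (- pi * u / 2)"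
  have t: "t > 0" unfolding t_def by simp
  have t2: "exp (- pi * u) = t^2" unfolding t_def by (simp add: exp_double[symmetric])
  have "sqrt (1 + t^2) \<le> 1 + t"
    using t by (intro real_le_lsqrt) (auto simp: power2_sum)
  then show "k_bar u \<le> 1" unfolding k_bar_def t2 t_def[symmetric] by simp
  have "1 \<le> sqrt (1 + t^2)" by simp
  then show "1 - k_bar u \<le> exp (- pi * u / 2)" unfolding k_bar_def t2 t_def[symmetric] by simp
qed

text \<open>By oddness of \<open>phi2\<close> the phases \<open>rho (- u)\<close> and pi/8 -
  \<open>chi_hat m u\<close> add up to pi/4 - \<open>eps m u\<close>, and Arg (1 + \<eta>) completes
  this to pi/4 + \<open>eps_tilde\<close>. The cosine and sine formulas are the real and imaginary
  parts of this polar form.\<close>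

lemma LG_phase_form:
  assumes u: "u > 0"
  shows "exp (\<i> * of_real (rho (- u))) * pcf_U (- (1/2) * \<i> * of_real u)
      (of_real (sqrt (2 * u) * x) * exp (- (of_real pi * \<i> / 4))) =
    of_real (exp (pi * u / 8) / ((2 * u) powr (1/4) * (1 + x^2) powr (1/4)) *
       exp (\<Sum>s=1..m. (-1)^s * E_bar (2 * s) (beta_bar x) / u^(2 * s)) * cmod (1 + eta_bar m u x)) *
    exp (\<i> * of_real (u * xi_bar x + 1/4 * pi
       - (\<Sum>s=0..m. (-1)^s * E_bar (2 * s + 1) (beta_bar x) / u^(2 * s + 1)) + eps_tilde m u x))"
proof -
  define SE where "SE = (\<Sum>s=1..m. (-1)^s * E_bar (2 * s) (beta_bar x) / u^(2 * s))"
  define SO where "SO = (\<Sum>s=0..m. (-1)^s * E_bar (2 * s + 1) (beta_bar x) / u^(2 * s + 1))"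
  define w where "w = 1 + eta_bar m u x"
  define K where "K = exp (pi * u / 8) / ((2 * u) powr (1/4) * (1 + x^2) powr (1/4))"
  \<comment> \<open>For small u the factor 1 + \<eta> has not been shown to be nonzero; if it is 0
    both sides vanish.\<close>
  have w: "w = of_real (cmod w) * exp (\<i> * of_real (Arg w))"
    by (cases "w = 0") (auto simp: Arg_eq)
  have ph: "\<i> * of_real (rho (- u)) + (- (\<i> * of_real (chi_hat m u - 1/8 * pi))) + (\<i> * of_real (u * xi_bar x) - \<i> * of_real SO)
        + \<i> * of_real (Arg w) = \<i> * of_real (u * xi_bar x + 1/4 * pi - SO + eps_tilde m u x)"
    unfolding rho_def phi2_minus eps_tilde_def eps_def chi_hat_def w_def by (simp add: algebra_simps)
  have L: "LG_approx m u x = exp (- (\<i> * of_real (chi_hat m u - 1/8 * pi))) * of_real K *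
       (of_real (exp SE) * exp (\<i> * of_real (u * xi_bar x) - \<i> * of_real SO))"
    unfolding LG_approx_def SE_def[symmetric] SO_def[symmetric] K_def add_diff_eq[symmetric] exp_add exp_of_real
      of_real_divide
    by (simp only: times_divide_eq_right times_divide_eq_left mult_ac)
  have "exp (\<i> * of_real (rho (- u))) * (LG_approx m u x * w) =
     of_real (K * exp SE * cmod w) * (exp (\<i> * of_real (rho (- u))) * exp (- (\<i> * of_real (chi_hat m u - 1/8 * pi))) *
        exp (\<i> * of_real (u * xi_bar x) - \<i> * of_real SO) * exp (\<i> * of_real (Arg w)))"
    unfolding L by (subst w) (simp only: of_real_mult mult_ac)
  also have "exp (\<i> * of_real (rho (- u))) * exp (- (\<i> * of_real (chi_hat m u - 1/8 * pi))) *
        exp (\<i> * of_real (u * xi_bar x) - \<i> * of_real SO) * exp (\<i> * of_real (Arg w))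
     = exp (\<i> * of_real (u * xi_bar x + 1/4 * pi - SO + eps_tilde m u x))"
    unfolding ph[symmetric] by (simp only: exp_add)
  finally show ?thesis unfolding eta_bar_eq[OF u, of x m] SE_def SO_def w_def K_def .
qed

lemma amplitude_eq:
  fixes k u q :: real
  assumes "k > 0" "u > 0" "q > 0"
  shows "sqrt (2 * k) / ((2 * u) powr (1/4) * q powr (1/4)) = (2 * k^2 / (u * q)) powr (1/4)"
proof -
  have "sqrt (2 * k) = (2 * k) powr (2 * (1/4))" using assms by (simp add: powr_half_sqrt)
  also have "\<dots> = ((2 * k) powr 2) powr (1/4)" by (rule powr_powr[symmetric])
  also have "(2 * k) powr 2 = 4 * k^2" using assms by (simp add: power_mult_distrib)
  finally have "sqrt (2 * k) = (4 * k^2) powr (1/4)" .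
  moreover have "(2 * u) powr (1/4) * q powr (1/4) = (2 * u * q) powr (1/4)"
    by (intro powr_mult[symmetric]; use assms in simp)
  moreover have "(4 * k^2) powr (1/4) / (2 * u * q) powr (1/4) = (4 * k^2 / (2 * u * q)) powr (1/4)"
    by (intro powr_divide[symmetric]; use assms in simp)
  ultimately have "sqrt (2 * k) / ((2 * u) powr (1/4) * q powr (1/4)) = (4 * k^2 / (2 * u * q)) powr (1/4)"
    by (simp only:)
  also have "4 * k^2 / (2 * u * q) = 2 * k^2 / (u * q)" using assms by (simp add: field_simps)
  finally show ?thesis .
qed

lemma weber_W_ray:
  assumes u: "u > 0"
  shows "weber_W (- (1/2) * u) y = sqrt (2 * k_bar u) * exp (- (pi * u / 8)) *
     Re (exp (\<i> * of_real (rho (- u))) * pcf_U (- (1/2) * \<i> * of_real u)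
        (of_real y * exp (- (of_real pi * \<i> / 4))))"
proof -
  have e: "2 * (- (1/2) * u) = - u" "pi * (- (1/2) * u) / 4 = - (pi * u / 8)"
    "\<i> * complex_of_real (- (1/2) * u) = - (1/2) * \<i> * of_real u" by simp_all
  show ?thesis unfolding weber_W_def e weber_k_minus ..
qed

lemma connection_ray:
  assumes u: "u > 0" and x: "x \<ge> 0"
  defines "V \<equiv> \<lambda>y. exp (\<i> * of_real (rho (- u))) * pcf_U (- (1/2) * \<i> * of_real u)
        (of_real y * exp (- (of_real pi * \<i> / 4)))"
  shows "k_bar u * Re (V (- x)) = Im (V x)"
proof -
  have e: "2 * (- (1/2) * u) = - u"
    "\<i> * complex_of_real (- (1/2) * u) = - (1/2) * \<i> * of_real u" by simp_all
  show ?thesis using pcf_U_connection[OF x, of "- (1/2) * u"] unfolding e weber_k_minus V_def .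
qed

lemma Re_Im_polar: "Re (of_real r * exp (\<i> * of_real t)) = r * cos t" "Im (of_real r * exp (\<i> * of_real t)) = r * sin t"
  by (simp_all add: Re_exp Im_exp)

theorem weber_W_pos:
  assumes u: "u > 0"
  shows "weber_W (- (1/2) * u) (sqrt (2 * u) * x) =
          (2 * (k_bar u)^2 / (u * (1 + x^2))) powr (1/4) *
          exp (\<Sum>s=1..m. (-1)^s * E_bar (2 * s) (beta_bar x) / u^(2 * s)) *
          cos (u * xi_bar x + 1/4 * pi
               - (\<Sum>s=0..m. (-1)^s * E_bar (2 * s + 1) (beta_bar x) / u^(2 * s + 1))
               + eps_tilde m u x) *
          cmod (1 + eta_bar m u x)"
proof -
  have p: "1 + x^2 > 0" by (simp add: add_pos_nonneg)
  \<comment> \<open>The factor exp (pi a / 4) of W at a = -u/2 cancels the growth exp (pi u / 8) of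
    the approximation.\<close>
  have ee: "exp (- (pi * u / 8)) * exp (pi * u / 8) = 1" by (simp flip: exp_add)
  have alg: "a * e * (e' / d * s * w * c) = (e * e') * (a / d) * s * c * w" for a e e' d s w c :: real
    by simp
  show ?thesis
    unfolding weber_W_ray[OF u] LG_phase_form[OF u, of x m] Re_Im_polar alg ee
      amplitude_eq[OF k_bar_bounds(1) u p] by simp
qed

theorem weber_W_neg:
  assumes u: "u > 0" and x: "x \<ge> 0"
  shows "weber_W (- (1/2) * u) (- (sqrt (2 * u) * x)) =
          (2 / (u * (k_bar u)^2 * (1 + x^2))) powr (1/4) *
          exp (\<Sum>s=1..m. (-1)^s * E_bar (2 * s) (beta_bar x) / u^(2 * s)) *
          sin (u * xi_bar x + 1/4 * pi
               - (\<Sum>s=0..m. (-1)^s * E_bar (2 * s + 1) (beta_bar x) / u^(2 * s + 1))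
               + eps_tilde m u x) *
          cmod (1 + eta_bar m u x)"
proof -
  define V where "V = (\<lambda>y. exp (\<i> * of_real (rho (- u))) * pcf_U (- (1/2) * \<i> * of_real u)
        (of_real y * exp (- (of_real pi * \<i> / 4))))"
  define k where "k = k_bar u"
  have k: "k > 0" unfolding k_def by (rule k_bar_bounds)
  have p: "1 + x^2 > 0" by (simp add: add_pos_nonneg)
  have ee: "exp (- (pi * u / 8)) * exp (pi * u / 8) = 1" by (simp flip: exp_add)
  have "sqrt (2 * u) * x \<ge> 0" using u x by simp
  from connection_ray[OF u this] have "k * Re (V (- (sqrt (2 * u) * x))) = Im (V (sqrt (2 * u) * x))"
    unfolding V_def k_def .
  then have R: "Re (V (- (sqrt (2 * u) * x))) = Im (V (sqrt (2 * u) * x)) / k" using k by (simp add: field_simps)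
  \<comment> \<open>The connection formula divides by k, which amounts to replacing k by 1/k in the
    amplitude; \<open>amplitude_eq\<close> is then reused with 1/k.\<close>
  have sk: "sqrt (2 * k) / k = sqrt (2 * (1 / k))"
  proof -
    have "sqrt (2 * k) / k = sqrt (2 * k) / sqrt (k^2)" using k by simp
    also have "\<dots> = sqrt (2 * k / k^2)" by (rule real_sqrt_divide[symmetric])
    also have "2 * k / k^2 = 2 * (1 / k)" using k by (simp add: power2_eq_square)
    finally show ?thesis .
  qed
  have "2 * (1 / k)^2 / (u * (1 + x^2)) = 2 / (u * k^2 * (1 + x^2))" by (simp add: power_divide mult_ac)
  then have am: "sqrt (2 * k) / k / ((2 * u) powr (1/4) * (1 + x^2) powr (1/4)) = (2 / (u * k^2 * (1 + x^2))) powr (1/4)"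
    unfolding sk using amplitude_eq[of "1 / k" u "1 + x^2"] k u p by simp
  have alg: "a * e * (e' / d * s * w * c / k) = (e * e') * (a / k / d) * s * c * w" for a e e' d s w c k :: real
    by (simp add: mult_ac)
  show ?thesis
    unfolding weber_W_ray[OF u] R[unfolded V_def] LG_phase_form[OF u, of x m] Re_Im_polar
      k_def[symmetric] alg ee am by simp
qed

section \<open>Size of the phase error\<close>

lemma abs_Arg_1_plus_le:
  assumes "norm w < 1/2"
  shows "\<bar>Arg (1 + w)\<bar> \<le> 2 * norm w"
proof -
  have "1 + w \<noteq> 0"
  proof
    assume "1 + w = 0"
    then have "w = - 1" by (simp add: add_eq_0_iff)
    then show False using assms by simp
  qed
  then have "\<bar>Arg (1 + w)\<bar> \<le> norm (Ln (1 + w))"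
    using abs_Im_le_cmod[of "Ln (1 + w)"] by (simp add: Arg_eq_Im_Ln)
  also have "\<dots> \<le> 2 * norm w" using assms by (rule norm_Ln_le)
  finally show ?thesis .
qed

text \<open>Since 1 < pi/3, the cosine is at least 1/2 on [0, 1]. This converts information modulo
  pi into a bound, once the angle is known to be at most 1 in absolute value.\<close>

lemma abs_le_2_abs_sin:
  fixes t :: real assumes "\<bar>t\<bar> \<le> 1"
  shows "\<bar>t\<bar> \<le> 2 * \<bar>sin t\<bar>"
proof -
  have main: "t \<le> 2 * sin t" if t: "0 \<le> t" "t \<le> 1" for t :: real
  proof -
    have "2 * sin 0 - 0 \<le> 2 * sin t - t"
    proof (rule DERIV_nonneg_imp_nondecreasing[OF t(1), where f = "\<lambda>t. 2 * sin t - t"])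
      fix r assume r: "0 \<le> r" "r \<le> t"
      have "cos (pi / 3) \<le> cos r" using r t pi_gt3 by (intro cos_monotone_0_pi_le) auto
      then have "2 * cos r - 1 \<ge> 0" by (simp add: cos_60)
      moreover have "((\<lambda>t. 2 * sin t - t) has_real_derivative 2 * cos r - 1) (at r)"
        by (auto intro!: derivative_eq_intros)
      ultimately show "\<exists>y. ((\<lambda>t. 2 * sin t - t) has_real_derivative y) (at r) \<and> y \<ge> 0" by blast
    qed
    then show ?thesis by simp
  qed
  have "\<bar>t\<bar> \<le> 2 * sin \<bar>t\<bar>" using assms by (intro main) auto
  also have "\<dots> \<le> 2 * \<bar>sin t\<bar>" by (cases "t \<ge> 0") auto
  finally show ?thesis .
qed

text \<open>The comparison at \<open>x = 0\<close> determines \<open>eps m u\<close> only modulo \<open>\<pi>\<close>; this crude bound fixes the branch.\<close>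

lemma eps_crude:
  assumes u: "u > 0"
  shows "\<bar>eps m u\<bar> \<le> pi / 8 + \<bar>\<Sum>s=0..m. (-1)^s * E_bar (2 * s + 1) 1 / u^(2 * s + 1)\<bar>"
proof -
  define O1 where "O1 = (\<Sum>s=0..m. (-1)^s * E_bar (2 * s + 1) 1 / u^(2 * s + 1))"
  have "phi2 u = Im (ln_Gamma (1/2 + \<i> * complex_of_real (u / 2)))" unfolding phi2_eq by simp
  then have "\<bar>phi2 u - (u / 2 * ln (u / 2) - u / 2)\<bar> \<le> pi / 4"
    using Im_ln_Gamma_half_bound[of "u / 2"] u by simp
  \<comment> \<open>The explicit term is minus half of y * ln y - y at y = u/2, so half of the bound
    pi/4 results.\<close>
  moreover have "1/2 * phi2 u + u / 4 * ln (2 * exp 1 / u) = 1/2 * (phi2 u - (u / 2 * ln (u / 2) - u / 2))"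
    using u by (simp add: ln_div ln_mult algebra_simps)
  ultimately have "\<bar>1/2 * phi2 u + u / 4 * ln (2 * exp 1 / u)\<bar> \<le> pi / 8" by argo
  then show ?thesis unfolding eps_def O1_def[symmetric]
    using abs_triangle_ineq4[of "1/2 * phi2 u + u / 4 * ln (2 * exp 1 / u)" O1] by argo
qed

text \<open>At x = 0 the quantities \<xi>, \<beta> and all odd coefficients vanish, so with \<psi> =
  \<open>eps_tilde m u 0\<close> the phase is \<psi> + pi/4. The connection formula relates the
  value at 0 to itself and gives tan (\<psi> + pi/4) = k, that is, (1 + k) sin \<psi> = -(1 - k) cos
  \<psi>.\<close>

lemma sin_eps_tilde_0:
  assumes u: "u > 0" and eta: "1 + eta_bar m u 0 \<noteq> 0"
  shows "\<bar>sin (eps_tilde m u 0)\<bar> \<le> exp (- pi * u / 2)"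
proof -
  define \<psi> where "\<psi> = eps_tilde m u 0"
  define k where "k = k_bar u"
  define r where "r = exp (pi * u / 8) / ((2 * u) powr (1/4) * (1 + 0^2) powr (1/4)) *
       exp (\<Sum>s=1..m. (-1)^s * E_bar (2 * s) (beta_bar 0) / u^(2 * s)) * cmod (1 + eta_bar m u 0)"
  have r: "r > 0" unfolding r_def using u eta by simp
  have b0: "beta_bar 0 = 0" "xi_bar 0 = 0" unfolding beta_bar_def xi_bar_def by auto
  have O0: "(\<Sum>s=0..m. (-1)^s * E_bar (2 * s + 1) 0 / u^(2 * s + 1)) = 0"
    by (intro sum.neutral ballI) (simp add: E_bar_odd_at_0)
  have "exp (\<i> * of_real (rho (- u))) * pcf_U (- (1/2) * \<i> * of_real u)
      (of_real (sqrt (2 * u) * 0) * exp (- (of_real pi * \<i> / 4))) = of_real r * exp (\<i> * of_real (\<psi> + pi / 4))"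
    unfolding LG_phase_form[OF u, of 0 m] r_def[symmetric] unfolding b0 O0 \<psi>_def by (simp add: add.commute)
  then have V0: "exp (\<i> * of_real (rho (- u))) * pcf_U (- (1/2) * \<i> * of_real u)
      (of_real 0 * exp (- (of_real pi * \<i> / 4))) = of_real r * exp (\<i> * of_real (\<psi> + pi / 4))" by simp
  have "k * (r * cos (\<psi> + pi / 4)) = r * sin (\<psi> + pi / 4)"
    using connection_ray[OF u order.refl] unfolding minus_zero V0 Re_Im_polar k_def .
  then have "k * cos (\<psi> + pi / 4) = sin (\<psi> + pi / 4)" using r by simp
  then have "k * ((cos \<psi> - sin \<psi>) * (sqrt 2 / 2)) = (sin \<psi> + cos \<psi>) * (sqrt 2 / 2)"
    unfolding cos_add sin_add cos_45 sin_45 by (simp add: algebra_simps)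
  then have "k * (cos \<psi> - sin \<psi>) * (sqrt 2 / 2) = (sin \<psi> + cos \<psi>) * (sqrt 2 / 2)" by (simp only: mult.assoc)
  then have "k * (cos \<psi> - sin \<psi>) = sin \<psi> + cos \<psi>" by simp
  then have e: "(1 + k) * sin \<psi> = - ((1 - k) * cos \<psi>)" by (simp add: algebra_simps)
  have k: "k > 0" "1 - k \<ge> 0" "1 - k \<le> exp (- pi * u / 2)" unfolding k_def using k_bar_bounds[of u] by auto
  have "\<bar>sin \<psi>\<bar> * 1 \<le> \<bar>sin \<psi>\<bar> * (1 + k)" using k by (intro mult_left_mono) auto
  also have "\<dots> = \<bar>(1 + k) * sin \<psi>\<bar>" using k by (simp add: abs_mult)
  also have "\<dots> = (1 - k) * \<bar>cos \<psi>\<bar>" unfolding e using k by (simp add: abs_mult)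
  also have "\<dots> \<le> (1 - k) * 1" using k by (intro mult_left_mono) auto
  finally show ?thesis using k(3) unfolding \<psi>_def by simp
qed

text \<open>\<open>eps m u\<close> does not depend on x and equals Arg (1 + \<eta>) -
  \<open>eps_tilde\<close> at x = 0: the first term is controlled by \<open>eta_bar_bound\<close>,
  the second is exponentially small.\<close>

theorem eps_bound:
  obtains C u0 where "C \<ge> 0" "u0 \<ge> 1" "\<And>u. u \<ge> u0 \<Longrightarrow> \<bar>eps m u\<bar> \<le> C / u ^ (2 * m + 2)"
    "\<And>u x. u \<ge> u0 \<Longrightarrow> x \<ge> 0 \<Longrightarrow> \<bar>Arg (1 + eta_bar m u x)\<bar> \<le> C / u ^ (2 * m + 2)"
proof -
  define N where "N = 2 * m + 2"
  obtain C where C: "C \<ge> 0" "\<And>u x. u \<ge> 1 \<Longrightarrow> x \<ge> 0 \<Longrightarrow> norm (eta_bar m u x) \<le> C / u ^ N"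
    using eta_bar_bound[of m] unfolding N_def by blast
  have l1: "((\<lambda>u. C / u ^ N) \<longlongrightarrow> 0) at_top"
    unfolding N_def by (intro tendsto_divide_0[OF tendsto_const] filterlim_at_top_imp_at_infinity
        filterlim_pow_at_top filterlim_ident) simp
  have l2: "((\<lambda>u. \<Sum>s=0..m. (-1)^s * E_bar (2 * s + 1) 1 / u^(2 * s + 1)) \<longlongrightarrow> 0) at_top"
    by (intro tendsto_null_sum tendsto_divide_0[OF tendsto_const] filterlim_at_top_imp_at_infinity
        filterlim_pow_at_top filterlim_ident) simp
  have l3: "((\<lambda>u::real. u ^ N / exp u) \<longlongrightarrow> 0) at_top" by (rule tendsto_power_div_exp_0)
  \<comment> \<open>The thresholds make \<open>eps_tilde m u 0\<close> at most 2/16 + pi/8 + 1/8 < 1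
    in absolute value; 1/16 also rules out \<eta> = -1, and the last condition lets exp (- u) be
    absorbed by u^(-N).\<close>
  have "eventually (\<lambda>u. u \<ge> 1 \<and> C / u ^ N < 1/16 \<and>
      \<bar>\<Sum>s=0..m. (-1)^s * E_bar (2 * s + 1) 1 / u^(2 * s + 1)\<bar> < 1/8 \<and> u ^ N / exp u < 1) at_top"
    using eventually_ge_at_top[of 1] order_tendstoD(2)[OF l1, of "1/16"]
      order_tendstoD(2)[OF tendsto_rabs_zero[OF l2], of "1/8"] order_tendstoD(2)[OF l3, of 1]
    by (simp add: eventually_conj_iff)
  then obtain u0 where u0: "\<And>u. u \<ge> u0 \<Longrightarrow> u \<ge> 1 \<and> C / u ^ N < 1/16 \<and>
      \<bar>\<Sum>s=0..m. (-1)^s * E_bar (2 * s + 1) 1 / u^(2 * s + 1)\<bar> < 1/8 \<and> u ^ N / exp u < 1"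
    unfolding eventually_at_top_linorder by blast
  have A: "\<bar>Arg (1 + eta_bar m u x)\<bar> \<le> 2 * C / u ^ N" if u: "u \<ge> u0" and x: "x \<ge> 0" for u x
  proof -
    have "norm (eta_bar m u x) \<le> C / u ^ N" using C(2)[of u x] u0[OF u] x by simp
    moreover have "norm (eta_bar m u x) < 1/2" using calculation u0[OF u] by linarith
    ultimately show ?thesis using abs_Arg_1_plus_le[of "eta_bar m u x"] by simp
  qed
  have E: "\<bar>eps m u\<bar> \<le> (2 * C + 2) / u ^ N" if u: "u \<ge> u0" for u
  proof -
    have u1: "u \<ge> 1" and small: "C / u ^ N < 1/16" using u0[OF u] by auto
    have up: "u > 0" using u1 by simp
    have n: "norm (eta_bar m u 0) \<le> C / u ^ N" using C(2)[of u 0] u1 by simp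
    have nz: "1 + eta_bar m u 0 \<noteq> 0"
    proof
      assume "1 + eta_bar m u 0 = 0"
      then have "eta_bar m u 0 = - 1" by (simp add: add_eq_0_iff)
      then show False using n small by simp
    qed
    have Ar: "\<bar>Arg (1 + eta_bar m u 0)\<bar> \<le> 2 * C / u ^ N" by (rule A[OF u]) simp
    have "\<bar>eps_tilde m u 0\<bar> \<le> \<bar>Arg (1 + eta_bar m u 0)\<bar> + \<bar>eps m u\<bar>" unfolding eps_tilde_def by simp
    also have "\<dots> \<le> 2 * (C / u ^ N) + (pi / 8 + 1/8)"
      using Ar eps_crude[OF up, of m] u0[OF u] by simp
    also have "\<dots> \<le> 1" using small pi_less_4 by argo
    finally have "\<bar>eps_tilde m u 0\<bar> \<le> 2 * \<bar>sin (eps_tilde m u 0)\<bar>" by (rule abs_le_2_abs_sin)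
    also have "\<dots> \<le> 2 * exp (- pi * u / 2)" using sin_eps_tilde_0[OF up nz] by simp
    also have "\<dots> \<le> 2 * exp (- u)"
    proof -
      have "2 * u \<le> pi * u" using pi_ge_two up by (intro mult_right_mono) auto
      then show ?thesis by simp
    qed
    also have "\<dots> \<le> 2 * (1 / u ^ N)"
    proof -
      have "u ^ N < exp u" using u0[OF u] by simp
      then have "1 / exp u \<le> 1 / u ^ N" using up by (intro divide_left_mono) auto
      then show ?thesis by (simp add: exp_minus inverse_eq_divide)
    qed
    finally have "\<bar>eps_tilde m u 0\<bar> \<le> 2 / u ^ N" by simp
    then have "\<bar>eps m u\<bar> \<le> 2 * C / u ^ N + 2 / u ^ N" using Ar unfolding eps_tilde_def by linarith
    then show ?thesis by (simp add: add_divide_distrib)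
  qed
  show ?thesis
  proof (rule that[of "2 * C + 2" "max u0 1"])
    fix u x :: real assume u: "u \<ge> max u0 1" and x: "x \<ge> 0"
    have "2 * C / u ^ N \<le> (2 * C + 2) / u ^ N" using u by (intro divide_right_mono) auto
    then show "\<bar>Arg (1 + eta_bar m u x)\<bar> \<le> (2 * C + 2) / u ^ (2 * m + 2)"
      using A[of u x] u x unfolding N_def by simp
  qed (use C E in \<open>auto simp: N_def\<close>)
qed

theorem mainTheorem13:
  fixes m :: nat
  shows
    "(\<forall>u x :: real. u > 0 \<longrightarrow> 0 \<le> x \<longrightarrow>
        weber_W (- (1/2) * u) (sqrt (2 * u) * x) =
          (2 * (k_bar u)^2 / (u * (1 + x^2))) powr (1/4) *
          exp (\<Sum>s=1..m. (-1)^s * E_bar (2 * s) (beta_bar x) / u^(2 * s)) *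
          cos (u * xi_bar x + 1/4 * pi
               - (\<Sum>s=0..m. (-1)^s * E_bar (2 * s + 1) (beta_bar x) / u^(2 * s + 1))
               + eps_tilde m u x) *
          cmod (1 + eta_bar m u x)
      \<and> weber_W (- (1/2) * u) (- (sqrt (2 * u) * x)) =
          (2 / (u * (k_bar u)^2 * (1 + x^2))) powr (1/4) *
          exp (\<Sum>s=1..m. (-1)^s * E_bar (2 * s) (beta_bar x) / u^(2 * s)) *
          sin (u * xi_bar x + 1/4 * pi
               - (\<Sum>s=0..m. (-1)^s * E_bar (2 * s + 1) (beta_bar x) / u^(2 * s + 1))
               + eps_tilde m u x) *
          cmod (1 + eta_bar m u x))
   \<and> eps m \<in> O[at_top](\<lambda>u. 1 / u^(2 * m + 2))
   \<and> (\<exists>C u0. \<forall>u x :: real. u0 \<le> u \<longrightarrow> 0 < u \<longrightarrow> 0 \<le> x \<longrightarrow>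
         cmod (eta_bar m u x) \<le> C / u^(2 * m + 2))
   \<and> (\<exists>C u0. \<forall>u x :: real. u0 \<le> u \<longrightarrow> 0 < u \<longrightarrow> 0 \<le> x \<longrightarrow>
         \<bar>eps_tilde m u x\<bar> \<le> C / u^(2 * m + 2))
   \<and> (\<forall>u::real. u > 0 \<longrightarrow> (eta_bar m u \<longlongrightarrow> 0) at_top)"
proof -
  obtain K where K: "K \<ge> 0" "\<And>u x. u \<ge> 1 \<Longrightarrow> x \<ge> 0 \<Longrightarrow> norm (eta_bar m u x) \<le> K / u ^ (2 * m + 2)"
    using eta_bar_bound[of m] by blast
  obtain C u0 where C: "C \<ge> 0" "u0 \<ge> 1" "\<And>u. u \<ge> u0 \<Longrightarrow> \<bar>eps m u\<bar> \<le> C / u ^ (2 * m + 2)"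
    "\<And>u x. u \<ge> u0 \<Longrightarrow> x \<ge> 0 \<Longrightarrow> \<bar>Arg (1 + eta_bar m u x)\<bar> \<le> C / u ^ (2 * m + 2)"
    using eps_bound[of m] by blast
  have "eps m \<in> O[at_top](\<lambda>u. 1 / u^(2 * m + 2))"
  proof (rule bigoI)
    show "eventually (\<lambda>u. norm (eps m u) \<le> C * norm (1 / u^(2 * m + 2))) at_top"
      using eventually_ge_at_top[of u0]
    proof eventually_elim
      case (elim u)
      have "u > 0" using elim C(2) by simp
      then show ?case using C(3)[OF elim] by simp
    qed
  qed
  moreover have "\<bar>eps_tilde m u x\<bar> \<le> 2 * C / u^(2 * m + 2)" if "u0 \<le> u" "0 \<le> x" for u x
    using C(3)[OF that(1)] C(4)[OF that] unfolding eps_tilde_def by simp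
  ultimately show ?thesis
    using weber_W_pos weber_W_neg K(2) eta_bar_tendsto_0 by (intro conjI) blast+
qed

end
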